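(* Let $k$ be a field of prime characteristic $p$, let $A\in pdCom_k$ be a divided powers algebra, let $I=\ker(\mu)$ be the kernel of the multiplication map $\mu:A\otimes_k A\to A$, and let $M$ be a $V(A)$-module. Then there is a bijection $$\mathrm{Hom}_{V(A)}(I/I^2,M)\simeq \mathrm{Der}_p(A,M),$$ and there is an isomorphism of $V(A)$-modules $$I/I^2\simeq \Omega_p(A).$$
   Context: Let $k$ be a field of prime characteristic $p$. An object of $pdCom_k$ (a divided powers algebra) is a pair $(A,\pi)$ where $A=k\oplus A_+$ is a commutative augmented $k$-algebra with augmentation ideal $A_+$, and $\pi:A_+\to A_+$ is a map (the $p$-map) such that: $x^p=0$ for $x\in A_+$; $\pi(x+y)=\pi(x)+\pi(y)+\sum_{j=1}^{p-1}\frac{(-1)^j}{j}x^jy^{p-j}$ for $x,y\in A_+$; $\pi(xy)=0$ for $x,y\in A_+$; $\pi(\lambda x)=\lambda^p\pi(x)$ for $\lambda\in k$, $x\in A_+$. (This is equivalent to a system of divided powers $\gamma_i$ on $A_+$, with $\gamma_p=\pi$.) Let $k[P]=\{\sum_{i=0}^n\lambda_iP^i\}$ be the skew polynomial ring with $P\lambda=\lambda^pP$ for $\lambda\in k$. The ring $V(A)$ has underlying $k$-module $A\otimes_k k[P]$, with multiplication determined by $(a\otimes1)(a'\otimes1)=aa'\otimes1$, $(1\otimes q)(1\otimes q')=1\otimes qq'$, $(a\otimes1)(1\otimes P)=a\otimes P$ for $a,a'\in A$, $q,q'\in k[P]$; $(1\otimes P)(a\otimes1)=0$ for $a\in A_+$;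 and $(1\otimes P)(\lambda\otimes1)=\lambda^p\otimes P$ for $\lambda\in k$. A (left) $V(A)$-module is the same as a Beck $A$-module, i.e. a pair $(M,\pi)$ with $M$ an $A$-module and $\pi:M\to M$ additive with $\pi(\lambda m)=\lambda^p\pi(m)$ for $\lambda\in k$ and $\pi(am)=0$ for $a\in A_+$, $m\in M$; the correspondence is $Pm:=(1\otimes P)m=\pi(m)$, $am:=(a\otimes 1)m$. For a $V(A)$-module $M$, the group of Beck derivations is $\mathrm{Der}_p(A,M)=\{D\in \mathrm{Der}_k(A,M)\mid D(\pi(a))=P D(a)-a^{p-1}D(a)\ \text{for all } a\in A_+\}$. $\Omega_p(A)$ is the $V(A)$-module generated by symbols $da$, $a\in A$, with relations $d(\lambda)=0$, $d(\lambda a+\mu b)=\lambda\,da+\mu\,db$, $d(ab)=a\,db+b\,da$, $d(\pi(c))=P\,dc-c^{p-1}dc$, for $a,b\in A$, $c\in A_+$, $\lambda,\mu\in k$. The algebra $T=A\otimes_kA$ is an object of $pdCom_k$ with augmentation ideal $T_+=(k\otimes A_+)\oplus(A_+\otimes k)\oplus(A_+\otimes A_+)$ and the $p$-map determined by $\pi(a\otimes1)=\pi(a)\otimes1$, $\pi(1\otimes a)=1\otimes\pi(a)$ for $a\in A_+$. The map $\mu$ is a morphism in $pdCom_k$, so $I\subset T_+$ satisfies $\pi(I)\subset I$, and $\pi$ induces a map $\pi:I/I^2\to I/I^2$ making the $A$-module of Kähler differentials $I/I^2$ a Beck $A$-module, i.e. a $V(A)$-module. *)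

theory Defs
  imports "HOL-Algebra.UnivPoly" "HOL-Algebra.QuotRing" "HOL-Algebra.Ideal_Product"
    "HOL-Computational_Algebra.Primes"
begin

section \<open>Left modules over a ring that need not be commutative\<close>

text \<open>
  The library locale \<open>module\<close> requires a commutative ring of scalars, which \<open>V(A)\<close> is not.
  As in the library, modules are records of type \<open>module\<close>; the fields \<open>mult\<close> and \<open>one\<close> play
  no role for a mere module.
\<close>

locale left_module = R?: ring R + M?: abelian_group M
  for R :: "('r, 'c) ring_scheme" and M :: "('r, 'm, 'd) module_scheme" +
  assumes smult_closed:
      "\<lbrakk>a \<in> carrier R; x \<in> carrier M\<rbrakk> \<Longrightarrow> a \<odot>\<^bsub>M\<^esub> x \<in> carrier M"
    and smult_l_distr:
      "\<lbrakk>a \<in> carrier R; b \<in> carrier R; x \<in> carrier M\<rbrakk> \<Longrightarrow>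
        (a \<oplus>\<^bsub>R\<^esub> b) \<odot>\<^bsub>M\<^esub> x = (a \<odot>\<^bsub>M\<^esub> x) \<oplus>\<^bsub>M\<^esub> (b \<odot>\<^bsub>M\<^esub> x)"
    and smult_r_distr:
      "\<lbrakk>a \<in> carrier R; x \<in> carrier M; y \<in> carrier M\<rbrakk> \<Longrightarrow>
        a \<odot>\<^bsub>M\<^esub> (x \<oplus>\<^bsub>M\<^esub> y) = (a \<odot>\<^bsub>M\<^esub> x) \<oplus>\<^bsub>M\<^esub> (a \<odot>\<^bsub>M\<^esub> y)"
    and smult_assoc1:
      "\<lbrakk>a \<in> carrier R; b \<in> carrier R; x \<in> carrier M\<rbrakk> \<Longrightarrow>
        (a \<otimes>\<^bsub>R\<^esub> b) \<odot>\<^bsub>M\<^esub> x = a \<odot>\<^bsub>M\<^esub> (b \<odot>\<^bsub>M\<^esub> x)"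
    and smult_one:
      "x \<in> carrier M \<Longrightarrow> \<one>\<^bsub>R\<^esub> \<odot>\<^bsub>M\<^esub> x = x"

text \<open>Homomorphisms are extensional functions, so that sets of homomorphisms have no
  duplicates coming from values outside the carrier.\<close>

definition module_Hom ::
  "('r, 'c) ring_scheme \<Rightarrow> ('r, 'm, 'd) module_scheme \<Rightarrow> ('r, 'n, 'e) module_scheme \<Rightarrow> ('m \<Rightarrow> 'n) set"
  where "module_Hom R M N = {f \<in> carrier M \<rightarrow>\<^sub>E carrier N.
    (\<forall>x\<in>carrier M. \<forall>y\<in>carrier M. f (x \<oplus>\<^bsub>M\<^esub> y) = f x \<oplus>\<^bsub>N\<^esub> f y) \<and>
    (\<forall>r\<in>carrier R. \<forall>x\<in>carrier M. f (r \<odot>\<^bsub>M\<^esub> x) = r \<odot>\<^bsub>N\<^esub> f x)}"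

definition module_isomorphic ::
  "('r, 'c) ring_scheme \<Rightarrow> ('r, 'm, 'd) module_scheme \<Rightarrow> ('r, 'n, 'e) module_scheme \<Rightarrow> bool"
  where "module_isomorphic R M N \<longleftrightarrow>
    (\<exists>f \<in> module_Hom R M N. bij_betw f (carrier M) (carrier N))"

definition free_module :: "('r, 'c) ring_scheme \<Rightarrow> 'b set \<Rightarrow> ('r, 'b \<Rightarrow> 'r) module"
  where "free_module R S = \<lparr>
    carrier = {f. range f \<subseteq> carrier R \<and> finite {s. f s \<noteq> \<zero>\<^bsub>R\<^esub>} \<and> {s. f s \<noteq> \<zero>\<^bsub>R\<^esub>} \<subseteq> S},
    monoid.mult = undefined, one = undefined,
    ring.zero = (\<lambda>_. \<zero>\<^bsub>R\<^esub>),
    ring.add = (\<lambda>f g s. f s \<oplus>\<^bsub>R\<^esub> g s),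
    smult = (\<lambda>r f s. r \<otimes>\<^bsub>R\<^esub> f s)\<rparr>"

definition free_gen :: "('r, 'c) ring_scheme \<Rightarrow> 'b \<Rightarrow> 'b \<Rightarrow> 'r"
  where "free_gen R s = (\<lambda>t. if t = s then \<one>\<^bsub>R\<^esub> else \<zero>\<^bsub>R\<^esub>)"

definition gen_submodule ::
  "('r, 'c) ring_scheme \<Rightarrow> ('r, 'm, 'd) module_scheme \<Rightarrow> 'm set \<Rightarrow> 'm set"
  where "gen_submodule R M S = \<Inter>{N. submodule N R M \<and> S \<subseteq> N}"

text \<open>The quotient by a submodule \<open>N\<close>. As a ring it is \<^term>\<open>M Quot N\<close>, which is meaningful
  when \<open>M\<close> is an algebra and \<open>N\<close> an ideal of it.\<close>

definition quot_module ::
  "('r, 'm, 'd) module_scheme \<Rightarrow> 'm set \<Rightarrow> ('r, 'm set) module"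
  where "quot_module M N = \<lparr>
    carrier = a_rcosets\<^bsub>M\<^esub> N,
    monoid.mult = rcoset_mult M N,
    one = N +>\<^bsub>M\<^esub> \<one>\<^bsub>M\<^esub>,
    ring.zero = N,
    ring.add = set_add M,
    smult = (\<lambda>r Y. \<Union>x\<in>Y. N +>\<^bsub>M\<^esub> (r \<odot>\<^bsub>M\<^esub> x))\<rparr>"


section \<open>Divided powers algebras\<close>

locale char_p_field = field k for p :: nat and k :: "('k, 'c) ring_scheme" +
  assumes prime_p: "Factorial_Ring.prime p"
    and characteristic: "add_pow k (n :: nat) \<one>\<^bsub>k\<^esub> = \<zero>\<^bsub>k\<^esub> \<longleftrightarrow> p dvd n"

locale augmented_algebra = algebra k A
  for k :: "('k, 'c) ring_scheme" and A :: "('k, 'a, 'd) module_scheme" +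
  fixes eps :: "'a \<Rightarrow> 'k"
  assumes eps_hom: "eps \<in> ring_hom A k"
    and eps_smult: "\<lbrakk>l \<in> carrier k; x \<in> carrier A\<rbrakk> \<Longrightarrow> eps (l \<odot>\<^bsub>A\<^esub> x) = l \<otimes>\<^bsub>k\<^esub> eps x"

abbreviation aug_ideal ::
  "('k, 'c) ring_scheme \<Rightarrow> ('a, 'd) ring_scheme \<Rightarrow> ('a \<Rightarrow> 'k) \<Rightarrow> 'a set"
  where "aug_ideal k A eps \<equiv> a_kernel A k eps"

text \<open>The sum over \<open>j = 1, \<dots>, p - 1\<close> of \<open>((-1)^j / j) x^j y^(p-j)\<close>.\<close>

definition pd_cross ::
  "nat \<Rightarrow> ('k, 'c) ring_scheme \<Rightarrow> ('k, 'a, 'd) module_scheme \<Rightarrow> 'a \<Rightarrow> 'a \<Rightarrow> 'a"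
  where "pd_cross p k A x y = (\<Oplus>\<^bsub>A\<^esub>j\<in>{1..p - 1}.
    (((\<ominus>\<^bsub>k\<^esub> \<one>\<^bsub>k\<^esub>) [^]\<^bsub>k\<^esub> j) \<otimes>\<^bsub>k\<^esub> inv\<^bsub>k\<^esub> (add_pow k j \<one>\<^bsub>k\<^esub>))
      \<odot>\<^bsub>A\<^esub> ((x [^]\<^bsub>A\<^esub> j) \<otimes>\<^bsub>A\<^esub> (y [^]\<^bsub>A\<^esub> (p - j))))"

text \<open>Only the values of \<open>\<pi>\<close> on the augmentation ideal matter.\<close>

locale pd_algebra = augmented_algebra k A eps
  for p :: nat and k :: "('k, 'c) ring_scheme" and A :: "('k, 'a, 'd) module_scheme"
    and eps :: "'a \<Rightarrow> 'k" +
  fixes \<pi> :: "'a \<Rightarrow> 'a"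
  assumes pi_closed: "x \<in> aug_ideal k A eps \<Longrightarrow> \<pi> x \<in> aug_ideal k A eps"
    and pow_p: "x \<in> aug_ideal k A eps \<Longrightarrow> x [^]\<^bsub>A\<^esub> p = \<zero>\<^bsub>A\<^esub>"
    and pi_add: "\<lbrakk>x \<in> aug_ideal k A eps; y \<in> aug_ideal k A eps\<rbrakk> \<Longrightarrow>
      \<pi> (x \<oplus>\<^bsub>A\<^esub> y) = \<pi> x \<oplus>\<^bsub>A\<^esub> \<pi> y \<oplus>\<^bsub>A\<^esub> pd_cross p k A x y"
    and pi_mult: "\<lbrakk>x \<in> aug_ideal k A eps; y \<in> aug_ideal k A eps\<rbrakk> \<Longrightarrow> \<pi> (x \<otimes>\<^bsub>A\<^esub> y) = \<zero>\<^bsub>A\<^esub>"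
    and pi_smult: "\<lbrakk>l \<in> carrier k; x \<in> aug_ideal k A eps\<rbrakk> \<Longrightarrow>
      \<pi> (l \<odot>\<^bsub>A\<^esub> x) = (l [^]\<^bsub>k\<^esub> p) \<odot>\<^bsub>A\<^esub> \<pi> x"


section \<open>The ring \<open>V(A)\<close>\<close>

text \<open>
  The powers of \<open>P\<close> form a basis of \<open>k[P]\<close> as a left vector space, so an element of
  \<open>A \<otimes> k[P]\<close> is uniquely a sum of terms \<open>a\<^sub>i \<otimes> P^i\<close>; it is represented by the finitely
  supported sequence of the \<open>a\<^sub>i\<close>, i.e. by an element of \<^term>\<open>up A\<close>. The underlying
  left \<open>A\<close>-module is thus that of the polynomial ring \<^term>\<open>UP A\<close>; only the product changes.

  The rules for the product give, for \<open>b\<close> in \<open>A\<close> and \<open>i > 0\<close>,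
  \<open>(1 \<otimes> P^i) (b \<otimes> 1) = \<epsilon>(b)^(p^i) \<otimes> P^i\<close>, because \<open>b\<close> and \<open>\<epsilon>(b)\<close> differ by an element
  of the augmentation ideal. Hence \<open>(a \<otimes> P^i) (b \<otimes> P^j) = a b' \<otimes> P^(i+j)\<close>
  with \<open>b'\<close> equal to \<open>V_twist\<close> of \<open>b\<close>.
\<close>

definition V_twist ::
  "nat \<Rightarrow> ('k, 'c) ring_scheme \<Rightarrow> ('k, 'a, 'd) module_scheme \<Rightarrow> ('a \<Rightarrow> 'k) \<Rightarrow> nat \<Rightarrow> 'a \<Rightarrow> 'a"
  where "V_twist p k A eps i b =
    (if i = 0 then b else (eps b [^]\<^bsub>k\<^esub> (p ^ i)) \<odot>\<^bsub>A\<^esub> \<one>\<^bsub>A\<^esub>)"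

definition V_ring ::
  "nat \<Rightarrow> ('k, 'c) ring_scheme \<Rightarrow> ('k, 'a, 'd) module_scheme \<Rightarrow> ('a \<Rightarrow> 'k) \<Rightarrow> (nat \<Rightarrow> 'a) ring"
  where "V_ring p k A eps = \<lparr>
    carrier = up A,
    monoid.mult = (\<lambda>f g n. \<Oplus>\<^bsub>A\<^esub>i\<in>{..n}. f i \<otimes>\<^bsub>A\<^esub> V_twist p k A eps i (g (n - i))),
    one = \<one>\<^bsub>UP A\<^esub>,
    ring.zero = \<zero>\<^bsub>UP A\<^esub>,
    ring.add = (\<lambda>f g. f \<oplus>\<^bsub>UP A\<^esub> g)\<rparr>"

text \<open>The elements \<open>a \<otimes> 1\<close> and \<open>1 \<otimes> P\<close>.\<close>

definition V_of :: "('a, 'd) ring_scheme \<Rightarrow> 'a \<Rightarrow> nat \<Rightarrow> 'a"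
  where "V_of A a = monom (UP A) a 0"

definition V_P :: "('a, 'd) ring_scheme \<Rightarrow> nat \<Rightarrow> 'a"
  where "V_P A = monom (UP A) \<one>\<^bsub>A\<^esub> 1"

text \<open>The \<open>V(A)\<close>-module attached to a Beck module, i.e. to an \<open>A\<close>-module \<open>M\<close> with a
  map \<open>P\<close>: the element \<open>\<Sum> a\<^sub>i \<otimes> P^i\<close> sends \<open>m\<close> to \<open>\<Sum> a\<^sub>i P^i(m)\<close>.\<close>

definition beck_V_module ::
  "('a, 'c) ring_scheme \<Rightarrow> ('a, 'm, 'd) module_scheme \<Rightarrow> ('m \<Rightarrow> 'm) \<Rightarrow> (nat \<Rightarrow> 'a, 'm) module"
  where "beck_V_module A M P = \<lparr>
    carrier = carrier M, monoid.mult = monoid.mult M, one = \<one>\<^bsub>M\<^esub>, ring.zero = \<zero>\<^bsub>M\<^esub>, ring.add = ring.add M,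
    smult = (\<lambda>v m. \<Oplus>\<^bsub>M\<^esub>i\<in>{i. v i \<noteq> \<zero>\<^bsub>A\<^esub>}. v i \<odot>\<^bsub>M\<^esub> ((P ^^ i) m))\<rparr>"


section \<open>Beck derivations and \<open>\<Omega>\<^sub>p(A)\<close>\<close>

definition Der_k ::
  "('k, 'c) ring_scheme \<Rightarrow> ('k, 'a, 'd) module_scheme \<Rightarrow> (nat \<Rightarrow> 'a, 'm, 'e) module_scheme \<Rightarrow>
    ('a \<Rightarrow> 'm) set"
  where "Der_k k A M = {D \<in> carrier A \<rightarrow>\<^sub>E carrier M.
    (\<forall>a\<in>carrier A. \<forall>b\<in>carrier A. D (a \<oplus>\<^bsub>A\<^esub> b) = D a \<oplus>\<^bsub>M\<^esub> D b) \<and>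
    (\<forall>l\<in>carrier k. \<forall>a\<in>carrier A. D (l \<odot>\<^bsub>A\<^esub> a) = V_of A (l \<odot>\<^bsub>A\<^esub> \<one>\<^bsub>A\<^esub>) \<odot>\<^bsub>M\<^esub> D a) \<and>
    (\<forall>a\<in>carrier A. \<forall>b\<in>carrier A.
      D (a \<otimes>\<^bsub>A\<^esub> b) = (V_of A a \<odot>\<^bsub>M\<^esub> D b) \<oplus>\<^bsub>M\<^esub> (V_of A b \<odot>\<^bsub>M\<^esub> D a))}"

definition Der_p ::
  "nat \<Rightarrow> ('k, 'c) ring_scheme \<Rightarrow> ('k, 'a, 'd) module_scheme \<Rightarrow> ('a \<Rightarrow> 'k) \<Rightarrow> ('a \<Rightarrow> 'a) \<Rightarrow>
    (nat \<Rightarrow> 'a, 'm, 'e) module_scheme \<Rightarrow> ('a \<Rightarrow> 'm) set"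
  where "Der_p p k A eps \<pi> M = {D \<in> Der_k k A M. \<forall>a \<in> aug_ideal k A eps.
    D (\<pi> a) = (V_P A \<odot>\<^bsub>M\<^esub> D a) \<ominus>\<^bsub>M\<^esub> (V_of A (a [^]\<^bsub>A\<^esub> (p - 1)) \<odot>\<^bsub>M\<^esub> D a)}"

definition Omega_rels ::
  "nat \<Rightarrow> ('k, 'c) ring_scheme \<Rightarrow> ('k, 'a, 'd) module_scheme \<Rightarrow> ('a \<Rightarrow> 'k) \<Rightarrow> ('a \<Rightarrow> 'a) \<Rightarrow>
    ('a \<Rightarrow> nat \<Rightarrow> 'a) set"
  where "Omega_rels p k A eps \<pi> =
    (let V = V_ring p k A eps; F = free_module V (carrier A); d = free_gen V;
         s = (\<lambda>l. V_of A (l \<odot>\<^bsub>A\<^esub> \<one>\<^bsub>A\<^esub>))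
     in {d (l \<odot>\<^bsub>A\<^esub> \<one>\<^bsub>A\<^esub>) | l. l \<in> carrier k}
      \<union> {d ((l \<odot>\<^bsub>A\<^esub> a) \<oplus>\<^bsub>A\<^esub> (m \<odot>\<^bsub>A\<^esub> b)) \<ominus>\<^bsub>F\<^esub> ((s l \<odot>\<^bsub>F\<^esub> d a) \<oplus>\<^bsub>F\<^esub> (s m \<odot>\<^bsub>F\<^esub> d b)) | l m a b.
          l \<in> carrier k \<and> m \<in> carrier k \<and> a \<in> carrier A \<and> b \<in> carrier A}
      \<union> {d (a \<otimes>\<^bsub>A\<^esub> b) \<ominus>\<^bsub>F\<^esub> ((V_of A a \<odot>\<^bsub>F\<^esub> d b) \<oplus>\<^bsub>F\<^esub> (V_of A b \<odot>\<^bsub>F\<^esub> d a)) | a b.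
          a \<in> carrier A \<and> b \<in> carrier A}
      \<union> {d (\<pi> c) \<ominus>\<^bsub>F\<^esub> ((V_P A \<odot>\<^bsub>F\<^esub> d c) \<ominus>\<^bsub>F\<^esub> (V_of A (c [^]\<^bsub>A\<^esub> (p - 1)) \<odot>\<^bsub>F\<^esub> d c)) | c.
          c \<in> aug_ideal k A eps})"

definition Omega_p ::
  "nat \<Rightarrow> ('k, 'c) ring_scheme \<Rightarrow> ('k, 'a, 'd) module_scheme \<Rightarrow> ('a \<Rightarrow> 'k) \<Rightarrow> ('a \<Rightarrow> 'a) \<Rightarrow>
    (nat \<Rightarrow> 'a, ('a \<Rightarrow> nat \<Rightarrow> 'a) set) module"
  where "Omega_p p k A eps \<pi> =
    (let V = V_ring p k A eps; F = free_module V (carrier A)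
     in quot_module F (gen_submodule V F (Omega_rels p k A eps \<pi>)))"


section \<open>The algebra \<open>A \<otimes> A\<close>\<close>

definition monoid_algebra ::
  "('k, 'c) ring_scheme \<Rightarrow> ('g, 'd) monoid_scheme \<Rightarrow> ('k, 'g \<Rightarrow> 'k) module"
  where "monoid_algebra k G = (free_module k (carrier G))\<lparr>
    monoid.mult := (\<lambda>f g z. \<Oplus>\<^bsub>k\<^esub>w\<in>{w. f (fst w) \<noteq> \<zero>\<^bsub>k\<^esub> \<and> g (snd w) \<noteq> \<zero>\<^bsub>k\<^esub> \<and> fst w \<otimes>\<^bsub>G\<^esub> snd w = z}.
      f (fst w) \<otimes>\<^bsub>k\<^esub> g (snd w)),
    one := free_gen k \<one>\<^bsub>G\<^esub>\<rparr>"

text \<open>The free vector space on the pairs \<open>(a, b)\<close>, with \<open>(a, b) (a', b') = (a a', b b')\<close>.\<close>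

abbreviation pair_algebra ::
  "('k, 'c) ring_scheme \<Rightarrow> ('k, 'a, 'd) module_scheme \<Rightarrow> ('k, 'a \<times> 'a \<Rightarrow> 'k) module"
  where "pair_algebra k A \<equiv> monoid_algebra k (A \<times>\<times> A)"

definition bilinear_rels ::
  "('k, 'c) ring_scheme \<Rightarrow> ('k, 'a, 'd) module_scheme \<Rightarrow> ('a \<times> 'a \<Rightarrow> 'k) set"
  where "bilinear_rels k A =
    (let F = pair_algebra k A; e = free_gen k
     in {e (a \<oplus>\<^bsub>A\<^esub> a', b) \<ominus>\<^bsub>F\<^esub> (e (a, b) \<oplus>\<^bsub>F\<^esub> e (a', b)) | a a' b.
          a \<in> carrier A \<and> a' \<in> carrier A \<and> b \<in> carrier A}
      \<union> {e (a, b \<oplus>\<^bsub>A\<^esub> b') \<ominus>\<^bsub>F\<^esub> (e (a, b) \<oplus>\<^bsub>F\<^esub> e (a, b')) | a b b'.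
          a \<in> carrier A \<and> b \<in> carrier A \<and> b' \<in> carrier A}
      \<union> {e (l \<odot>\<^bsub>A\<^esub> a, b) \<ominus>\<^bsub>F\<^esub> (l \<odot>\<^bsub>F\<^esub> e (a, b)) | l a b.
          l \<in> carrier k \<and> a \<in> carrier A \<and> b \<in> carrier A}
      \<union> {e (a, l \<odot>\<^bsub>A\<^esub> b) \<ominus>\<^bsub>F\<^esub> (l \<odot>\<^bsub>F\<^esub> e (a, b)) | l a b.
          l \<in> carrier k \<and> a \<in> carrier A \<and> b \<in> carrier A})"

text \<open>The subspace spanned by the bilinearity relations, which is an ideal.\<close>

definition tensor_null ::
  "('k, 'c) ring_scheme \<Rightarrow> ('k, 'a, 'd) module_scheme \<Rightarrow> ('a \<times> 'a \<Rightarrow> 'k) set"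
  where "tensor_null k A = gen_submodule k (pair_algebra k A) (bilinear_rels k A)"

definition tensor_square ::
  "('k, 'c) ring_scheme \<Rightarrow> ('k, 'a, 'd) module_scheme \<Rightarrow> ('k, ('a \<times> 'a \<Rightarrow> 'k) set) module"
  where "tensor_square k A = quot_module (pair_algebra k A) (tensor_null k A)"

definition tens ::
  "('k, 'c) ring_scheme \<Rightarrow> ('k, 'a, 'd) module_scheme \<Rightarrow> 'a \<Rightarrow> 'a \<Rightarrow> ('a \<times> 'a \<Rightarrow> 'k) set"
  where "tens k A a b = tensor_null k A +>\<^bsub>pair_algebra k A\<^esub> free_gen k (a, b)"

text \<open>\<open>\<mu>(\<Sum> a \<otimes> b) = \<Sum> a b\<close>; the image below is a singleton because the bilinearity
  relations are mapped to zero.\<close>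

definition mult_map ::
  "('k, 'c) ring_scheme \<Rightarrow> ('k, 'a, 'd) module_scheme \<Rightarrow> ('a \<times> 'a \<Rightarrow> 'k) set \<Rightarrow> 'a"
  where "mult_map k A Y = the_elem
    ((\<lambda>f. \<Oplus>\<^bsub>A\<^esub>z\<in>{z. f z \<noteq> \<zero>\<^bsub>k\<^esub>}. f z \<odot>\<^bsub>A\<^esub> (fst z \<otimes>\<^bsub>A\<^esub> snd z)) ` Y)"

text \<open>The augmentation \<open>a \<otimes> b \<mapsto> \<epsilon>(a) \<epsilon>(b)\<close>, whose kernel is \<open>T\<^sub>+\<close>.\<close>

definition tensor_eps ::
  "('k, 'c) ring_scheme \<Rightarrow> ('k, 'a, 'd) module_scheme \<Rightarrow> ('a \<Rightarrow> 'k) \<Rightarrow> ('a \<times> 'a \<Rightarrow> 'k) set \<Rightarrow> 'k"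
  where "tensor_eps k A eps Y = eps (mult_map k A Y)"

definition tensor_pi ::
  "nat \<Rightarrow> ('k, 'c) ring_scheme \<Rightarrow> ('k, 'a, 'd) module_scheme \<Rightarrow> ('a \<Rightarrow> 'k) \<Rightarrow> ('a \<Rightarrow> 'a) \<Rightarrow>
    ('a \<times> 'a \<Rightarrow> 'k) set \<Rightarrow> ('a \<times> 'a \<Rightarrow> 'k) set"
  where "tensor_pi p k A eps \<pi> = (THE q.
    q \<in> extensional (aug_ideal k (tensor_square k A) (tensor_eps k A eps)) \<and>
    pd_algebra p k (tensor_square k A) (tensor_eps k A eps) q \<and>
    (\<forall>a \<in> aug_ideal k A eps.
      q (tens k A a \<one>\<^bsub>A\<^esub>) = tens k A (\<pi> a) \<one>\<^bsub>A\<^esub> \<and>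
      q (tens k A \<one>\<^bsub>A\<^esub> a) = tens k A \<one>\<^bsub>A\<^esub> (\<pi> a)))"


section \<open>The module \<open>I/I\<^sup>2\<close>\<close>

definition diag_ideal ::
  "('k, 'c) ring_scheme \<Rightarrow> ('k, 'a, 'd) module_scheme \<Rightarrow> ('a \<times> 'a \<Rightarrow> 'k) set set"
  where "diag_ideal k A = a_kernel (tensor_square k A) A (mult_map k A)"

definition diag_ideal_sq ::
  "('k, 'c) ring_scheme \<Rightarrow> ('k, 'a, 'd) module_scheme \<Rightarrow> ('a \<times> 'a \<Rightarrow> 'k) set set"
  where "diag_ideal_sq k A = ideal_prod (tensor_square k A) (diag_ideal k A) (diag_ideal k A)"

text \<open>\<open>I\<close> as an \<open>A\<close>-module through \<open>a \<mapsto> a \<otimes> 1\<close>. Using \<open>1 \<otimes> a\<close> instead gives the same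
  action on \<open>I/I\<^sup>2\<close>.\<close>

definition diag_module ::
  "('k, 'c) ring_scheme \<Rightarrow> ('k, 'a, 'd) module_scheme \<Rightarrow> ('a, ('a \<times> 'a \<Rightarrow> 'k) set) module"
  where "diag_module k A = \<lparr>
    carrier = diag_ideal k A,
    monoid.mult = monoid.mult (tensor_square k A), one = \<one>\<^bsub>tensor_square k A\<^esub>,
    ring.zero = \<zero>\<^bsub>tensor_square k A\<^esub>, ring.add = ring.add (tensor_square k A),
    smult = (\<lambda>a x. tens k A a \<one>\<^bsub>A\<^esub> \<otimes>\<^bsub>tensor_square k A\<^esub> x)\<rparr>"

definition cotangent_pi ::
  "nat \<Rightarrow> ('k, 'c) ring_scheme \<Rightarrow> ('k, 'a, 'd) module_scheme \<Rightarrow> ('a \<Rightarrow> 'k) \<Rightarrow> ('a \<Rightarrow> 'a) \<Rightarrow>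
    ('a \<times> 'a \<Rightarrow> 'k) set set \<Rightarrow> ('a \<times> 'a \<Rightarrow> 'k) set set"
  where "cotangent_pi p k A eps \<pi> Y =
    (\<Union>x\<in>Y. diag_ideal_sq k A +>\<^bsub>tensor_square k A\<^esub> tensor_pi p k A eps \<pi> x)"

definition cotangent ::
  "nat \<Rightarrow> ('k, 'c) ring_scheme \<Rightarrow> ('k, 'a, 'd) module_scheme \<Rightarrow> ('a \<Rightarrow> 'k) \<Rightarrow> ('a \<Rightarrow> 'a) \<Rightarrow>
    (nat \<Rightarrow> 'a, ('a \<times> 'a \<Rightarrow> 'k) set set) module"
  where "cotangent p k A eps \<pi> =
    beck_V_module A (quot_module (diag_module k A) (diag_ideal_sq k A)) (cotangent_pi p k A eps \<pi>)"

text \<open>The class of \<open>1 \<otimes> a - a \<otimes> 1\<close>.\<close>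

definition cotangent_d ::
  "('k, 'c) ring_scheme \<Rightarrow> ('k, 'a, 'd) module_scheme \<Rightarrow> 'a \<Rightarrow> ('a \<times> 'a \<Rightarrow> 'k) set set"
  where "cotangent_d k A a = diag_ideal_sq k A +>\<^bsub>tensor_square k A\<^esub>
    (tens k A \<one>\<^bsub>A\<^esub> a \<ominus>\<^bsub>tensor_square k A\<^esub> tens k A a \<one>\<^bsub>A\<^esub>)"

end

theory Submission
  imports Defs
begin

text \<open>
  As for Kaehler differentials, \<open>I\<close> is generated over \<open>A\<close> by the elements \<open>1 \<otimes> a - a \<otimes> 1\<close>, so a
  homomorphism out of \<open>I/I\<^sup>2\<close> is determined by the derivation it induces, and a derivation \<open>\<delta>\<close>
  comes from the map \<open>a \<otimes> b \<mapsto> a \<delta>(b)\<close>. Modulo \<open>I\<^sup>2\<close> the cross terms in \<open>\<pi>(1 \<otimes> c)\<close>, for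
  \<open>1 \<otimes> c = c \<otimes> 1 + (1 \<otimes> c - c \<otimes> 1)\<close>, reduce to \<open>-c^(p-1)\<close> times \<open>1 \<otimes> c - c \<otimes> 1\<close>, so that
  compatibility with the \<open>p\<close>-maps is exactly the additional axiom of a Beck derivation. The
  isomorphism with \<open>\<Omega>\<^sub>p(A)\<close> then compares two universal properties.

  The \<open>p\<close>-map of \<open>A \<otimes> A\<close> is obtained by linear algebra: a \<open>p\<close>-map on a nil ideal \<open>J\<close> is a linear
  section of an extension of \<open>J\<close> whose addition is twisted by the cross terms, and such a section
  can be prescribed on \<open>A \<otimes> A\<close> by a bilinear map.
\<close>

section \<open>Modules, free modules and quotients\<close>

text \<open>The p-map of A \<otimes> A is given only by a definite description. It is not additive,
  and sums of tensors have no normal form, so it can be prescribed neither on representatives nor by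
  plain bilinearity; this forces the twisted extension. The addition there is a group law because
  ((x+y)^p - x^p - y^p)/p is a symmetric 2-cocycle, which is checked with the integer coefficients
  \<open>(p choose j) div p\<close>; in k these are the coefficients (-1)^j/j up to sign. Scalars
  act on the second coordinate through l^p, and (l + m)v = lv + mv holds because the cross term of
  lx and mx is a multiple of x^p = 0: this is where nilpotence enters. Uniqueness follows since T_+
  is spanned additively by tensors a \<otimes> 1, 1 \<otimes> b and products of these.

  For V(A), everything is reduced to the elements a \<otimes> 1 and 1 \<otimes> P: an element v is
  its constant coefficient plus a right multiple of P, so linearity of maps and associativity of the
  action follow by induction on the degree. The ring axioms of V(A) come with the hypothesis that M
  is a left module over it.\<close>

definition linear_map ::
  "('r, 'c) ring_scheme \<Rightarrow> ('r, 'm, 'd) module_scheme \<Rightarrow> ('r, 'n, 'e) module_scheme \<Rightarrow> ('m \<Rightarrow> 'n) \<Rightarrow> bool"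
  where "linear_map R M N f \<longleftrightarrow> f \<in> carrier M \<rightarrow> carrier N \<and>
    (\<forall>x\<in>carrier M. \<forall>y\<in>carrier M. f (x \<oplus>\<^bsub>M\<^esub> y) = f x \<oplus>\<^bsub>N\<^esub> f y) \<and>
    (\<forall>r\<in>carrier R. \<forall>x\<in>carrier M. f (r \<odot>\<^bsub>M\<^esub> x) = r \<odot>\<^bsub>N\<^esub> f x)"

lemma linear_mapI:
  assumes "\<And>x. x \<in> carrier M \<Longrightarrow> f x \<in> carrier N"
    and "\<And>x y. x \<in> carrier M \<Longrightarrow> y \<in> carrier M \<Longrightarrow> f (x \<oplus>\<^bsub>M\<^esub> y) = f x \<oplus>\<^bsub>N\<^esub> f y"
    and "\<And>r x. r \<in> carrier R \<Longrightarrow> x \<in> carrier M \<Longrightarrow> f (r \<odot>\<^bsub>M\<^esub> x) = r \<odot>\<^bsub>N\<^esub> f x"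
  shows "linear_map R M N f"
  using assms by (auto simp: linear_map_def)

lemma
  assumes "linear_map R M N f" and "x \<in> carrier M"
  shows linear_map_closed: "f x \<in> carrier N"
    and linear_map_add: "y \<in> carrier M \<Longrightarrow> f (x \<oplus>\<^bsub>M\<^esub> y) = f x \<oplus>\<^bsub>N\<^esub> f y"
    and linear_map_smult: "r \<in> carrier R \<Longrightarrow> f (r \<odot>\<^bsub>M\<^esub> x) = r \<odot>\<^bsub>N\<^esub> f x"
  using assms by (auto simp: linear_map_def)

lemma linear_map_compose:
  "linear_map R M N f \<Longrightarrow> linear_map R N L g \<Longrightarrow> linear_map R M L (\<lambda>x. g (f x))"
  by (auto simp: linear_map_def Pi_iff)

text \<open>Extensionality is kept out of \<open>linear_map\<close>, so that linear maps compose as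
  plain functions; it is restored only when a map has to become an element of
  \<open>module_Hom\<close>.\<close>

lemma module_Hom_iff:
  "f \<in> module_Hom R M N \<longleftrightarrow> f \<in> extensional (carrier M) \<and> linear_map R M N f"
  by (auto simp: module_Hom_def linear_map_def PiE_def)

lemma abelian_group_hom_linear_map:
  assumes "abelian_group M" "abelian_group N" "linear_map R M N f"
  shows "abelian_group_hom M N f"
  using assms
  by (intro abelian_group_homI group_hom.intro group_hom_axioms.intro abelian_group.a_group)
     (auto simp: linear_map_def hom_def)

context left_module
begin

lemma lm_smult_r_null: "a \<in> carrier R \<Longrightarrow> a \<odot>\<^bsub>M\<^esub> \<zero>\<^bsub>M\<^esub> = \<zero>\<^bsub>M\<^esub>"
  using smult_r_distr[of a "\<zero>\<^bsub>M\<^esub>" "\<zero>\<^bsub>M\<^esub>"] smult_closed[of a "\<zero>\<^bsub>M\<^esub>"]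
  by (metis M.add.r_cancel_one' M.r_zero M.zero_closed)

lemma lm_smult_l_null: "x \<in> carrier M \<Longrightarrow> \<zero>\<^bsub>R\<^esub> \<odot>\<^bsub>M\<^esub> x = \<zero>\<^bsub>M\<^esub>"
  using smult_l_distr[of "\<zero>\<^bsub>R\<^esub>" "\<zero>\<^bsub>R\<^esub>" x] smult_closed[of "\<zero>\<^bsub>R\<^esub>" x]
  by (metis M.add.r_cancel_one' R.r_zero R.zero_closed)

lemma lm_smult_r_minus:
  assumes "a \<in> carrier R" "x \<in> carrier M"
  shows "a \<odot>\<^bsub>M\<^esub> (\<ominus>\<^bsub>M\<^esub> x) = \<ominus>\<^bsub>M\<^esub> (a \<odot>\<^bsub>M\<^esub> x)"
  using smult_r_distr[of a "\<ominus>\<^bsub>M\<^esub> x" x] assms lm_smult_r_null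
  by (metis M.add.inv_closed M.l_neg M.minus_equality smult_closed)

lemma lm_smult_l_minus:
  assumes "a \<in> carrier R" "x \<in> carrier M"
  shows "(\<ominus>\<^bsub>R\<^esub> a) \<odot>\<^bsub>M\<^esub> x = \<ominus>\<^bsub>M\<^esub> (a \<odot>\<^bsub>M\<^esub> x)"
  using smult_l_distr[of "\<ominus>\<^bsub>R\<^esub> a" a x] assms lm_smult_l_null
  by (metis R.add.inv_closed R.l_neg M.minus_equality smult_closed)

lemma lm_finsum_smult:
  assumes "finite B" "a \<in> carrier R" "f \<in> B \<rightarrow> carrier M"
  shows "a \<odot>\<^bsub>M\<^esub> (\<Oplus>\<^bsub>M\<^esub>i\<in>B. f i) = (\<Oplus>\<^bsub>M\<^esub>i\<in>B. a \<odot>\<^bsub>M\<^esub> f i)"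
  using assms
  by (induct set: finite) (auto simp: lm_smult_r_null Pi_def smult_r_distr smult_closed)

end

lemma module_imp_left_module: "module R M \<Longrightarrow> left_module R M"
  by (auto simp: module_def left_module_def left_module_axioms_def module_axioms_def cring_def)

lemma left_module_imp_module: "cring R \<Longrightarrow> left_module R M \<Longrightarrow> module R M"
  by (auto simp: module_def left_module_def left_module_axioms_def module_axioms_def cring_def)

lemma left_moduleI:
  assumes "ring R" "abelian_group M"
    and "\<And>a x. a \<in> carrier R \<Longrightarrow> x \<in> carrier M \<Longrightarrow> a \<odot>\<^bsub>M\<^esub> x \<in> carrier M"
    and "\<And>a b x. a \<in> carrier R \<Longrightarrow> b \<in> carrier R \<Longrightarrow> x \<in> carrier M \<Longrightarrow>
        (a \<oplus>\<^bsub>R\<^esub> b) \<odot>\<^bsub>M\<^esub> x = (a \<odot>\<^bsub>M\<^esub> x) \<oplus>\<^bsub>M\<^esub> (b \<odot>\<^bsub>M\<^esub> x)"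
    and "\<And>a x y. a \<in> carrier R \<Longrightarrow> x \<in> carrier M \<Longrightarrow> y \<in> carrier M \<Longrightarrow>
        a \<odot>\<^bsub>M\<^esub> (x \<oplus>\<^bsub>M\<^esub> y) = (a \<odot>\<^bsub>M\<^esub> x) \<oplus>\<^bsub>M\<^esub> (a \<odot>\<^bsub>M\<^esub> y)"
    and "\<And>a b x. a \<in> carrier R \<Longrightarrow> b \<in> carrier R \<Longrightarrow> x \<in> carrier M \<Longrightarrow>
        (a \<otimes>\<^bsub>R\<^esub> b) \<odot>\<^bsub>M\<^esub> x = a \<odot>\<^bsub>M\<^esub> (b \<odot>\<^bsub>M\<^esub> x)"
    and "\<And>x. x \<in> carrier M \<Longrightarrow> \<one>\<^bsub>R\<^esub> \<odot>\<^bsub>M\<^esub> x = x"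
  shows "left_module R M"
  using assms by (simp add: left_module_def left_module_axioms_def)

section \<open>Free modules and linear extension\<close>

lemma finite_support_add:
  assumes "ring R" "finite {s. f s \<noteq> \<zero>\<^bsub>R\<^esub>}" "finite {s. g s \<noteq> \<zero>\<^bsub>R\<^esub>}"
  shows "finite {s. f s \<oplus>\<^bsub>R\<^esub> g s \<noteq> \<zero>\<^bsub>R\<^esub>}"
proof -
  interpret ring R by fact
  have "{s. f s \<oplus>\<^bsub>R\<^esub> g s \<noteq> \<zero>\<^bsub>R\<^esub>} \<subseteq> {s. f s \<noteq> \<zero>\<^bsub>R\<^esub>} \<union> {s. g s \<noteq> \<zero>\<^bsub>R\<^esub>}" by auto
  with assms show ?thesis by (meson finite_UnI finite_subset)
qed

lemma free_module_carrier:
  "f \<in> carrier (free_module R S) \<longleftrightarrow>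
    (\<forall>s. f s \<in> carrier R) \<and> finite {s. f s \<noteq> \<zero>\<^bsub>R\<^esub>} \<and> (\<forall>s. f s \<noteq> \<zero>\<^bsub>R\<^esub> \<longrightarrow> s \<in> S)"
  by (auto simp: free_module_def)

lemma free_module_simps:
  "\<zero>\<^bsub>free_module R S\<^esub> = (\<lambda>_. \<zero>\<^bsub>R\<^esub>)"
  "f \<oplus>\<^bsub>free_module R S\<^esub> g = (\<lambda>s. f s \<oplus>\<^bsub>R\<^esub> g s)"
  "r \<odot>\<^bsub>free_module R S\<^esub> f = (\<lambda>s. r \<otimes>\<^bsub>R\<^esub> f s)"
  by (simp_all add: free_module_def)

lemma free_module_left_module:
  assumes "ring R"
  shows "left_module R (free_module R S)"
proof -
  interpret ring R by fact
  let ?F = "free_module R S"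
  have add: "(\<lambda>s. f s \<oplus>\<^bsub>R\<^esub> g s) \<in> carrier ?F" if "f \<in> carrier ?F" "g \<in> carrier ?F" for f g
  proof -
    have "s \<in> S" if "f s \<oplus>\<^bsub>R\<^esub> g s \<noteq> \<zero>\<^bsub>R\<^esub>" for s
      using that \<open>f \<in> carrier ?F\<close> \<open>g \<in> carrier ?F\<close>
      by (cases "f s = \<zero>\<^bsub>R\<^esub>"; cases "g s = \<zero>\<^bsub>R\<^esub>") (auto simp: free_module_carrier)
    then show ?thesis
      using that finite_support_add[OF assms, of f g] by (simp add: free_module_carrier)
  qed
  have smult: "(\<lambda>s. r \<otimes>\<^bsub>R\<^esub> f s) \<in> carrier ?F" if "r \<in> carrier R" "f \<in> carrier ?F" for r f
  proof -
    have "{s. r \<otimes>\<^bsub>R\<^esub> f s \<noteq> \<zero>\<^bsub>R\<^esub>} \<subseteq> {s. f s \<noteq> \<zero>\<^bsub>R\<^esub>}"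
      using that by auto
    then show ?thesis
      using that by (auto simp: free_module_carrier intro: finite_subset)
  qed
  have grp: "abelian_group ?F"
  proof (rule abelian_groupI)
    fix f assume f: "f \<in> carrier ?F"
    have "(\<lambda>s. \<ominus>\<^bsub>R\<^esub> \<one>\<^bsub>R\<^esub> \<otimes>\<^bsub>R\<^esub> f s) \<in> carrier ?F"
      by (rule smult[OF _ f]) simp
    moreover have "(\<lambda>s. \<ominus>\<^bsub>R\<^esub> \<one>\<^bsub>R\<^esub> \<otimes>\<^bsub>R\<^esub> f s) \<oplus>\<^bsub>?F\<^esub> f = \<zero>\<^bsub>?F\<^esub>"
      using f by (auto simp: free_module_simps free_module_carrier l_minus l_neg)
    ultimately show "\<exists>g\<in>carrier ?F. g \<oplus>\<^bsub>?F\<^esub> f = \<zero>\<^bsub>?F\<^esub>" by blast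
  next
    fix f g assume "f \<in> carrier ?F" "g \<in> carrier ?F"
    then show "f \<oplus>\<^bsub>?F\<^esub> g \<in> carrier ?F"
      using add unfolding free_module_simps by blast
  qed (auto simp: free_module_simps free_module_carrier a_assoc, simp add: a_comm)
  have c: "f s \<in> carrier R" if "f \<in> carrier ?F" for f s
    using that by (simp add: free_module_carrier)
  show ?thesis
  proof (rule left_moduleI[OF assms grp])
    show "r \<odot>\<^bsub>?F\<^esub> f \<in> carrier ?F" if "r \<in> carrier R" "f \<in> carrier ?F" for r f
      using smult[OF that] by (simp add: free_module_simps)
  qed (auto simp: free_module_simps c l_distr r_distr m_assoc)
qed

lemma free_gen_closed: "ring R \<Longrightarrow> s \<in> S \<Longrightarrow> free_gen R s \<in> carrier (free_module R S)"
  by (auto simp: free_module_carrier free_gen_def ring.ring_simprules)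

text \<open>Induction on the finite support: the value at one point b of it is set to zero, and f is
  recovered by adding back f(b) times the generator at b.\<close>

lemma free_module_induct [consumes 2, case_names zero add]:
  assumes "ring R" "f \<in> carrier (free_module R S)"
    and zero: "Q (\<lambda>_. \<zero>\<^bsub>R\<^esub>)"
    and add: "\<And>f r s. f \<in> carrier (free_module R S) \<Longrightarrow> Q f \<Longrightarrow> r \<in> carrier R \<Longrightarrow> s \<in> S \<Longrightarrow>
      Q (f \<oplus>\<^bsub>free_module R S\<^esub> (r \<odot>\<^bsub>free_module R S\<^esub> free_gen R s))"
  shows "Q f"
proof -
  interpret ring R by fact
  let ?F = "free_module R S"
  have "finite B \<Longrightarrow> \<forall>f\<in>carrier ?F. {s. f s \<noteq> \<zero>\<^bsub>R\<^esub>} = B \<longrightarrow> Q f" for B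
  proof (induction B rule: finite_induct)
    case empty
    show ?case
    proof (intro ballI impI)
      fix f assume "f \<in> carrier ?F" "{s. f s \<noteq> \<zero>\<^bsub>R\<^esub>} = {}"
      then have "f = (\<lambda>_. \<zero>\<^bsub>R\<^esub>)" by auto
      with zero show "Q f" by simp
    qed
  next
    case (insert b B)
    show ?case
    proof (intro ballI impI)
      fix f assume f: "f \<in> carrier ?F" "{s. f s \<noteq> \<zero>\<^bsub>R\<^esub>} = insert b B"
      let ?g = "\<lambda>s. if s = b then \<zero>\<^bsub>R\<^esub> else f s"
      have g: "{s. ?g s \<noteq> \<zero>\<^bsub>R\<^esub>} = B" using f(2) insert(2) by auto
      have fc: "f s \<in> carrier R" for s using f(1) by (simp add: free_module_carrier)
      have gF: "?g \<in> carrier ?F" using f(1) g insert(1) by (simp add: free_module_carrier)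
      have "f b \<noteq> \<zero>\<^bsub>R\<^esub>" using f(2) by blast
      then have b: "b \<in> S" "f b \<in> carrier R" using f(1) by (simp_all add: free_module_carrier)
      have "f = ?g \<oplus>\<^bsub>?F\<^esub> (f b \<odot>\<^bsub>?F\<^esub> free_gen R b)"
        by (rule ext) (simp add: free_module_simps free_gen_def fc)
      moreover have "Q ?g" using bspec[OF insert(3) gF] g by simp
      ultimately show "Q f" using add[OF gF _ b(2,1)] by metis
    qed
  qed
  moreover have "finite {s. f s \<noteq> \<zero>\<^bsub>R\<^esub>}" using assms(2) by (simp add: free_module_carrier)
  ultimately show ?thesis using assms(2) by blast
qed

text \<open>The universal map out of a free module. For h(a, b) = a b it is literally the sum inside
  \<open>mult_map\<close>, which is why it runs over the support.\<close>

definition lin_ext ::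
  "('r, 'c) ring_scheme \<Rightarrow> ('r, 'm, 'd) module_scheme \<Rightarrow> ('b \<Rightarrow> 'm) \<Rightarrow> ('b \<Rightarrow> 'r) \<Rightarrow> 'm"
  where "lin_ext R N h f = (\<Oplus>\<^bsub>N\<^esub>s\<in>{s. f s \<noteq> \<zero>\<^bsub>R\<^esub>}. f s \<odot>\<^bsub>N\<^esub> h s)"

lemma free_linear_map_eq:
  assumes "left_module R N" "linear_map R (free_module R S) N f" "linear_map R (free_module R S) N g"
    and eq: "\<And>s. s \<in> S \<Longrightarrow> f (free_gen R s) = g (free_gen R s)"
    and "x \<in> carrier (free_module R S)"
  shows "f x = g x"
proof -
  interpret N: left_module R N by fact
  let ?F = "free_module R S"
  have R: "ring R" by (rule N.R.ring_axioms)
  interpret F: left_module R ?F by (rule free_module_left_module[OF R])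
  interpret f: abelian_group_hom ?F N f
    using abelian_group_hom_linear_map assms(2) N.M.abelian_group_axioms F.M.abelian_group_axioms
    by blast
  interpret g: abelian_group_hom ?F N g
    using abelian_group_hom_linear_map assms(3) N.M.abelian_group_axioms F.M.abelian_group_axioms
    by blast
  show ?thesis
  proof (rule free_module_induct[where Q = "\<lambda>x. f x = g x", OF R assms(5)])
    show "f (\<lambda>_. \<zero>\<^bsub>R\<^esub>) = g (\<lambda>_. \<zero>\<^bsub>R\<^esub>)"
      using f.hom_zero g.hom_zero by (simp add: free_module_simps)
    fix x r s assume *: "x \<in> carrier ?F" "f x = g x" "r \<in> carrier R" "s \<in> S"
    have e: "free_gen R s \<in> carrier ?F" by (rule free_gen_closed[OF R *(4)])
    then have "f (r \<odot>\<^bsub>?F\<^esub> free_gen R s) = g (r \<odot>\<^bsub>?F\<^esub> free_gen R s)"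
      using *(3) eq[OF *(4)] assms(2,3) by (simp add: linear_map_smult)
    then show "f (x \<oplus>\<^bsub>?F\<^esub> (r \<odot>\<^bsub>?F\<^esub> free_gen R s)) = g (x \<oplus>\<^bsub>?F\<^esub> (r \<odot>\<^bsub>?F\<^esub> free_gen R s))"
      using * e by (simp add: F.smult_closed)
  qed
qed

lemma free_submodule_eq:
  assumes "ring R" "submodule H R (free_module R S)" "\<And>s. s \<in> S \<Longrightarrow> free_gen R s \<in> H"
    and "x \<in> carrier (free_module R S)"
  shows "x \<in> H"
proof -
  interpret H: submodule H R "free_module R S" by fact
  show ?thesis
  proof (rule free_module_induct[where Q = "\<lambda>x. x \<in> H", OF assms(1,4)])
    show "(\<lambda>_. \<zero>\<^bsub>R\<^esub>) \<in> H"
      using H.one_closed by (simp add: free_module_simps)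
    fix x r s assume "x \<in> H" "r \<in> carrier R" "s \<in> S"
    then show "x \<oplus>\<^bsub>free_module R S\<^esub> (r \<odot>\<^bsub>free_module R S\<^esub> free_gen R s) \<in> H"
      using assms(3) H.m_closed[of x "r \<odot>\<^bsub>free_module R S\<^esub> free_gen R s"] by simp
  qed
qed

context left_module
begin

text \<open>Two functions rarely have the same support; enlarging both sums to one finite set lets
  them be added termwise.\<close>

lemma lin_ext_superset:
  assumes "finite B" "{s. f s \<noteq> \<zero>\<^bsub>R\<^esub>} \<subseteq> B" "\<And>s. f s \<in> carrier R" "h \<in> B \<rightarrow> carrier M"
  shows "lin_ext R M h f = (\<Oplus>\<^bsub>M\<^esub>s\<in>B. f s \<odot>\<^bsub>M\<^esub> h s)"
  unfolding lin_ext_def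
proof (rule M.add.finprod_mono_neutral_cong_left)
  show "f i \<odot>\<^bsub>M\<^esub> h i = \<zero>\<^bsub>M\<^esub>" if "i \<in> B - {s. f s \<noteq> \<zero>\<^bsub>R\<^esub>}" for i
    using assms that by (auto simp: lm_smult_l_null Pi_def)
qed (use assms in \<open>auto simp: Pi_def intro!: smult_closed\<close>)

lemma lin_ext_linear_map:
  assumes h: "h \<in> S \<rightarrow> carrier M"
  shows "linear_map R (free_module R S) M (lin_ext R M h)"
proof (rule linear_mapI)
  let ?F = "free_module R S"
  interpret F: left_module R ?F by (rule free_module_left_module) (rule R.ring_axioms)
  fix f assume f: "f \<in> carrier ?F"
  then have f': "finite {s. f s \<noteq> \<zero>\<^bsub>R\<^esub>}" "{s. f s \<noteq> \<zero>\<^bsub>R\<^esub>} \<subseteq> S" "\<And>s. f s \<in> carrier R"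
    by (auto simp: free_module_carrier)
  show "lin_ext R M h f \<in> carrier M"
    unfolding lin_ext_def using f' h
    by (intro M.finsum_closed) (auto intro!: smult_closed simp: Pi_def)
  {
    fix g assume g: "g \<in> carrier ?F"
    then have g': "finite {s. g s \<noteq> \<zero>\<^bsub>R\<^esub>}" "{s. g s \<noteq> \<zero>\<^bsub>R\<^esub>} \<subseteq> S" "\<And>s. g s \<in> carrier R"
      by (auto simp: free_module_carrier)
    let ?B = "{s. f s \<noteq> \<zero>\<^bsub>R\<^esub>} \<union> {s. g s \<noteq> \<zero>\<^bsub>R\<^esub>}"
    have B: "finite ?B" "h \<in> ?B \<rightarrow> carrier M" using f' g' h by auto
    have 1: "lin_ext R M h f = (\<Oplus>\<^bsub>M\<^esub>s\<in>?B. f s \<odot>\<^bsub>M\<^esub> h s)"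
      using B f' by (intro lin_ext_superset) auto
    have 2: "lin_ext R M h g = (\<Oplus>\<^bsub>M\<^esub>s\<in>?B. g s \<odot>\<^bsub>M\<^esub> h s)"
      using B g' by (intro lin_ext_superset) auto
    have "lin_ext R M h (f \<oplus>\<^bsub>?F\<^esub> g) = (\<Oplus>\<^bsub>M\<^esub>s\<in>?B. (f s \<oplus>\<^bsub>R\<^esub> g s) \<odot>\<^bsub>M\<^esub> h s)"
      unfolding free_module_simps using B f' g' by (intro lin_ext_superset) auto
    also have "\<dots> = (\<Oplus>\<^bsub>M\<^esub>s\<in>?B. (f s \<odot>\<^bsub>M\<^esub> h s) \<oplus>\<^bsub>M\<^esub> (g s \<odot>\<^bsub>M\<^esub> h s))"
      using B(2) f' g'
      by (intro M.finsum_cong') (auto simp: smult_l_distr Pi_def intro!: smult_closed M.a_closed)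
    also have "\<dots> = lin_ext R M h f \<oplus>\<^bsub>M\<^esub> lin_ext R M h g"
      unfolding 1 2 using B(2) f' g' by (intro M.finsum_addf) (auto intro!: smult_closed)
    finally show "lin_ext R M h (f \<oplus>\<^bsub>?F\<^esub> g) = lin_ext R M h f \<oplus>\<^bsub>M\<^esub> lin_ext R M h g" .
  }
  {
    fix r assume r: "r \<in> carrier R"
    let ?B = "{s. f s \<noteq> \<zero>\<^bsub>R\<^esub>}"
    have B: "finite ?B" "h \<in> ?B \<rightarrow> carrier M" using f' h by auto
    have "lin_ext R M h (r \<odot>\<^bsub>?F\<^esub> f) = (\<Oplus>\<^bsub>M\<^esub>s\<in>?B. (r \<otimes>\<^bsub>R\<^esub> f s) \<odot>\<^bsub>M\<^esub> h s)"
      unfolding free_module_simps using B f' r by (intro lin_ext_superset) auto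
    also have "\<dots> = (\<Oplus>\<^bsub>M\<^esub>s\<in>?B. r \<odot>\<^bsub>M\<^esub> (f s \<odot>\<^bsub>M\<^esub> h s))"
      using B(2) f' r by (intro M.finsum_cong') (auto simp: Pi_def smult_assoc1 intro!: smult_closed)
    also have "\<dots> = r \<odot>\<^bsub>M\<^esub> lin_ext R M h f"
      unfolding lin_ext_def using B f' r
      by (intro lm_finsum_smult[symmetric]) (auto intro!: smult_closed)
    finally show "lin_ext R M h (r \<odot>\<^bsub>?F\<^esub> f) = r \<odot>\<^bsub>M\<^esub> lin_ext R M h f" .
  }
qed

lemma lin_ext_gen:
  assumes "h s \<in> carrier M"
  shows "lin_ext R M h (free_gen R s) = h s"
proof -
  have "lin_ext R M h (free_gen R s) = (\<Oplus>\<^bsub>M\<^esub>t\<in>{s}. free_gen R s t \<odot>\<^bsub>M\<^esub> h t)"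
    using assms by (intro lin_ext_superset) (auto simp: free_gen_def)
  also have "\<dots> = h s" using assms by (simp add: free_gen_def smult_one)
  finally show ?thesis .
qed

text \<open>Closure under negatives comes from the action of -1.\<close>

lemma lm_submoduleI:
  assumes "H \<subseteq> carrier M" "\<zero>\<^bsub>M\<^esub> \<in> H"
    and "\<And>a b. a \<in> H \<Longrightarrow> b \<in> H \<Longrightarrow> a \<oplus>\<^bsub>M\<^esub> b \<in> H"
    and smult: "\<And>a x. a \<in> carrier R \<Longrightarrow> x \<in> H \<Longrightarrow> a \<odot>\<^bsub>M\<^esub> x \<in> H"
  shows "submodule H R M"
proof -
  have inv: "\<ominus>\<^bsub>M\<^esub> x \<in> H" if "x \<in> H" for x
    using smult[of "\<ominus>\<^bsub>R\<^esub> \<one>\<^bsub>R\<^esub>", OF _ that] lm_smult_l_minus[of "\<one>\<^bsub>R\<^esub>" x] that assms(1)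
    by (auto simp: smult_one)
  show ?thesis
    using assms inv unfolding a_inv_def
    by (intro submodule.intro subgroup.intro) (auto simp: submodule_axioms_def)
qed

lemma carrier_submodule: "submodule (carrier M) R M"
  by (rule lm_submoduleI) (auto simp: smult_closed)

lemma abelian_subgroup_submodule: "submodule N R M \<Longrightarrow> abelian_subgroup N M"
  by (intro abelian_subgroupI3 additive_subgroupI)
     (auto simp: submodule_def abelian_group_axioms)

lemma gen_submodule_subset: "submodule N R M \<Longrightarrow> S \<subseteq> N \<Longrightarrow> gen_submodule R M S \<subseteq> N"
  by (auto simp: gen_submodule_def)

lemma gen_submodule_incl: "S \<subseteq> gen_submodule R M S"
  by (auto simp: gen_submodule_def)

lemma gen_submodule_submodule:
  assumes "S \<subseteq> carrier M"
  shows "submodule (gen_submodule R M S) R M"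
proof (rule lm_submoduleI)
  note sub = additive_subgroup.a_subset additive_subgroup.zero_closed additive_subgroup.a_closed
  have *: "additive_subgroup N M" if "submodule N R M" for N
    using abelian_subgroup_submodule[OF that] by (simp add: abelian_subgroup_def)
  show "gen_submodule R M S \<subseteq> carrier M"
    by (rule gen_submodule_subset[OF carrier_submodule assms])
  show "\<zero>\<^bsub>M\<^esub> \<in> gen_submodule R M S"
    by (auto simp: gen_submodule_def dest: * additive_subgroup.zero_closed)
  show "a \<oplus>\<^bsub>M\<^esub> b \<in> gen_submodule R M S"
    if "a \<in> gen_submodule R M S" "b \<in> gen_submodule R M S" for a b
    using that by (auto simp: gen_submodule_def dest: * intro!: additive_subgroup.a_closed)
  show "a \<odot>\<^bsub>M\<^esub> b \<in> gen_submodule R M S"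
    if "a \<in> carrier R" "b \<in> gen_submodule R M S" for a b
    using that by (auto simp: gen_submodule_def intro!: submodule.smult_closed)
qed

text \<open>Together with \<open>gen_submodule_subset\<close> this shows that a linear map vanishing
  on a set of relations vanishes on the submodule they generate.\<close>

lemma kernel_submodule:
  assumes "left_module R N" "linear_map R M N f"
  shows "submodule {x \<in> carrier M. f x = \<zero>\<^bsub>N\<^esub>} R M"
proof -
  interpret N: left_module R N by fact
  interpret hom: abelian_group_hom M N f
    using abelian_group_hom_linear_map assms(2) N.M.abelian_group_axioms M.abelian_group_axioms
    by blast
  show ?thesis
    using assms(2)
    by (intro lm_submoduleI) (auto simp: smult_closed linear_map_smult N.lm_smult_r_null)
qed

end

section \<open>Quotients by submodules\<close>

lemma a_r_coset_cong: "add M = add M' \<Longrightarrow> N +>\<^bsub>M\<^esub> x = N +>\<^bsub>M'\<^esub> x"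
  by (simp add: a_r_coset_def')

text \<open>One setting for three quotients over three different rings: the tensor square over k,
  I/I^2 over A, and \<open>Omega_p\<close> over V(A).\<close>

locale quot_left_module = left_module R M
  for R :: "('r, 'c) ring_scheme" and M :: "('r, 'm, 'd) module_scheme" +
  fixes N :: "'m set"
  assumes N: "submodule N R M"
begin

sublocale N: abelian_subgroup N M
  by (rule abelian_subgroup_submodule[OF N])

lemma quot_carrier: "carrier (quot_module M N) = (\<lambda>x. N +>\<^bsub>M\<^esub> x) ` carrier M"
  by (auto simp: quot_module_def A_RCOSETS_def' a_r_coset_def')

lemma quot_zero: "\<zero>\<^bsub>quot_module M N\<^esub> = N"
  by (simp add: quot_module_def)

lemma quot_eq:
  assumes "x \<in> carrier M" "y \<in> carrier M"
  shows "N +>\<^bsub>M\<^esub> x = N +>\<^bsub>M\<^esub> y \<longleftrightarrow> x \<ominus>\<^bsub>M\<^esub> y \<in> N"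
  using assms N.a_rcos_module[of y x] N.a_repr_independence'[of x y] N.a_rcos_self[of x]
  by (auto simp: a_minus_def)

lemma quot_add:
  assumes "x \<in> carrier M" "y \<in> carrier M"
  shows "(N +>\<^bsub>M\<^esub> x) \<oplus>\<^bsub>quot_module M N\<^esub> (N +>\<^bsub>M\<^esub> y) = N +>\<^bsub>M\<^esub> (x \<oplus>\<^bsub>M\<^esub> y)"
  using N.a_rcos_sum[OF assms] by (simp add: quot_module_def)

text \<open>Operations on the quotient are written as unions over all representatives; such a union
  is the value at any one of them once that value does not depend on the choice.\<close>

lemma quot_union:
  assumes "x \<in> carrier M"
    and "\<And>y. y \<in> carrier M \<Longrightarrow> y \<ominus>\<^bsub>M\<^esub> x \<in> N \<Longrightarrow> F y = F x"
  shows "(\<Union>y\<in>N +>\<^bsub>M\<^esub> x. F y) = F x"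
proof -
  have "F y = F x" if "y \<in> N +>\<^bsub>M\<^esub> x" for y
  proof -
    have "y \<in> carrier M" using that assms(1) by (rule N.a_elemrcos_carrier[rotated])
    then show ?thesis using that assms N.a_rcos_module[of x y] by (auto simp: a_minus_def)
  qed
  moreover have "x \<in> N +>\<^bsub>M\<^esub> x" using assms N.a_rcos_self by simp
  ultimately show ?thesis by blast
qed

lemma quot_smult:
  assumes "r \<in> carrier R" "x \<in> carrier M"
  shows "r \<odot>\<^bsub>quot_module M N\<^esub> (N +>\<^bsub>M\<^esub> x) = N +>\<^bsub>M\<^esub> (r \<odot>\<^bsub>M\<^esub> x)"
proof -
  have "N +>\<^bsub>M\<^esub> (r \<odot>\<^bsub>M\<^esub> y) = N +>\<^bsub>M\<^esub> (r \<odot>\<^bsub>M\<^esub> x)" if "y \<in> carrier M" "y \<ominus>\<^bsub>M\<^esub> x \<in> N" for y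
  proof -
    have "r \<odot>\<^bsub>M\<^esub> (y \<ominus>\<^bsub>M\<^esub> x) \<in> N" using that N assms by (intro submodule.smult_closed)
    then show ?thesis
      using that assms quot_eq[of "r \<odot>\<^bsub>M\<^esub> y" "r \<odot>\<^bsub>M\<^esub> x"]
      by (simp add: a_minus_def smult_r_distr lm_smult_r_minus smult_closed)
  qed
  then show ?thesis
    using quot_union[OF assms(2), of "\<lambda>y. N +>\<^bsub>M\<^esub> (r \<odot>\<^bsub>M\<^esub> y)"] by (simp add: quot_module_def)
qed

lemma quot_abelian_group: "abelian_group (quot_module M N)"
proof (rule abelian_groupI)
  fix X assume "X \<in> carrier (quot_module M N)"
  then obtain x where x: "x \<in> carrier M" "X = N +>\<^bsub>M\<^esub> x" by (auto simp: quot_carrier)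
  have "(N +>\<^bsub>M\<^esub> (\<ominus>\<^bsub>M\<^esub> x)) \<oplus>\<^bsub>quot_module M N\<^esub> X = \<zero>\<^bsub>quot_module M N\<^esub>"
    using x by (simp add: quot_add M.l_neg quot_zero M.a_coset_add_zero N.a_subset)
  then show "\<exists>y\<in>carrier (quot_module M N). y \<oplus>\<^bsub>quot_module M N\<^esub> X = \<zero>\<^bsub>quot_module M N\<^esub>"
    using x by (auto simp: quot_carrier)
  have "(N +>\<^bsub>M\<^esub> \<zero>\<^bsub>M\<^esub>) \<oplus>\<^bsub>quot_module M N\<^esub> X = X"
    unfolding x(2) using x by (subst quot_add) auto
  then show "\<zero>\<^bsub>quot_module M N\<^esub> \<oplus>\<^bsub>quot_module M N\<^esub> X = X"
    by (simp add: quot_zero M.a_coset_add_zero N.a_subset)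
next
  have "N +>\<^bsub>M\<^esub> \<zero>\<^bsub>M\<^esub> = N" by (simp add: M.a_coset_add_zero N.a_subset)
  then show "\<zero>\<^bsub>quot_module M N\<^esub> \<in> carrier (quot_module M N)"
    unfolding quot_carrier quot_zero by (metis M.zero_closed image_eqI)
qed (auto simp: quot_carrier quot_add M.a_ac)

lemma quot_left_module: "left_module R (quot_module M N)"
  by (intro left_moduleI quot_abelian_group)
     (auto simp: quot_carrier quot_add quot_smult smult_l_distr smult_r_distr smult_assoc1
       smult_one smult_closed R.ring_axioms)

text \<open>The induced map is read off as the single element of the image of a coset, the form in
  which \<open>mult_map\<close> is given; \<open>\<phi>\<close> is constant on cosets because it
  kills \<open>N\<close>.\<close>

lemma quot_lift:
  assumes "left_module R L" "linear_map R M L \<phi>" "\<And>x. x \<in> N \<Longrightarrow> \<phi> x = \<zero>\<^bsub>L\<^esub>"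
  shows quot_lift_eq: "x \<in> carrier M \<Longrightarrow> the_elem (\<phi> ` (N +>\<^bsub>M\<^esub> x)) = \<phi> x"
    and quot_lift_linear_map: "linear_map R (quot_module M N) L (\<lambda>Y. the_elem (\<phi> ` Y))"
proof -
  interpret L: left_module R L by fact
  interpret hom: abelian_group_hom M L \<phi>
    using abelian_group_hom_linear_map assms(2) L.M.abelian_group_axioms M.abelian_group_axioms
    by blast
  show eq: "the_elem (\<phi> ` (N +>\<^bsub>M\<^esub> x)) = \<phi> x" if x: "x \<in> carrier M" for x
  proof -
    have "\<phi> y = \<phi> x" if "y \<in> N +>\<^bsub>M\<^esub> x" for y
    proof -
      have y: "y \<in> carrier M" using x that by (rule N.a_elemrcos_carrier)
      then have "\<phi> (y \<oplus>\<^bsub>M\<^esub> \<ominus>\<^bsub>M\<^esub> x) = \<zero>\<^bsub>L\<^esub>"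
        using that x N.a_rcos_module[of x y] assms(3) by simp
      then have "\<phi> y \<oplus>\<^bsub>L\<^esub> \<ominus>\<^bsub>L\<^esub> \<phi> x = \<zero>\<^bsub>L\<^esub>"
        using x y by simp
      then show ?thesis
        using x y by (metis L.M.minus_equality L.M.minus_minus L.M.add.inv_closed hom.hom_closed)
    qed
    moreover have "x \<in> N +>\<^bsub>M\<^esub> x" using x N.a_rcos_self by simp
    ultimately have "\<phi> ` (N +>\<^bsub>M\<^esub> x) = {\<phi> x}" by blast
    then show ?thesis by simp
  qed
  show "linear_map R (quot_module M N) L (\<lambda>Y. the_elem (\<phi> ` Y))"
    using assms(2)
    by (intro linear_mapI)
       (auto simp: quot_carrier quot_add quot_smult eq linear_map_smult smult_closed)
qed

lemma quot_linear_map: "linear_map R M (quot_module M N) (\<lambda>x. N +>\<^bsub>M\<^esub> x)"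
  by (rule linear_mapI) (auto simp: quot_carrier quot_add quot_smult)

end

section \<open>The algebra \<open>A \<otimes> A\<close>\<close>

lemma abelian_group_cong:
  assumes "abelian_group M" "carrier M' = carrier M" "add M' = add M" "zero M' = zero M"
  shows "abelian_group M'"
  using abelian_groupE[OF assms(1)] assms(2-4) by (intro abelian_groupI) simp_all

text \<open>The product and unit fields may differ: in this way a monoid algebra inherits the module
  structure of the free module on its monoid.\<close>

lemma left_module_cong:
  assumes "left_module R M"
    and "carrier M' = carrier M" "add M' = add M" "zero M' = zero M" "smult M' = smult M"
  shows "left_module R M'"
proof -
  interpret left_module R M by fact
  show ?thesis
    by (intro left_moduleI R.ring_axioms abelian_group_cong[OF M.abelian_group_axioms] assms(2-4))
       (simp_all add: assms(2-5) smult_closed smult_l_distr smult_r_distr smult_assoc1 smult_one)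
qed

lemma cring_cong:
  assumes "cring R" "carrier R' = carrier R" "add R' = add R" "zero R' = zero R"
    "monoid.mult R' = monoid.mult R" "one R' = one R"
  shows "cring R'"
proof -
  interpret cring R by fact
  show ?thesis
    by (intro cringI abelian_group_cong[OF abelian_group_axioms] assms(2-4) comm_monoidI)
       (simp_all add: assms(2-6) m_assoc l_distr, simp add: m_comm)
qed

lemma linear_map_cong_dom:
  assumes "carrier M' = carrier M" "add M' = add M" "smult M' = smult M"
  shows "linear_map R M' N f \<longleftrightarrow> linear_map R M N f"
  using assms by (simp add: linear_map_def)

lemma submodule_cong:
  assumes "carrier M' = carrier M" "add M' = add M" "zero M' = zero M" "smult M' = smult M"
  shows "submodule N R M' \<longleftrightarrow> submodule N R M"
  using assms by (simp add: submodule_def submodule_axioms_def subgroup_def m_inv_def)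

section \<open>The algebra of a commutative monoid\<close>

lemma monoid_algebra_simps:
  "carrier (monoid_algebra k G) = carrier (free_module k (carrier G))"
  "zero (monoid_algebra k G) = zero (free_module k (carrier G))"
  "add (monoid_algebra k G) = add (free_module k (carrier G))"
  "smult (monoid_algebra k G) = smult (free_module k (carrier G))"
  "one (monoid_algebra k G) = free_gen k \<one>\<^bsub>G\<^esub>"
  by (simp_all add: monoid_algebra_def free_module_def)

text \<open>The monoid of interest is A \<times> A with the componentwise product; proving the ring
  axioms for an arbitrary commutative monoid keeps the pairs out of the computations.\<close>

locale comm_monoid_algebra = cring k + G: comm_monoid G
  for k :: "('k, 'c) ring_scheme" and G :: "('g, 'd) monoid_scheme"
begin

abbreviation "F \<equiv> monoid_algebra k G"

sublocale F: left_module k F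
  by (rule left_module_cong[OF free_module_left_module[of k "carrier G"]])
     (simp_all add: monoid_algebra_simps ring_axioms)

lemma gen_closed: "s \<in> carrier G \<Longrightarrow> free_gen k s \<in> carrier F"
  by (simp add: monoid_algebra_simps free_gen_closed ring_axioms)

text \<open>The convolution may be computed over any finite box containing the supports, so that
  products with different factors can be summed over one index set.\<close>

lemma mult_superset:
  assumes "f \<in> carrier F" "g \<in> carrier F" "finite B" "finite C"
    and "{s. f s \<noteq> \<zero>\<^bsub>k\<^esub>} \<subseteq> B" "{s. g s \<noteq> \<zero>\<^bsub>k\<^esub>} \<subseteq> C"
  shows "(f \<otimes>\<^bsub>F\<^esub> g) z =
    (\<Oplus>\<^bsub>k\<^esub>w\<in>{w \<in> B \<times> C. fst w \<otimes>\<^bsub>G\<^esub> snd w = z}. f (fst w) \<otimes>\<^bsub>k\<^esub> g (snd w))"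
proof -
  have c: "f s \<in> carrier k" "g s \<in> carrier k" for s
    using assms(1,2) by (auto simp: monoid_algebra_simps free_module_carrier)
  have "(f \<otimes>\<^bsub>F\<^esub> g) z =
    (\<Oplus>\<^bsub>k\<^esub>w\<in>{w. f (fst w) \<noteq> \<zero>\<^bsub>k\<^esub> \<and> g (snd w) \<noteq> \<zero>\<^bsub>k\<^esub> \<and> fst w \<otimes>\<^bsub>G\<^esub> snd w = z}.
      f (fst w) \<otimes>\<^bsub>k\<^esub> g (snd w))"
    by (simp add: monoid_algebra_def)
  also have "\<dots> = (\<Oplus>\<^bsub>k\<^esub>w\<in>{w \<in> B \<times> C. fst w \<otimes>\<^bsub>G\<^esub> snd w = z}. f (fst w) \<otimes>\<^bsub>k\<^esub> g (snd w))"
  proof (rule add.finprod_mono_neutral_cong_left)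
    show "finite {w \<in> B \<times> C. fst w \<otimes>\<^bsub>G\<^esub> snd w = z}" using assms(3,4) by simp
  qed (use assms(5,6) c in \<open>auto simp: mem_Times_iff\<close>)
  finally show ?thesis .
qed

lemma mult_eq:
  assumes "f \<in> carrier F" "g \<in> carrier F"
  shows "(f \<otimes>\<^bsub>F\<^esub> g) z =
    (\<Oplus>\<^bsub>k\<^esub>w\<in>{w \<in> {s. f s \<noteq> \<zero>\<^bsub>k\<^esub>} \<times> {s. g s \<noteq> \<zero>\<^bsub>k\<^esub>}. fst w \<otimes>\<^bsub>G\<^esub> snd w = z}.
      f (fst w) \<otimes>\<^bsub>k\<^esub> g (snd w))"
  using assms by (intro mult_superset) (simp_all add: monoid_algebra_simps free_module_carrier)

lemma F_mult_closed:
  assumes "f \<in> carrier F" "g \<in> carrier F"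
  shows "f \<otimes>\<^bsub>F\<^esub> g \<in> carrier F"
proof -
  let ?B = "{s. f s \<noteq> \<zero>\<^bsub>k\<^esub>}" and ?C = "{s. g s \<noteq> \<zero>\<^bsub>k\<^esub>}"
  have c: "f s \<in> carrier k" "g s \<in> carrier k" for s
    using assms by (auto simp: monoid_algebra_simps free_module_carrier)
  have BC: "finite ?B" "finite ?C" "?B \<subseteq> carrier G" "?C \<subseteq> carrier G"
    using assms by (auto simp: monoid_algebra_simps free_module_carrier)
  have supp: "z \<in> (\<lambda>w. fst w \<otimes>\<^bsub>G\<^esub> snd w) ` (?B \<times> ?C)" if "(f \<otimes>\<^bsub>F\<^esub> g) z \<noteq> \<zero>\<^bsub>k\<^esub>" for z
  proof (rule ccontr)
    assume "z \<notin> (\<lambda>w. fst w \<otimes>\<^bsub>G\<^esub> snd w) ` (?B \<times> ?C)"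
    then have "{w \<in> ?B \<times> ?C. fst w \<otimes>\<^bsub>G\<^esub> snd w = z} = {}" by blast
    then have "(f \<otimes>\<^bsub>F\<^esub> g) z = \<zero>\<^bsub>k\<^esub>" unfolding mult_eq[OF assms] by (simp only: finsum_empty)
    with that show False by contradiction
  qed
  have "finite {z. (f \<otimes>\<^bsub>F\<^esub> g) z \<noteq> \<zero>\<^bsub>k\<^esub>}"
    by (rule finite_subset[OF _ finite_imageI[OF finite_cartesian_product[OF BC(1,2)]]])
       (rule subsetI, rule supp, simp)
  moreover have "z \<in> carrier G" if "(f \<otimes>\<^bsub>F\<^esub> g) z \<noteq> \<zero>\<^bsub>k\<^esub>" for z
    using supp[OF that] BC(3,4) by (auto intro!: G.m_closed)
  moreover have "(f \<otimes>\<^bsub>F\<^esub> g) z \<in> carrier k" for z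
    unfolding mult_eq[OF assms] using c by (intro finsum_closed) auto
  ultimately show ?thesis unfolding monoid_algebra_simps free_module_carrier by blast
qed

text \<open>Linearity in each factor comes before the ring axioms: with it, associativity and the
  unit law reduce to generators, where they are those of \<open>G\<close>.\<close>

lemma mult_linear_left:
  assumes g: "g \<in> carrier F"
  shows "linear_map k F F (\<lambda>f. f \<otimes>\<^bsub>F\<^esub> g)"
proof (rule linear_mapI)
  let ?C = "{s. g s \<noteq> \<zero>\<^bsub>k\<^esub>}"
  have g': "finite ?C" "\<And>s. g s \<in> carrier k"
    using g by (auto simp: monoid_algebra_simps free_module_carrier)
  fix f assume f: "f \<in> carrier F"
  then show "f \<otimes>\<^bsub>F\<^esub> g \<in> carrier F" by (intro F_mult_closed g)
  let ?B = "{s. f s \<noteq> \<zero>\<^bsub>k\<^esub>}"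
  have f': "finite ?B" "\<And>s. f s \<in> carrier k"
    using f by (auto simp: monoid_algebra_simps free_module_carrier)
  {
    fix f2 assume f2: "f2 \<in> carrier F"
    let ?B2 = "{s. f2 s \<noteq> \<zero>\<^bsub>k\<^esub>}"
    have f2': "finite ?B2" "\<And>s. f2 s \<in> carrier k"
      using f2 by (auto simp: monoid_algebra_simps free_module_carrier)
    show "(f \<oplus>\<^bsub>F\<^esub> f2) \<otimes>\<^bsub>F\<^esub> g = (f \<otimes>\<^bsub>F\<^esub> g) \<oplus>\<^bsub>F\<^esub> (f2 \<otimes>\<^bsub>F\<^esub> g)"
    proof
      fix z
      let ?I = "{w \<in> (?B \<union> ?B2) \<times> ?C. fst w \<otimes>\<^bsub>G\<^esub> snd w = z}"
      have "((f \<oplus>\<^bsub>F\<^esub> f2) \<otimes>\<^bsub>F\<^esub> g) z = (\<Oplus>\<^bsub>k\<^esub>w\<in>?I. (f \<oplus>\<^bsub>F\<^esub> f2) (fst w) \<otimes>\<^bsub>k\<^esub> g (snd w))"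
        using f f2 f' f2' g g'
        by (intro mult_superset F.M.a_closed) (auto simp: monoid_algebra_simps free_module_simps)
      also have "\<dots> = (\<Oplus>\<^bsub>k\<^esub>w\<in>?I. f (fst w) \<otimes>\<^bsub>k\<^esub> g (snd w) \<oplus>\<^bsub>k\<^esub> f2 (fst w) \<otimes>\<^bsub>k\<^esub> g (snd w))"
        using f' f2' g'
        by (intro finsum_cong') (simp_all add: monoid_algebra_simps free_module_simps l_distr)
      also have "\<dots> = (\<Oplus>\<^bsub>k\<^esub>w\<in>?I. f (fst w) \<otimes>\<^bsub>k\<^esub> g (snd w)) \<oplus>\<^bsub>k\<^esub>
          (\<Oplus>\<^bsub>k\<^esub>w\<in>?I. f2 (fst w) \<otimes>\<^bsub>k\<^esub> g (snd w))"
        using f' f2' g' by (intro finsum_addf) auto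
      also have "(\<Oplus>\<^bsub>k\<^esub>w\<in>?I. f (fst w) \<otimes>\<^bsub>k\<^esub> g (snd w)) = (f \<otimes>\<^bsub>F\<^esub> g) z"
        using f f' f2' g g' by (intro mult_superset[symmetric]) auto
      also have "(\<Oplus>\<^bsub>k\<^esub>w\<in>?I. f2 (fst w) \<otimes>\<^bsub>k\<^esub> g (snd w)) = (f2 \<otimes>\<^bsub>F\<^esub> g) z"
        using f2 f' f2' g g' by (intro mult_superset[symmetric]) auto
      finally show "((f \<oplus>\<^bsub>F\<^esub> f2) \<otimes>\<^bsub>F\<^esub> g) z = ((f \<otimes>\<^bsub>F\<^esub> g) \<oplus>\<^bsub>F\<^esub> (f2 \<otimes>\<^bsub>F\<^esub> g)) z"
        by (simp add: monoid_algebra_simps free_module_simps)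
    qed
  }
  {
    fix r assume r: "r \<in> carrier k"
    show "(r \<odot>\<^bsub>F\<^esub> f) \<otimes>\<^bsub>F\<^esub> g = r \<odot>\<^bsub>F\<^esub> (f \<otimes>\<^bsub>F\<^esub> g)"
    proof
      fix z
      let ?I = "{w \<in> ?B \<times> ?C. fst w \<otimes>\<^bsub>G\<^esub> snd w = z}"
      have "((r \<odot>\<^bsub>F\<^esub> f) \<otimes>\<^bsub>F\<^esub> g) z = (\<Oplus>\<^bsub>k\<^esub>w\<in>?I. (r \<odot>\<^bsub>F\<^esub> f) (fst w) \<otimes>\<^bsub>k\<^esub> g (snd w))"
        using f f' g g' r F.smult_closed[OF r f]
        by (intro mult_superset) (auto simp: monoid_algebra_simps free_module_simps)
      also have "\<dots> = (\<Oplus>\<^bsub>k\<^esub>w\<in>?I. r \<otimes>\<^bsub>k\<^esub> (f (fst w) \<otimes>\<^bsub>k\<^esub> g (snd w)))"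
        using f' g' r
        by (intro finsum_cong') (simp_all add: monoid_algebra_simps free_module_simps m_assoc)
      also have "\<dots> = r \<otimes>\<^bsub>k\<^esub> (\<Oplus>\<^bsub>k\<^esub>w\<in>?I. f (fst w) \<otimes>\<^bsub>k\<^esub> g (snd w))"
        using f' g' r by (intro finsum_rdistr[symmetric]) auto
      finally show "((r \<odot>\<^bsub>F\<^esub> f) \<otimes>\<^bsub>F\<^esub> g) z = (r \<odot>\<^bsub>F\<^esub> (f \<otimes>\<^bsub>F\<^esub> g)) z"
        using mult_eq[OF f g, of z] by (simp add: monoid_algebra_simps free_module_simps)
    qed
  }
qed

text \<open>Exchanging the two factors preserves the fibre over z because \<open>G\<close> is
  commutative. Linearity on the right then follows from linearity on the left.\<close>

lemma mult_swap:
  assumes f: "f \<in> carrier F" and g: "g \<in> carrier F"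
  shows "f \<otimes>\<^bsub>F\<^esub> g = g \<otimes>\<^bsub>F\<^esub> f"
proof
  fix z
  let ?B = "{s. f s \<noteq> \<zero>\<^bsub>k\<^esub>}" and ?C = "{s. g s \<noteq> \<zero>\<^bsub>k\<^esub>}"
  have c: "f s \<in> carrier k" "g s \<in> carrier k" for s
    using assms by (auto simp: monoid_algebra_simps free_module_carrier)
  have BC: "?B \<subseteq> carrier G" "?C \<subseteq> carrier G"
    using assms by (auto simp: monoid_algebra_simps free_module_carrier)
  let ?I = "{w \<in> ?B \<times> ?C. fst w \<otimes>\<^bsub>G\<^esub> snd w = z}" and ?J = "{w \<in> ?C \<times> ?B. fst w \<otimes>\<^bsub>G\<^esub> snd w = z}"
  have J: "?J = prod.swap ` ?I"
  proof (intro equalityI subsetI)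
    fix w assume w: "w \<in> ?J"
    then have "fst w \<in> carrier G" "snd w \<in> carrier G" using BC by (simp_all add: mem_Times_iff subset_iff)
    with w have "prod.swap w \<in> ?I" by (simp add: G.m_comm mem_Times_iff)
    then show "w \<in> prod.swap ` ?I" by (rule image_eqI[rotated]) simp
  next
    fix w assume "w \<in> prod.swap ` ?I"
    then obtain v where v: "v \<in> ?I" "w = prod.swap v" by blast
    then have "fst v \<in> carrier G" "snd v \<in> carrier G" using BC by (simp_all add: mem_Times_iff subset_iff)
    with v show "w \<in> ?J" by (simp add: G.m_comm mem_Times_iff)
  qed
  have "(g \<otimes>\<^bsub>F\<^esub> f) z = (\<Oplus>\<^bsub>k\<^esub>w\<in>prod.swap ` ?I. g (fst w) \<otimes>\<^bsub>k\<^esub> f (snd w))"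
    unfolding mult_eq[OF g f] J ..
  also have "\<dots> = (\<Oplus>\<^bsub>k\<^esub>w\<in>?I. g (fst (prod.swap w)) \<otimes>\<^bsub>k\<^esub> f (snd (prod.swap w)))"
    using c by (intro finsum_reindex) auto
  also have "\<dots> = (\<Oplus>\<^bsub>k\<^esub>w\<in>?I. f (fst w) \<otimes>\<^bsub>k\<^esub> g (snd w))"
    using c by (intro finsum_cong') (auto simp: m_comm)
  finally show "(f \<otimes>\<^bsub>F\<^esub> g) z = (g \<otimes>\<^bsub>F\<^esub> f) z" unfolding mult_eq[OF f g] by simp
qed

lemma mult_linear_right:
  assumes g: "g \<in> carrier F"
  shows "linear_map k F F (\<lambda>f. g \<otimes>\<^bsub>F\<^esub> f)"
  using mult_linear_left[OF g] g mult_swap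
  by (auto simp: linear_map_def F.smult_closed)

lemma mult_gen:
  assumes "s \<in> carrier G" "t \<in> carrier G"
  shows "free_gen k s \<otimes>\<^bsub>F\<^esub> free_gen k t = free_gen k (s \<otimes>\<^bsub>G\<^esub> t)"
proof
  fix z
  let ?I = "{w \<in> {s} \<times> {t}. fst w \<otimes>\<^bsub>G\<^esub> snd w = z}"
  have "(free_gen k s \<otimes>\<^bsub>F\<^esub> free_gen k t) z =
    (\<Oplus>\<^bsub>k\<^esub>w\<in>?I. free_gen k s (fst w) \<otimes>\<^bsub>k\<^esub> free_gen k t (snd w))"
    using assms by (intro mult_superset gen_closed) (auto simp: free_gen_def)
  also have "?I = (if s \<otimes>\<^bsub>G\<^esub> t = z then {(s, t)} else {})" by auto
  finally show "(free_gen k s \<otimes>\<^bsub>F\<^esub> free_gen k t) z = free_gen k (s \<otimes>\<^bsub>G\<^esub> t) z"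
    by (auto simp: free_gen_def)
qed

lemma linear_map_eq:
  assumes "left_module k N" "linear_map k F N f" "linear_map k F N g"
    and "\<And>s. s \<in> carrier G \<Longrightarrow> f (free_gen k s) = g (free_gen k s)" "x \<in> carrier F"
  shows "f x = g x"
  using assms free_linear_map_eq[of k N "carrier G" f g x]
  by (simp add: linear_map_cong_dom[OF monoid_algebra_simps(1,3,4)] monoid_algebra_simps)

lemma F_mult_assoc:
  assumes f: "f \<in> carrier F" and g: "g \<in> carrier F" and h: "h \<in> carrier F"
  shows "(f \<otimes>\<^bsub>F\<^esub> g) \<otimes>\<^bsub>F\<^esub> h = f \<otimes>\<^bsub>F\<^esub> (g \<otimes>\<^bsub>F\<^esub> h)"
proof -
  note L = mult_linear_left and R = mult_linear_right
  note lm = F.left_module_axioms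
  \<comment> \<open>On three generators the claim is associativity of \<open>G\<close>. Then h, g
    and f are freed in turn, both sides being linear in the argument concerned.\<close>
  have 1: "(free_gen k s \<otimes>\<^bsub>F\<^esub> free_gen k t) \<otimes>\<^bsub>F\<^esub> h = free_gen k s \<otimes>\<^bsub>F\<^esub> (free_gen k t \<otimes>\<^bsub>F\<^esub> h)"
    if "s \<in> carrier G" "t \<in> carrier G" for s t
    by (rule linear_map_eq[OF lm R linear_map_compose[OF R R] _ h])
       (use that in \<open>auto simp: mult_gen gen_closed F_mult_closed G.m_assoc\<close>)
  have 2: "(free_gen k s \<otimes>\<^bsub>F\<^esub> g) \<otimes>\<^bsub>F\<^esub> h = free_gen k s \<otimes>\<^bsub>F\<^esub> (g \<otimes>\<^bsub>F\<^esub> h)"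
    if "s \<in> carrier G" for s
    by (rule linear_map_eq[OF lm linear_map_compose[OF R L] linear_map_compose[OF L R] _ g])
       (use that h 1 in \<open>auto simp: gen_closed\<close>)
  show ?thesis
    by (rule linear_map_eq[OF lm linear_map_compose[OF L L] L _ f])
       (use g h 2 in \<open>auto simp: gen_closed F_mult_closed\<close>)
qed

lemma F_l_one:
  assumes "f \<in> carrier F"
  shows "\<one>\<^bsub>F\<^esub> \<otimes>\<^bsub>F\<^esub> f = f"
proof -
  have "linear_map k F F (\<lambda>f. f)" by (auto simp: linear_map_def)
  then show ?thesis
    by (intro linear_map_eq[OF F.left_module_axioms mult_linear_right _ _ assms, where g = "\<lambda>f. f"])
       (auto simp: monoid_algebra_simps(5) mult_gen gen_closed)
qed

lemma F_cring: "cring F"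
proof (rule cringI)
  show "abelian_group F" by (rule F.abelian_group_axioms)
  show "comm_monoid F"
    using mult_swap F_mult_assoc F_l_one F_mult_closed gen_closed
    by (intro comm_monoidI) (auto simp: monoid_algebra_simps(5))
  show "(f \<oplus>\<^bsub>F\<^esub> g) \<otimes>\<^bsub>F\<^esub> h = f \<otimes>\<^bsub>F\<^esub> h \<oplus>\<^bsub>F\<^esub> g \<otimes>\<^bsub>F\<^esub> h"
    if "f \<in> carrier F" "g \<in> carrier F" "h \<in> carrier F" for f g h
    using linear_map_add[OF mult_linear_left] that by blast
qed

lemma F_smult_mult:
  assumes "r \<in> carrier k" "f \<in> carrier F" "g \<in> carrier F"
  shows "(r \<odot>\<^bsub>F\<^esub> f) \<otimes>\<^bsub>F\<^esub> g = r \<odot>\<^bsub>F\<^esub> (f \<otimes>\<^bsub>F\<^esub> g)"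
  using linear_map_smult[OF mult_linear_left] assms by blast

lemma submodule_eq:
  assumes "submodule H k F" "\<And>s. s \<in> carrier G \<Longrightarrow> free_gen k s \<in> H" "x \<in> carrier F"
  shows "x \<in> H"
  using assms free_submodule_eq[OF ring_axioms, of H "carrier G" x]
  by (simp add: submodule_cong[OF monoid_algebra_simps(1,3,2,4)] monoid_algebra_simps)

lemma lin_ext_linear_map_F:
  assumes "left_module k N" "h \<in> carrier G \<rightarrow> carrier N"
  shows "linear_map k F N (lin_ext k N h)"
  using left_module.lin_ext_linear_map[OF assms]
  by (simp add: linear_map_cong_dom[OF monoid_algebra_simps(1,3,4)])

end

section \<open>The tensor square as a quotient algebra\<close>

locale algebra_square = algebra k A
  for k :: "('k, 'c) ring_scheme" and A :: "('k, 'a, 'd) module_scheme" (structure)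
begin

abbreviation "AA \<equiv> A \<times>\<times> A"
abbreviation "T \<equiv> tensor_square k A"
abbreviation "NN \<equiv> tensor_null k A"

sublocale pair: comm_monoid_algebra k AA
proof -
  have "comm_monoid AA"
    by (rule comm_monoidI) (auto simp: mult_DirProd' m_ac)
  then show "comm_monoid_algebra k AA"
    by (simp add: comm_monoid_algebra_def R.is_cring)
qed

abbreviation "F \<equiv> pair_algebra k A"
abbreviation "e \<equiv> free_gen k"

lemma e_closed: "a \<in> carrier A \<Longrightarrow> b \<in> carrier A \<Longrightarrow> e (a, b) \<in> carrier F"
  by (intro pair.gen_closed) simp

lemma bilinear_rels_cases [consumes 1, case_names add_left add_right smult_left smult_right]:
  assumes "r \<in> bilinear_rels k A"
  obtains a a' b where "a \<in> carrier A" "a' \<in> carrier A" "b \<in> carrier A"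
      "r = e (a \<oplus> a', b) \<ominus>\<^bsub>F\<^esub> (e (a, b) \<oplus>\<^bsub>F\<^esub> e (a', b))"
    | a b b' where "a \<in> carrier A" "b \<in> carrier A" "b' \<in> carrier A"
      "r = e (a, b \<oplus> b') \<ominus>\<^bsub>F\<^esub> (e (a, b) \<oplus>\<^bsub>F\<^esub> e (a, b'))"
    | l a b where "l \<in> carrier k" "a \<in> carrier A" "b \<in> carrier A"
      "r = e (l \<odot> a, b) \<ominus>\<^bsub>F\<^esub> (l \<odot>\<^bsub>F\<^esub> e (a, b))"
    | l a b where "l \<in> carrier k" "a \<in> carrier A" "b \<in> carrier A"
      "r = e (a, l \<odot> b) \<ominus>\<^bsub>F\<^esub> (l \<odot>\<^bsub>F\<^esub> e (a, b))"
  using assms unfolding bilinear_rels_def Let_def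
  by (elim UnE CollectE exE conjE) (rule that, assumption, assumption, assumption, assumption)+

lemma bilinear_relsI:
  assumes "a \<in> carrier A" "b \<in> carrier A"
  shows "a' \<in> carrier A \<Longrightarrow> e (a \<oplus> a', b) \<ominus>\<^bsub>F\<^esub> (e (a, b) \<oplus>\<^bsub>F\<^esub> e (a', b)) \<in> bilinear_rels k A"
    and "b' \<in> carrier A \<Longrightarrow> e (a, b \<oplus> b') \<ominus>\<^bsub>F\<^esub> (e (a, b) \<oplus>\<^bsub>F\<^esub> e (a, b')) \<in> bilinear_rels k A"
    and "l \<in> carrier k \<Longrightarrow> e (l \<odot> a, b) \<ominus>\<^bsub>F\<^esub> (l \<odot>\<^bsub>F\<^esub> e (a, b)) \<in> bilinear_rels k A"
    and "l \<in> carrier k \<Longrightarrow> e (a, l \<odot> b) \<ominus>\<^bsub>F\<^esub> (l \<odot>\<^bsub>F\<^esub> e (a, b)) \<in> bilinear_rels k A"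
  using assms unfolding bilinear_rels_def Let_def by blast+

lemma bilinear_rels_closed: "bilinear_rels k A \<subseteq> carrier F"
proof
  fix r assume "r \<in> bilinear_rels k A"
  then show "r \<in> carrier F"
    by (cases rule: bilinear_rels_cases) (auto intro!: e_closed pair.F.M.minus_closed pair.F.smult_closed)
qed

lemma bilinear_rels_null: "bilinear_rels k A \<subseteq> NN"
  unfolding tensor_null_def by (rule pair.F.gen_submodule_incl)

lemma NN_submodule: "submodule NN k F"
  unfolding tensor_null_def by (rule pair.F.gen_submodule_submodule[OF bilinear_rels_closed])

sublocale quot: quot_left_module k F NN
  by (simp add: quot_left_module_def quot_left_module_axioms_def NN_submodule pair.F.left_module_axioms)

sublocale Fc: cring F by (rule pair.F_cring)

lemma mult_e:
  "a \<in> carrier A \<Longrightarrow> b \<in> carrier A \<Longrightarrow> c \<in> carrier A \<Longrightarrow> d \<in> carrier A \<Longrightarrow>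
    e (a, b) \<otimes>\<^bsub>F\<^esub> e (c, d) = e (a \<otimes> c, b \<otimes> d)"
  using pair.mult_gen[of "(a, b)" "(c, d)"] by simp

text \<open>Multiplying a bilinearity relation by a generator e(c, d) gives the relation of the same
  kind with c and d multiplied into its entries. Preimages of \<open>NN\<close> under linear maps
  are submodules, so this passes from the relations to all of \<open>NN\<close>, and then from the
  generators to all f.\<close>

lemma mult_null:
  assumes f: "f \<in> carrier F" and r: "r \<in> NN"
  shows "f \<otimes>\<^bsub>F\<^esub> r \<in> NN"
proof -
  have preimage: "submodule {x \<in> carrier F. \<phi> x \<in> NN} k F" if "linear_map k F F \<phi>" for \<phi>
  proof -
    interpret hom: abelian_group_hom F F \<phi>
      using abelian_group_hom_linear_map[OF _ _ that] pair.F.M.abelian_group_axioms by blast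
    show ?thesis
      using that NN_submodule
      by (intro pair.F.lm_submoduleI)
        (auto simp: linear_map_smult pair.F.smult_closed submodule.smult_closed)
  qed
  have gen: "e s \<otimes>\<^bsub>F\<^esub> r \<in> NN" if s: "s \<in> carrier AA" for s
  proof -
    obtain c d where cd: "s = (c, d)" "c \<in> carrier A" "d \<in> carrier A" using s by auto
    have sm: "l \<odot>\<^bsub>F\<^esub> x \<otimes>\<^bsub>F\<^esub> y = l \<odot>\<^bsub>F\<^esub> (x \<otimes>\<^bsub>F\<^esub> y)" "x \<otimes>\<^bsub>F\<^esub> (l \<odot>\<^bsub>F\<^esub> y) = l \<odot>\<^bsub>F\<^esub> (x \<otimes>\<^bsub>F\<^esub> y)"
      if "l \<in> carrier k" "x \<in> carrier F" "y \<in> carrier F" for l x y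
      using that linear_map_smult[OF pair.mult_linear_right] pair.F_smult_mult by auto
    have sA: "c \<otimes> (l \<odot> x) = l \<odot> (c \<otimes> x)"
      if "l \<in> carrier k" "c \<in> carrier A" "x \<in> carrier A" for l c x
      using smult_assoc2[of l x c] that by (simp add: m_comm)
    have "e s \<otimes>\<^bsub>F\<^esub> x \<in> bilinear_rels k A" if "x \<in> bilinear_rels k A" for x
      using that
    proof (cases rule: bilinear_rels_cases)
      case (add_left a a' b)
      have "e s \<otimes>\<^bsub>F\<^esub> x = e ((c \<otimes> a) \<oplus> (c \<otimes> a'), d \<otimes> b) \<ominus>\<^bsub>F\<^esub>
          (e (c \<otimes> a, d \<otimes> b) \<oplus>\<^bsub>F\<^esub> e (c \<otimes> a', d \<otimes> b))"
        using add_left cd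
        by (simp add: a_minus_def Fc.r_distr Fc.r_minus e_closed mult_e r_distr)
      then show ?thesis using bilinear_relsI add_left cd by simp
    next
      case (add_right a b b')
      have "e s \<otimes>\<^bsub>F\<^esub> x = e (c \<otimes> a, (d \<otimes> b) \<oplus> (d \<otimes> b')) \<ominus>\<^bsub>F\<^esub>
          (e (c \<otimes> a, d \<otimes> b) \<oplus>\<^bsub>F\<^esub> e (c \<otimes> a, d \<otimes> b'))"
        using add_right cd
        by (simp add: a_minus_def Fc.r_distr Fc.r_minus e_closed mult_e r_distr)
      then show ?thesis using bilinear_relsI add_right cd by simp
    next
      case (smult_left l a b)
      have "e s \<otimes>\<^bsub>F\<^esub> x = e (l \<odot> (c \<otimes> a), d \<otimes> b) \<ominus>\<^bsub>F\<^esub> (l \<odot>\<^bsub>F\<^esub> e (c \<otimes> a, d \<otimes> b))"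
        using smult_left cd
        by (simp add: a_minus_def Fc.r_distr Fc.r_minus e_closed mult_e sm sA pair.F.smult_closed)
      then show ?thesis using bilinear_relsI smult_left cd by simp
    next
      case (smult_right l a b)
      have "e s \<otimes>\<^bsub>F\<^esub> x = e (c \<otimes> a, l \<odot> (d \<otimes> b)) \<ominus>\<^bsub>F\<^esub> (l \<odot>\<^bsub>F\<^esub> e (c \<otimes> a, d \<otimes> b))"
        using smult_right cd
        by (simp add: a_minus_def Fc.r_distr Fc.r_minus e_closed mult_e sm sA pair.F.smult_closed)
      then show ?thesis using bilinear_relsI smult_right cd by simp
    qed
    then have "bilinear_rels k A \<subseteq> {x \<in> carrier F. e s \<otimes>\<^bsub>F\<^esub> x \<in> NN}"
      using bilinear_rels_closed bilinear_rels_null by blast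
    then have "NN \<subseteq> {x \<in> carrier F. e s \<otimes>\<^bsub>F\<^esub> x \<in> NN}"
      using preimage[OF pair.mult_linear_right[OF pair.gen_closed[OF s]]]
      unfolding tensor_null_def by (intro pair.F.gen_submodule_subset)
    with r show ?thesis by blast
  qed
  have rF: "r \<in> carrier F" using r quot.N.a_subset by blast
  have "f \<in> {x \<in> carrier F. x \<otimes>\<^bsub>F\<^esub> r \<in> NN}"
    by (rule pair.submodule_eq[OF preimage[OF pair.mult_linear_left[OF rF]] _ f])
       (use gen pair.gen_closed in auto)
  then show ?thesis by simp
qed

lemma NN_ideal: "ideal NN F"
proof (rule idealI[OF Fc.ring_axioms quot.N.a_subgroup])
  fix r f assume *: "r \<in> NN" "f \<in> carrier F"
  then show "f \<otimes>\<^bsub>F\<^esub> r \<in> NN" by (intro mult_null)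
  moreover have "r \<in> carrier F" using * quot.N.a_subset by blast
  ultimately show "r \<otimes>\<^bsub>F\<^esub> f \<in> NN" using * by (simp add: Fc.m_comm)
qed

sublocale Ni: ideal NN F by (rule NN_ideal)

abbreviation (input) cl where "cl f \<equiv> NN +>\<^bsub>F\<^esub> f"

lemma T_carrier: "carrier T = cl ` carrier F"
  unfolding tensor_square_def by (rule quot.quot_carrier)

lemma T_add: "f \<in> carrier F \<Longrightarrow> g \<in> carrier F \<Longrightarrow> cl f \<oplus>\<^bsub>T\<^esub> cl g = cl (f \<oplus>\<^bsub>F\<^esub> g)"
  unfolding tensor_square_def by (rule quot.quot_add)

lemma T_smult: "l \<in> carrier k \<Longrightarrow> f \<in> carrier F \<Longrightarrow> l \<odot>\<^bsub>T\<^esub> cl f = cl (l \<odot>\<^bsub>F\<^esub> f)"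
  unfolding tensor_square_def by (rule quot.quot_smult)

lemma T_mult: "f \<in> carrier F \<Longrightarrow> g \<in> carrier F \<Longrightarrow> cl f \<otimes>\<^bsub>T\<^esub> cl g = cl (f \<otimes>\<^bsub>F\<^esub> g)"
  by (simp add: tensor_square_def quot_module_def Ni.rcoset_mult_add)

lemma T_left_module: "left_module k T"
  unfolding tensor_square_def by (rule quot.quot_left_module)

sublocale Tm: module k T
  by (rule left_module_imp_module[OF R.is_cring T_left_module])

text \<open>As a ring, the quotient by the ideal \<open>NN\<close> has the operations of the factor
  ring of the pair algebra; the scalar action is an additional field.\<close>

lemma T_cring: "cring T"
  by (rule cring_cong[OF Ni.quotient_is_cring[OF Fc.is_cring]])
     (simp_all add: tensor_square_def quot_module_def FactRing_def)

sublocale T: algebra k T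
proof (rule algebra.intro[OF Tm.module_axioms])
  show "cring T" by (rule T_cring)
  show "algebra_axioms k T"
    by unfold_locales
      (auto simp: T_carrier T_smult T_mult pair.F_smult_mult pair.F.smult_closed)
qed

lemma tens_cl: "tens k A a b = cl (e (a, b))"
  by (simp add: tens_def)

lemma tens_closed [simp]: "a \<in> carrier A \<Longrightarrow> b \<in> carrier A \<Longrightarrow> tens k A a b \<in> carrier T"
  by (auto simp: T_carrier tens_cl e_closed)

lemma tens_mult:
  assumes "a \<in> carrier A" "b \<in> carrier A" "c \<in> carrier A" "d \<in> carrier A"
  shows "tens k A a b \<otimes>\<^bsub>T\<^esub> tens k A c d = tens k A (a \<otimes> c) (b \<otimes> d)"
  using assms by (simp add: tens_cl T_mult e_closed mult_e)

lemma tens_one: "\<one>\<^bsub>T\<^esub> = tens k A \<one> \<one>"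
  by (simp add: tens_cl tensor_square_def quot_module_def monoid_algebra_simps)

lemma tens_add_left:
  assumes "a \<in> carrier A" "a' \<in> carrier A" "b \<in> carrier A"
  shows "tens k A (a \<oplus> a') b = tens k A a b \<oplus>\<^bsub>T\<^esub> tens k A a' b"
proof -
  have "e (a \<oplus> a', b) \<ominus>\<^bsub>F\<^esub> (e (a, b) \<oplus>\<^bsub>F\<^esub> e (a', b)) \<in> NN"
    using assms by (intro subsetD[OF bilinear_rels_null] bilinear_relsI)
  then show ?thesis
    using assms by (simp add: tens_cl T_add e_closed quot.quot_eq)
qed

lemma tens_add_right:
  assumes "a \<in> carrier A" "b \<in> carrier A" "b' \<in> carrier A"
  shows "tens k A a (b \<oplus> b') = tens k A a b \<oplus>\<^bsub>T\<^esub> tens k A a b'"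
proof -
  have "e (a, b \<oplus> b') \<ominus>\<^bsub>F\<^esub> (e (a, b) \<oplus>\<^bsub>F\<^esub> e (a, b')) \<in> NN"
    using assms by (intro subsetD[OF bilinear_rels_null] bilinear_relsI)
  then show ?thesis
    using assms by (simp add: tens_cl T_add e_closed quot.quot_eq)
qed

lemma tens_smult_left:
  assumes "l \<in> carrier k" "a \<in> carrier A" "b \<in> carrier A"
  shows "tens k A (l \<odot> a) b = l \<odot>\<^bsub>T\<^esub> tens k A a b"
proof -
  have "e (l \<odot> a, b) \<ominus>\<^bsub>F\<^esub> (l \<odot>\<^bsub>F\<^esub> e (a, b)) \<in> NN"
    using assms by (intro subsetD[OF bilinear_rels_null] bilinear_relsI)
  then show ?thesis
    using assms by (simp add: tens_cl T_smult e_closed quot.quot_eq pair.F.smult_closed)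
qed

lemma tens_smult_right:
  assumes "l \<in> carrier k" "a \<in> carrier A" "b \<in> carrier A"
  shows "tens k A a (l \<odot> b) = l \<odot>\<^bsub>T\<^esub> tens k A a b"
proof -
  have "e (a, l \<odot> b) \<ominus>\<^bsub>F\<^esub> (l \<odot>\<^bsub>F\<^esub> e (a, b)) \<in> NN"
    using assms by (intro subsetD[OF bilinear_rels_null] bilinear_relsI)
  then show ?thesis
    using assms by (simp add: tens_cl T_smult e_closed quot.quot_eq pair.F.smult_closed)
qed

text \<open>Scalars are absorbed by l(a \<otimes> b) = (l a) \<otimes> b, and 0 = 0 \<otimes> 0;
  hence pure tensors span T under addition alone.\<close>

lemma T_induct [consumes 1, case_names tens add]:
  assumes x: "x \<in> carrier T"
    and tens: "\<And>a b. a \<in> carrier A \<Longrightarrow> b \<in> carrier A \<Longrightarrow> Q (tens k A a b)"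
    and add: "\<And>x y. x \<in> carrier T \<Longrightarrow> y \<in> carrier T \<Longrightarrow> Q x \<Longrightarrow> Q y \<Longrightarrow> Q (x \<oplus>\<^bsub>T\<^esub> y)"
  shows "Q x"
proof -
  have smult_tens: "l \<odot>\<^bsub>T\<^esub> tens k A a b = tens k A (l \<odot> a) b"
    if "l \<in> carrier k" "a \<in> carrier A" "b \<in> carrier A" for l a b
    using that by (simp add: tens_smult_left)
  have zero: "\<zero>\<^bsub>T\<^esub> = tens k A \<zero> \<zero>"
    using smult_tens[of "\<zero>\<^bsub>k\<^esub>" "\<zero>" "\<zero>"] by simp
  obtain f where f: "f \<in> carrier F" "x = cl f" using x by (auto simp: T_carrier)
  have "Q (cl f)"
  proof (rule free_module_induct[where Q = "\<lambda>f. Q (cl f)", OF R.ring_axioms])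
    show "f \<in> carrier (free_module k (carrier AA))" using f by (simp add: monoid_algebra_simps)
    have "cl \<zero>\<^bsub>F\<^esub> = \<zero>\<^bsub>T\<^esub>"
      by (simp add: tensor_square_def quot_module_def pair.F.M.a_coset_add_zero quot.N.a_subset)
    then show "Q (cl (\<lambda>_. \<zero>\<^bsub>k\<^esub>))"
      using tens[of "\<zero>" "\<zero>"] zero by (simp add: monoid_algebra_simps free_module_simps)
  next
    fix f l s
    assume "f \<in> carrier (free_module k (carrier AA))" "Q (cl f)" "l \<in> carrier k" "s \<in> carrier AA"
    then have *: "f \<in> carrier F" "Q (cl f)" "l \<in> carrier k" "s \<in> carrier AA"
      by (simp_all add: monoid_algebra_simps)
    obtain a b where s: "s = (a, b)" "a \<in> carrier A" "b \<in> carrier A" using * by auto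
    have "cl (f \<oplus>\<^bsub>F\<^esub> (l \<odot>\<^bsub>F\<^esub> e s)) = cl f \<oplus>\<^bsub>T\<^esub> tens k A (l \<odot> a) b"
      using * s
      by (simp add: tens_smult_left, simp add: tens_cl T_add T_smult e_closed pair.F.smult_closed)
    moreover have "Q (cl f \<oplus>\<^bsub>T\<^esub> tens k A (l \<odot> a) b)"
      using * s by (intro add tens tens_closed) (auto simp: T_carrier)
    ultimately show "Q (cl (f \<oplus>\<^bsub>free_module k (carrier AA)\<^esub>
        (l \<odot>\<^bsub>free_module k (carrier AA)\<^esub> free_gen k s)))"
      by (simp add: monoid_algebra_simps)
  qed
  with f show ?thesis by simp
qed

section \<open>The universal property of the tensor square\<close>

definition tensor_lift :: "('k, 'm, 'e) module_scheme \<Rightarrow> ('a \<times> 'a \<Rightarrow> 'm) \<Rightarrow> ('a \<times> 'a \<Rightarrow> 'k) set \<Rightarrow> 'm"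
  where "tensor_lift N h Y = the_elem (lin_ext k N h ` Y)"

text \<open>Bilinearity of h says that its linear extension kills the four families of relations,
  hence the submodule they generate; so it descends to the quotient.\<close>

lemma
  assumes N: "left_module k N"
    and lin1: "\<And>b. b \<in> carrier A \<Longrightarrow> linear_map k A N (\<lambda>a. h (a, b))"
    and lin2: "\<And>a. a \<in> carrier A \<Longrightarrow> linear_map k A N (\<lambda>b. h (a, b))"
  shows tensor_lift_linear_map: "linear_map k T N (tensor_lift N h)"
    and tensor_lift_tens: "a \<in> carrier A \<Longrightarrow> b \<in> carrier A \<Longrightarrow> tensor_lift N h (tens k A a b) = h (a, b)"
proof -
  interpret N: left_module k N by fact
  have h: "h \<in> carrier AA \<rightarrow> carrier N"
    using linear_map_closed[OF lin1] by auto
  let ?E = "lin_ext k N h"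
  have lin: "linear_map k F N ?E" by (rule pair.lin_ext_linear_map_F[OF N h])
  interpret hom: abelian_group_hom F N ?E
    using abelian_group_hom_linear_map[OF _ _ lin] pair.F.M.abelian_group_axioms
      N.M.abelian_group_axioms by blast
  have gen: "?E (e (a, b)) = h (a, b)" if "a \<in> carrier A" "b \<in> carrier A" for a b
    using that h by (intro N.lin_ext_gen) auto
  have hc: "h (a, b) \<in> carrier N" if "a \<in> carrier A" "b \<in> carrier A" for a b
    using that h by auto
  have rels: "?E r = \<zero>\<^bsub>N\<^esub>" if "r \<in> bilinear_rels k A" for r
    using that
  proof (cases rule: bilinear_rels_cases)
    case (add_left a a' b)
    then show ?thesis
      using linear_map_add[OF lin1, of b a a']
      by (simp add: a_minus_def e_closed gen hc N.M.r_neg)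
  next
    case (add_right a b b')
    then show ?thesis
      using linear_map_add[OF lin2, of a b b']
      by (simp add: a_minus_def e_closed gen hc N.M.r_neg)
  next
    case (smult_left l a b)
    then show ?thesis
      using linear_map_smult[OF lin1, of b a l]
      by (simp add: a_minus_def e_closed gen hc N.M.r_neg pair.F.smult_closed linear_map_smult[OF lin]
          N.smult_closed)
  next
    case (smult_right l a b)
    then show ?thesis
      using linear_map_smult[OF lin2, of a b l]
      by (simp add: a_minus_def e_closed gen hc N.M.r_neg pair.F.smult_closed linear_map_smult[OF lin]
          N.smult_closed)
  qed
  have null: "?E x = \<zero>\<^bsub>N\<^esub>" if "x \<in> NN" for x
  proof -
    have "NN \<subseteq> {x \<in> carrier F. ?E x = \<zero>\<^bsub>N\<^esub>}"
      unfolding tensor_null_def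
      using rels bilinear_rels_closed
      by (intro pair.F.gen_submodule_subset pair.F.kernel_submodule[OF N lin]) blast
    with that show ?thesis by blast
  qed
  show "linear_map k T N (tensor_lift N h)"
    using quot.quot_lift_linear_map[OF N lin null]
    unfolding tensor_square_def tensor_lift_def[abs_def] .
  show "tensor_lift N h (tens k A a b) = h (a, b)" if "a \<in> carrier A" "b \<in> carrier A" for a b
    using quot.quot_lift_eq[OF N lin null, of "e (a, b)"] that
    by (simp add: tensor_lift_def tens_cl e_closed gen)
qed

text \<open>Makes the multiplication map an instance of the universal property.\<close>

lemma mult_map_lift: "mult_map k A = tensor_lift A (\<lambda>z. fst z \<otimes> snd z)"
  by (simp add: fun_eq_iff mult_map_def tensor_lift_def lin_ext_def)

lemma smult_mult_right:
  "l \<in> carrier k \<Longrightarrow> a \<in> carrier A \<Longrightarrow> b \<in> carrier A \<Longrightarrow> a \<otimes> (l \<odot> b) = l \<odot> (a \<otimes> b)"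
  using smult_assoc2[of l b a] by (simp add: m_comm)

lemma
  shows mult_map_linear_map: "linear_map k T A (mult_map k A)"
    and mult_map_tens: "a \<in> carrier A \<Longrightarrow> b \<in> carrier A \<Longrightarrow> mult_map k A (tens k A a b) = a \<otimes> b"
proof -
  have l: "left_module k A" by (rule module_imp_left_module) (rule module_axioms)
  have 1: "linear_map k A A (\<lambda>a. fst (a, b) \<otimes> snd (a, b))" if "b \<in> carrier A" for b
    using that by (intro linear_mapI) (auto simp: l_distr smult_assoc2)
  have 2: "linear_map k A A (\<lambda>b. fst (a, b) \<otimes> snd (a, b))" if "a \<in> carrier A" for a
    using that by (intro linear_mapI) (auto simp: r_distr smult_mult_right)
  show "linear_map k T A (mult_map k A)"
    unfolding mult_map_lift by (rule tensor_lift_linear_map[OF l 1 2])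
  show "mult_map k A (tens k A a b) = a \<otimes> b" if "a \<in> carrier A" "b \<in> carrier A"
    unfolding mult_map_lift using that by (subst tensor_lift_tens[OF l 1 2]) auto
qed

text \<open>Both sides are additive in each factor, and for pure tensors multiplicativity is
  commutativity of A.\<close>

lemma mult_map_ring_hom: "mult_map k A \<in> ring_hom T A"
proof (rule ring_hom_memI)
  show closed: "mult_map k A x \<in> carrier A" if "x \<in> carrier T" for x
    by (rule linear_map_closed[OF mult_map_linear_map that])
  show madd: "mult_map k A (x \<oplus>\<^bsub>T\<^esub> y) = mult_map k A x \<oplus> mult_map k A y"
    if "x \<in> carrier T" "y \<in> carrier T" for x y
    by (rule linear_map_add[OF mult_map_linear_map that])
  show "mult_map k A \<one>\<^bsub>T\<^esub> = \<one>"
    by (simp add: tens_one mult_map_tens)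
  fix x y assume x: "x \<in> carrier T" and y: "y \<in> carrier T"
  show "mult_map k A (x \<otimes>\<^bsub>T\<^esub> y) = mult_map k A x \<otimes> mult_map k A y"
    using x
  proof (induction x rule: T_induct)
    case (tens a b)
    show ?case
      using y
    proof (induction y rule: T_induct)
      case (tens c d)
      with \<open>a \<in> carrier A\<close> \<open>b \<in> carrier A\<close> show ?case
        by (simp add: tens_mult mult_map_tens m_ac)
    next
      case (add x y)
      with tens show ?case by (simp add: T.r_distr closed madd r_distr)
    qed
  next
    case (add x x')
    with y show ?case by (simp add: T.l_distr closed madd l_distr)
  qed
qed

end

section \<open>The cross terms of the \<open>p\<close>-map\<close>

text \<open>Turns the double sums of the cocycle identity into sums over sets of exponent
  pairs.\<close>

lemma (in abelian_monoid) finsum_Sigma: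
  assumes "finite I" "\<And>i. i \<in> I \<Longrightarrow> finite (B i)"
    and "\<And>i j. i \<in> I \<Longrightarrow> j \<in> B i \<Longrightarrow> f i j \<in> carrier G"
  shows "(\<Oplus>i\<in>I. \<Oplus>j\<in>B i. f i j) = (\<Oplus>z\<in>Sigma I B. f (fst z) (snd z))"
  using assms
proof (induction I rule: finite_induct)
  case (insert i I)
  have S: "Sigma (insert i I) B = Pair i ` B i \<union> Sigma I B" by auto
  have "(\<Oplus>z\<in>Sigma (insert i I) B. f (fst z) (snd z)) =
    (\<Oplus>z\<in>Pair i ` B i. f (fst z) (snd z)) \<oplus> (\<Oplus>z\<in>Sigma I B. f (fst z) (snd z))"
    unfolding S using insert by (intro finsum_Un_disjoint) auto
  also have "(\<Oplus>z\<in>Pair i ` B i. f (fst z) (snd z)) = (\<Oplus>j\<in>B i. f i j)"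
    using insert by (subst finsum_reindex) (auto simp: inj_on_def)
  finally show ?case
    using insert by (simp add: Pi_def)
qed simp

text \<open>For prime p this is ((x + y)^p - x^p - y^p)/p, written with integer coefficients so that
  it makes sense in every commutative ring. Over a field of characteristic p its negative is
  \<open>pd_cross\<close>.\<close>

definition cross :: "('a, 'b) ring_scheme \<Rightarrow> nat \<Rightarrow> 'a \<Rightarrow> 'a \<Rightarrow> 'a"
  where "cross R p x y = (\<Oplus>\<^bsub>R\<^esub>j\<in>{1..p - 1}.
    add_pow R ((p choose j) div p) (x [^]\<^bsub>R\<^esub> j \<otimes>\<^bsub>R\<^esub> y [^]\<^bsub>R\<^esub> (p - j)))"

context cring
begin

lemma add_pow_mult_add_pow:
  assumes "x \<in> carrier R" "y \<in> carrier R"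
  shows "([m] \<cdot> x) \<otimes> ([n] \<cdot> y) = [(m * n :: nat)] \<cdot> (x \<otimes> y)"
  using assms by (simp add: add_pow_ldistr add_pow_rdistr add.nat_pow_pow mult.commute)

lemma binomial_ring:
  assumes x: "x \<in> carrier R" and y: "y \<in> carrier R"
  shows "(x \<oplus> y) [^] n = (\<Oplus>i\<in>{..n}. [(n choose i)] \<cdot> (x [^] i \<otimes> y [^] (n - i)))"
proof (induction n)
  case (Suc n)
  define t where "t i j = x [^] i \<otimes> y [^] j" for i j :: nat
  have t: "t i j \<in> carrier R" for i j unfolding t_def using x y by simp
  have tx: "t i j \<otimes> x = t (Suc i) j" for i j
    unfolding t_def using x y by (simp add: m_ac)
  have ty: "t i j \<otimes> y = t i (Suc j)" for i j
    unfolding t_def using x y by (simp add: m_ac)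
  have "(x \<oplus> y) [^] Suc n = (\<Oplus>i\<in>{..n}. [(n choose i)] \<cdot> t i (n - i)) \<otimes> (x \<oplus> y)"
    using Suc by (simp add: t_def)
  also have "\<dots> = (\<Oplus>i\<in>{..n}. [(n choose i)] \<cdot> t i (n - i)) \<otimes> x \<oplus>
      (\<Oplus>i\<in>{..n}. [(n choose i)] \<cdot> t i (n - i)) \<otimes> y"
    using x y t by (intro r_distr) (auto intro!: finsum_closed)
  also have "(\<Oplus>i\<in>{..n}. [(n choose i)] \<cdot> t i (n - i)) \<otimes> x =
      (\<Oplus>i\<in>{..n}. [(n choose i)] \<cdot> t (Suc i) (n - i))"
    using x t by (subst finsum_ldistr) (auto simp: add_pow_ldistr tx)
  also have "(\<Oplus>i\<in>{..n}. [(n choose i)] \<cdot> t i (n - i)) \<otimes> y =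
      (\<Oplus>i\<in>{..n}. [(n choose i)] \<cdot> t i (Suc n - i))"
    using y t
    by (subst finsum_ldistr) (auto simp: add_pow_ldistr ty Suc_diff_le intro!: finsum_cong')
  \<comment> \<open>The added summand i = n + 1 has coefficient n choose (n + 1) = 0; it gives the
    sum the range from which i = 0 can be split off.\<close>
  also have "\<dots> = (\<Oplus>i\<in>{..Suc n}. [(n choose i)] \<cdot> t i (Suc n - i))"
    using t by (subst finsum_Suc) (auto intro!: finsum_closed simp: binomial_eq_0)
  also have "\<dots> = (\<Oplus>i\<in>{..n}. [(n choose Suc i)] \<cdot> t (Suc i) (n - i)) \<oplus> t 0 (Suc n)"
    using t by (subst finsum_Suc2) auto
  also have "(\<Oplus>i\<in>{..n}. [(n choose i)] \<cdot> t (Suc i) (n - i)) \<oplus> \<dots> =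
      ((\<Oplus>i\<in>{..n}. [(n choose i)] \<cdot> t (Suc i) (n - i)) \<oplus>
       (\<Oplus>i\<in>{..n}. [(n choose Suc i)] \<cdot> t (Suc i) (n - i))) \<oplus> t 0 (Suc n)"
    using t by (intro a_assoc[symmetric]) (auto intro!: finsum_closed)
  also have "(\<Oplus>i\<in>{..n}. [(n choose i)] \<cdot> t (Suc i) (n - i)) \<oplus>
       (\<Oplus>i\<in>{..n}. [(n choose Suc i)] \<cdot> t (Suc i) (n - i)) =
       (\<Oplus>i\<in>{..n}. [(Suc n choose Suc i)] \<cdot> t (Suc i) (n - i))"
    using t by (subst finsum_addf[symmetric]) (auto simp: add.nat_pow_mult)
  also have "\<dots> \<oplus> t 0 (Suc n) = (\<Oplus>i\<in>{..Suc n}. [(Suc n choose i)] \<cdot> t i (Suc n - i))"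
    using t by (subst finsum_Suc2) auto
  finally show ?case by (simp add: t_def)
qed simp

lemma cross_closed [simp]: "x \<in> carrier R \<Longrightarrow> y \<in> carrier R \<Longrightarrow> cross R p x y \<in> carrier R"
  unfolding cross_def by (intro finsum_closed) auto

lemma cross_comm:
  assumes "x \<in> carrier R" "y \<in> carrier R"
  shows "cross R p x y = cross R p y x"
proof -
  have img: "(\<lambda>j. p - j) ` {1..p - 1} = {1..p - 1}"
  proof (intro equalityI subsetI)
    fix j assume "j \<in> {1..p - 1}"
    then show "j \<in> (\<lambda>j. p - j) ` {1..p - 1}" by (intro image_eqI[of _ _ "p - j"]) auto
  qed auto
  have "cross R p x y = (\<Oplus>j\<in>(\<lambda>j. p - j) ` {1..p - 1}. [((p choose j) div p)] \<cdot> (x [^] j \<otimes> y [^] (p - j)))"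
    unfolding cross_def img ..
  also have "\<dots> = (\<Oplus>j\<in>{1..p - 1}. [((p choose (p - j)) div p)] \<cdot> (x [^] (p - j) \<otimes> y [^] (p - (p - j))))"
    using assms by (intro finsum_reindex) (auto simp: inj_on_def)
  also have "\<dots> = cross R p y x"
    unfolding cross_def
  proof (intro finsum_cong')
    show "[((p choose (p - j)) div p)] \<cdot> (x [^] (p - j) \<otimes> y [^] (p - (p - j))) =
        [((p choose j) div p)] \<cdot> (y [^] j \<otimes> x [^] (p - j))" if "j \<in> {1..p - 1}" for j
      using that assms binomial_symmetric[of j p] by (auto simp: m_comm)
  qed (use assms in auto)
  finally show ?thesis .
qed

text \<open>Both sides are the sum of the monomials of \<open>((x + y + z)^p - x^p - y^p - z^p) / p\<close>,
  indexed by the exponents \<open>(i, l)\<close> of \<open>x\<close> and \<open>y\<close>.\<close>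

lemma cross_cocycle:
  assumes p: "Factorial_Ring.prime p"
    and x: "x \<in> carrier R" and y: "y \<in> carrier R" and z: "z \<in> carrier R"
  shows "cross R p x y \<oplus> cross R p (x \<oplus> y) z = cross R p y z \<oplus> cross R p x (y \<oplus> z)"
proof -
  have p0: "p > 0" "p > 1" using p prime_gt_0_nat prime_gt_1_nat by auto
  \<comment> \<open>The trinomial coefficient p!/(i! l! (p - i - l)!), divided by p. It arises in
    two factored forms, one for each order of expansion.\<close>
  define g where "g w = [(((p choose (fst w + snd w)) * ((fst w + snd w) choose fst w)) div p)] \<cdot>
    (x [^] fst w \<otimes> y [^] snd w \<otimes> z [^] (p - (fst w + snd w)))" for w
  have g: "g w \<in> carrier R" for w unfolding g_def using x y z by simp
  \<comment> \<open>The exponent pairs of the four cross terms: without z, with z to a power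
    strictly between 0 and p, without x, and with x to such a power. \<open>S1\<close> and
    \<open>S2\<close> together, like \<open>S3\<close> and \<open>S4\<close>, cover every monomial
    of degree p except x^p, y^p and z^p exactly once.\<close>
  define S1 where "S1 = (\<lambda>i. (i, p - i)) ` {1..p - 1}"
  define S2 where "S2 = (\<lambda>w. (snd w, fst w - snd w)) ` (SIGMA j:{1..p - 1}. {..j})"
  define S3 where "S3 = Pair (0::nat) ` {1..p - 1}"
  define S4 where "S4 = (SIGMA i:{1..p - 1}. {..p - i})"
  have fin: "finite S1" "finite S2" "finite S3" "finite S4"
    by (simp_all add: S1_def S2_def S3_def S4_def)
  have dv: "p dvd (p choose j)" if "j \<in> {1..p - 1}" for j
    using that p p0 by (intro dvd_choose_prime) auto
  have 1: "cross R p x y = finsum R g S1"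
    unfolding S1_def cross_def using x y z g
    by (subst finsum_reindex) (auto simp: inj_on_def g_def intro!: finsum_cong')
  have 3: "cross R p y z = finsum R g S3"
    unfolding S3_def cross_def using x y z g
    by (subst finsum_reindex) (auto simp: inj_on_def g_def intro!: finsum_cong')
  have "cross R p (x \<oplus> y) z = (\<Oplus>j\<in>{1..p - 1}. \<Oplus>i\<in>{..j}. g (i, j - i))"
    unfolding cross_def
  proof (rule finsum_cong')
    fix j assume j: "j \<in> {1..p - 1}"
    have "[((p choose j) div p)] \<cdot> ((x \<oplus> y) [^] j \<otimes> z [^] (p - j)) =
      (x \<oplus> y) [^] j \<otimes> ([((p choose j) div p)] \<cdot> (z [^] (p - j)))"
      using x y z by (simp add: add_pow_rdistr)
    also have "\<dots> = (\<Oplus>i\<in>{..j}. [(j choose i)] \<cdot> (x [^] i \<otimes> y [^] (j - i)) \<otimes>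
        ([((p choose j) div p)] \<cdot> (z [^] (p - j))))"
      unfolding binomial_ring[OF x y] using x y z by (intro finsum_ldistr) auto
    also have "\<dots> = (\<Oplus>i\<in>{..j}. g (i, j - i))"
    proof (rule finsum_cong')
      fix i assume "i \<in> {..j}"
      then show "[(j choose i)] \<cdot> (x [^] i \<otimes> y [^] (j - i)) \<otimes>
        ([((p choose j) div p)] \<cdot> (z [^] (p - j))) = g (i, j - i)"
        using x y z dv[OF j]
        by (simp add: add_pow_mult_add_pow g_def div_mult_swap mult.commute)
    qed (use g in auto)
    finally show "[((p choose j) div p)] \<cdot> ((x \<oplus> y) [^] j \<otimes> z [^] (p - j)) =
        (\<Oplus>i\<in>{..j}. g (i, j - i))" .
  qed (use g in \<open>auto intro!: finsum_closed\<close>)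
  also have "\<dots> = (\<Oplus>w\<in>(SIGMA j:{1..p - 1}. {..j}). g (snd w, fst w - snd w))"
    using g by (intro finsum_Sigma) auto
  also have "\<dots> = finsum R g S2"
    unfolding S2_def using g by (subst finsum_reindex) (auto simp: inj_on_def)
  finally have 2: "cross R p (x \<oplus> y) z = finsum R g S2" .
  have "cross R p x (y \<oplus> z) = (\<Oplus>i\<in>{1..p - 1}. \<Oplus>l\<in>{..p - i}. g (i, l))"
    unfolding cross_def
  proof (rule finsum_cong')
    fix i assume i: "i \<in> {1..p - 1}"
    have "[((p choose i) div p)] \<cdot> (x [^] i \<otimes> (y \<oplus> z) [^] (p - i)) =
      ([((p choose i) div p)] \<cdot> (x [^] i)) \<otimes> (y \<oplus> z) [^] (p - i)"
      using x y z by (simp add: add_pow_ldistr)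
    also have "\<dots> = (\<Oplus>l\<in>{..p - i}. ([((p choose i) div p)] \<cdot> (x [^] i)) \<otimes>
        ([((p - i) choose l)] \<cdot> (y [^] l \<otimes> z [^] (p - i - l))))"
      unfolding binomial_ring[OF y z] using x y z by (intro finsum_rdistr) auto
    also have "\<dots> = (\<Oplus>l\<in>{..p - i}. g (i, l))"
    proof (rule finsum_cong')
      fix l assume l: "l \<in> {..p - i}"
      \<comment> \<open>Choosing i and then l out of the remaining p - i is choosing i + l and then
        i among them; division by p stays exact because p divides p choose i.\<close>
      have "(p choose i) div p * ((p - i) choose l) = (p choose i) * ((p - i) choose l) div p"
        using dv[OF i] by (simp add: div_mult_swap mult.commute)
      also have "(p choose i) * ((p - i) choose l) = (p choose (i + l)) * ((i + l) choose i)"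
        using i l choose_mult[of i "i + l" p] by auto
      finally show "([((p choose i) div p)] \<cdot> (x [^] i)) \<otimes>
        ([((p - i) choose l)] \<cdot> (y [^] l \<otimes> z [^] (p - i - l))) = g (i, l)"
        using x y z by (simp add: add_pow_mult_add_pow g_def m_assoc)
    qed (use g in auto)
    finally show "[((p choose i) div p)] \<cdot> (x [^] i \<otimes> (y \<oplus> z) [^] (p - i)) =
        (\<Oplus>l\<in>{..p - i}. g (i, l))" .
  qed (use g in \<open>auto intro!: finsum_closed\<close>)
  also have "\<dots> = finsum R g S4"
    unfolding S4_def using g by (subst finsum_Sigma) auto
  finally have 4: "cross R p x (y \<oplus> z) = finsum R g S4" .
  have S1: "S1 = {w. fst w + snd w = p \<and> fst w \<ge> 1 \<and> snd w \<ge> 1}"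
    using p0 by (auto simp: S1_def image_iff)
  have S2: "S2 = {w. 1 \<le> fst w + snd w \<and> fst w + snd w \<le> p - 1}"
  proof (intro equalityI subsetI)
    fix w assume "w \<in> {w. 1 \<le> fst w + snd w \<and> fst w + snd w \<le> p - 1}"
    then show "w \<in> S2"
      unfolding S2_def by (intro image_eqI[of _ _ "(fst w + snd w, fst w)"]) auto
  qed (auto simp: S2_def)
  have S3: "S3 = {w. fst w = 0 \<and> 1 \<le> snd w \<and> snd w \<le> p - 1}"
    by (auto simp: S3_def)
  have S4: "S4 = {w. 1 \<le> fst w \<and> fst w \<le> p - 1 \<and> fst w + snd w \<le> p}"
    using p0 by (auto simp: S4_def)
  have "S1 \<inter> S2 = {}" "S3 \<inter> S4 = {}" "S1 \<union> S2 = S3 \<union> S4"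
    unfolding S1 S2 S3 S4 using p0 by auto
  then show ?thesis
    unfolding 1 2 3 4 using fin g
    by (metis (no_types, lifting) finsum_Un_disjoint Pi_I)
qed

lemma ideal_finsum_closed:
  assumes "ideal J R" "finite B" "\<And>i. i \<in> B \<Longrightarrow> f i \<in> J"
  shows "finsum R f B \<in> J"
proof -
  interpret J: ideal J R by fact
  show ?thesis
    using assms(2,3)
    by (induction B rule: finite_induct) (auto simp: Pi_def intro!: J.a_closed)
qed

lemma ideal_add_pow_closed: "ideal J R \<Longrightarrow> x \<in> J \<Longrightarrow> add_pow R (n :: nat) x \<in> J"
  by (induction n)
    (auto intro: additive_subgroup.zero_closed additive_subgroup.a_closed ideal.axioms(1))

text \<open>Every monomial contains x, as the exponents j start at 1.\<close>

lemma cross_ideal: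
  assumes "ideal J R" "x \<in> J" "y \<in> carrier R"
  shows "cross R p x y \<in> J"
  unfolding cross_def
proof (rule ideal_finsum_closed[OF assms(1)])
  interpret J: ideal J R by fact
  fix j assume "j \<in> {1..p - 1}"
  then obtain i where "j = Suc i" by (cases j) auto
  then have "x [^] j \<in> J" using assms by (simp add: J.I_l_closed)
  then show "[((p choose j) div p)] \<cdot> (x [^] j \<otimes> y [^] (p - j)) \<in> J"
    using assms by (intro ideal_add_pow_closed[OF assms(1)] J.I_r_closed) auto
qed simp

lemma cross_scale:
  assumes "u \<in> carrier R" "x \<in> carrier R" "y \<in> carrier R"
  shows "cross R p (u \<otimes> x) (u \<otimes> y) = u [^] p \<otimes> cross R p x y"
proof -
  have "u [^] p \<otimes> cross R p x y =
    (\<Oplus>j\<in>{1..p - 1}. u [^] p \<otimes> [((p choose j) div p)] \<cdot> (x [^] j \<otimes> y [^] (p - j)))"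
    unfolding cross_def using assms by (intro finsum_rdistr) auto
  also have "\<dots> = cross R p (u \<otimes> x) (u \<otimes> y)"
    unfolding cross_def
  proof (rule finsum_cong')
    fix j assume "j \<in> {1..p - 1}"
    then have "j + (p - j) = p" by auto
    then have "u [^] p = u [^] j \<otimes> u [^] (p - j)" using assms nat_pow_mult[of u j "p - j"] by simp
    then show "u [^] p \<otimes> [((p choose j) div p)] \<cdot> (x [^] j \<otimes> y [^] (p - j)) =
      [((p choose j) div p)] \<cdot> ((u \<otimes> x) [^] j \<otimes> (u \<otimes> y) [^] (p - j))"
      using assms by (simp add: add_pow_rdistr nat_pow_distrib m_ac)
  qed (use assms in auto)
  finally show ?thesis by simp
qed

text \<open>By homogeneity the common factor x comes out as x^p. This is the source of nearly every
  vanishing cross term below.\<close>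

lemma cross_nil:
  assumes "a \<in> carrier R" "b \<in> carrier R" "x \<in> carrier R" "x [^] p = \<zero>"
  shows "cross R p (a \<otimes> x) (b \<otimes> x) = \<zero>"
  using cross_scale[of x a b p] assms by (simp add: m_comm)

text \<open>Only the summand j = p - 1 is linear in y, with coefficient (p choose (p - 1)) div p =
  1; all others contain the square of y.\<close>

lemma cross_mod_square:
  assumes p: "p \<ge> 2" and K: "ideal K R" and x: "x \<in> carrier R" and y: "y \<in> carrier R"
    and yy: "y \<otimes> y \<in> K"
  shows "cross R p x y \<ominus> x [^] (p - 1) \<otimes> y \<in> K"
proof -
  interpret K: ideal K R by fact
  let ?t = "\<lambda>j. [((p choose j) div p)] \<cdot> (x [^] j \<otimes> y [^] (p - j))"
  have I: "{1..p - 1} = insert (p - 1) {1..p - 2}" using p by auto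
  define S where "S = finsum R ?t {1..p - 2}"
  have "cross R p x y = ?t (p - 1) \<oplus> S"
    unfolding cross_def I S_def using p x y by (intro finsum_insert) auto
  moreover have "?t (p - 1) = x [^] (p - 1) \<otimes> y"
    using p x y binomial_symmetric[of 1 p] by simp
  moreover have mem: "S \<in> K"
    unfolding S_def
  proof (rule ideal_finsum_closed[OF K])
    fix j assume "j \<in> {1..p - 2}"
    then have "p - j = (p - j - 2) + 2" by auto
    then have "y [^] (p - j) = y [^] (p - j - 2) \<otimes> (y \<otimes> y)"
      using y by (metis nat_pow_mult nat_pow_Suc nat_pow_0 l_one numeral_2_eq_2)
    then have "y [^] (p - j) \<in> K" using yy y by (simp add: K.I_l_closed)
    then show "?t j \<in> K" using x by (intro ideal_add_pow_closed[OF K] K.I_l_closed) auto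
  qed simp
  moreover have "S \<in> carrier R" using mem by (rule K.Icarr)
  ultimately show ?thesis
    using x y by (simp add: a_minus_def a_comm[of _ S] a_assoc r_neg)
qed

lemma frobenius_add:
  assumes p: "Factorial_Ring.prime (p :: nat)" and char: "[p] \<cdot> \<one> = \<zero>"
    and x: "x \<in> carrier R" and y: "y \<in> carrier R"
  shows "(x \<oplus> y) [^] p = x [^] p \<oplus> y [^] p"
proof -
  have p0: "p > 0" using p prime_gt_0_nat by auto
  have pz: "[p] \<cdot> a = \<zero>" if "a \<in> carrier R" for a
    using that char add_pow_ldistr[of \<one> a p] by simp
  have mid: "[(p choose i)] \<cdot> (x [^] i \<otimes> y [^] (p - i)) = \<zero>" if "i \<notin> {0, p}" "i \<le> p" for i
  proof -
    have "p dvd (p choose i)" using that p p0 by (intro dvd_choose_prime) auto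
    then obtain m where m: "(p choose i) = p * m" by blast
    show ?thesis unfolding m using x y pz by (simp add: add.nat_pow_pow[symmetric])
  qed
  have "(x \<oplus> y) [^] p = (\<Oplus>i\<in>{0, p}. [(p choose i)] \<cdot> (x [^] i \<otimes> y [^] (p - i)))"
    unfolding binomial_ring[OF x y]
    using x y mid by (intro add.finprod_mono_neutral_cong_right) auto
  then show ?thesis using x y p0 by (simp add: a_comm)
qed

end

section \<open>The cross terms in characteristic p\<close>

context char_p_field
begin

lemma char_p: "add_pow k p \<one>\<^bsub>k\<^esub> = \<zero>\<^bsub>k\<^esub>"
  using characteristic by simp

text \<open>Since j (p choose j) = p ((p - 1) choose (j - 1)), the integer (p choose j)/p times j is
  (p - 1) choose (j - 1), which is (-1)^(j-1) modulo p. Dividing by j, invertible for 0 < j < p,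
  gives the coefficient.\<close>

lemma cross_coeff:
  assumes "j \<in> {1..p - 1}"
  shows "((\<ominus>\<^bsub>k\<^esub> \<one>\<^bsub>k\<^esub>) [^]\<^bsub>k\<^esub> j) \<otimes>\<^bsub>k\<^esub> inv\<^bsub>k\<^esub> (add_pow k j \<one>\<^bsub>k\<^esub>) =
    \<ominus>\<^bsub>k\<^esub> (add_pow k ((p choose j) div p) \<one>\<^bsub>k\<^esub>)"
proof -
  have p0: "p > 0" using prime_p prime_gt_0_nat by auto
  \<comment> \<open>By Pascal's rule two consecutive entries of row p - 1 add up to an entry of row
    p, which p divides; so modulo p the entries alternate between 1 and -1.\<close>
  have pm: "add_pow k (p - 1 choose i) \<one>\<^bsub>k\<^esub> = (\<ominus>\<^bsub>k\<^esub> \<one>\<^bsub>k\<^esub>) [^]\<^bsub>k\<^esub> i" if "i < p" for i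
    using that
  proof (induction i)
    case (Suc i)
    have "(p - 1 choose i) + (p - 1 choose Suc i) = p choose Suc i"
      using p0 by (metis Suc_diff_1 binomial_Suc_Suc)
    moreover have "p dvd (p choose Suc i)" using Suc.prems prime_p by (intro dvd_choose_prime) auto
    ultimately have "add_pow k ((p - 1 choose i) + (p - 1 choose Suc i)) \<one>\<^bsub>k\<^esub> = \<zero>\<^bsub>k\<^esub>"
      using characteristic by simp
    then have *: "(\<ominus>\<^bsub>k\<^esub> \<one>\<^bsub>k\<^esub>) [^]\<^bsub>k\<^esub> i \<oplus>\<^bsub>k\<^esub> add_pow k (p - 1 choose Suc i) \<one>\<^bsub>k\<^esub> = \<zero>\<^bsub>k\<^esub>"
      using Suc by (simp add: add.nat_pow_mult[symmetric])
    have "add_pow k (p - 1 choose Suc i) \<one>\<^bsub>k\<^esub> = \<ominus>\<^bsub>k\<^esub> ((\<ominus>\<^bsub>k\<^esub> \<one>\<^bsub>k\<^esub>) [^]\<^bsub>k\<^esub> i)"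
      using sum_zero_eq_neg[OF _ _ *] by simp
    then show ?case by (simp add: r_minus)
  qed simp
  have j: "0 < j" "j < p" using assms p0 by auto
  define w where "w = (p choose j) div p"
  have "p dvd (p choose j)" using j prime_p by (intro dvd_choose_prime) auto
  then have "p * (j * w) = j * (p choose j)" unfolding w_def by auto
  also have "\<dots> = p * (p - 1 choose (j - 1))" using j times_binomial_minus1_eq by simp
  finally have jw: "j * w = (p - 1 choose (j - 1))" using p0 by simp
  have "\<not> p dvd j" using j by (meson dvd_imp_le not_less)
  then have u: "add_pow k j \<one>\<^bsub>k\<^esub> \<in> Units k"
    using characteristic field_Units by auto
  have "add_pow k j \<one>\<^bsub>k\<^esub> \<otimes>\<^bsub>k\<^esub> add_pow k w \<one>\<^bsub>k\<^esub> = (\<ominus>\<^bsub>k\<^esub> \<one>\<^bsub>k\<^esub>) [^]\<^bsub>k\<^esub> (j - 1)"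
    using pm[of "j - 1"] j jw by (simp add: add_pow_mult_add_pow)
  moreover have "(\<ominus>\<^bsub>k\<^esub> \<one>\<^bsub>k\<^esub>) [^]\<^bsub>k\<^esub> j = (\<ominus>\<^bsub>k\<^esub> \<one>\<^bsub>k\<^esub>) [^]\<^bsub>k\<^esub> (j - 1) \<otimes>\<^bsub>k\<^esub> (\<ominus>\<^bsub>k\<^esub> \<one>\<^bsub>k\<^esub>)"
    using j by (metis nat_pow_Suc Suc_diff_1)
  ultimately have "(\<ominus>\<^bsub>k\<^esub> \<one>\<^bsub>k\<^esub>) [^]\<^bsub>k\<^esub> j = \<ominus>\<^bsub>k\<^esub> (add_pow k w \<one>\<^bsub>k\<^esub>) \<otimes>\<^bsub>k\<^esub> add_pow k j \<one>\<^bsub>k\<^esub>"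
    by (simp add: r_minus l_minus m_comm)
  then show ?thesis
    using u by (simp add: m_assoc w_def)
qed

end

lemma (in module) add_pow_smult:
  assumes "l \<in> carrier R" "x \<in> carrier M"
  shows "add_pow R (n::nat) l \<odot>\<^bsub>M\<^esub> x = add_pow M n (l \<odot>\<^bsub>M\<^esub> x)"
proof (induction n)
  case (Suc n)
  then show ?case using assms by (simp add: smult_l_distr)
qed (use assms in simp)

text \<open>Passes from coefficients in k to integer ones; laws of \<open>cross\<close> thereby
  become laws of \<open>pd_cross\<close>, up to the sign.\<close>

lemma pd_cross_eq:
  assumes "char_p_field p k" "algebra k A" "x \<in> carrier A" "y \<in> carrier A"
  shows "pd_cross p k A x y = \<ominus>\<^bsub>A\<^esub> cross A p x y"
proof -
  interpret K: char_p_field p k by fact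
  interpret B: cring A by (rule algebra.M_cring) fact
  interpret A: algebra k A by fact
  have "\<ominus>\<^bsub>A\<^esub> cross A p x y = (\<ominus>\<^bsub>A\<^esub> \<one>\<^bsub>A\<^esub>) \<otimes>\<^bsub>A\<^esub> cross A p x y"
    using assms by (simp add: B.l_minus)
  also have "\<dots> = (\<Oplus>\<^bsub>A\<^esub>j\<in>{1..p - 1}. (\<ominus>\<^bsub>A\<^esub> \<one>\<^bsub>A\<^esub>) \<otimes>\<^bsub>A\<^esub>
      add_pow A ((p choose j) div p) (x [^]\<^bsub>A\<^esub> j \<otimes>\<^bsub>A\<^esub> y [^]\<^bsub>A\<^esub> (p - j)))"
    unfolding cross_def using assms by (intro B.finsum_rdistr) auto
  also have "\<dots> = pd_cross p k A x y"
    unfolding pd_cross_def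
  proof (rule B.finsum_cong')
    fix j assume j: "j \<in> {1..p - 1}"
    show "(\<ominus>\<^bsub>A\<^esub> \<one>\<^bsub>A\<^esub>) \<otimes>\<^bsub>A\<^esub> add_pow A ((p choose j) div p) (x [^]\<^bsub>A\<^esub> j \<otimes>\<^bsub>A\<^esub> y [^]\<^bsub>A\<^esub> (p - j)) =
      ((\<ominus>\<^bsub>k\<^esub> \<one>\<^bsub>k\<^esub>) [^]\<^bsub>k\<^esub> j \<otimes>\<^bsub>k\<^esub> inv\<^bsub>k\<^esub> (add_pow k j \<one>\<^bsub>k\<^esub>)) \<odot>\<^bsub>A\<^esub> (x [^]\<^bsub>A\<^esub> j \<otimes>\<^bsub>A\<^esub> y [^]\<^bsub>A\<^esub> (p - j))"
      using assms unfolding K.cross_coeff[OF j]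
      by (simp add: A.smult_l_minus A.add_pow_smult B.l_minus)
  qed (use assms in \<open>auto simp: K.cross_coeff\<close>)
  finally show ?thesis by simp
qed

lemma cross_hom:
  assumes "ring_hom_cring R S h" "x \<in> carrier R" "y \<in> carrier R"
  shows "h (cross R p x y) = cross S p (h x) (h y)"
proof -
  interpret ring_hom_cring R S h by fact
  have pow: "h (z [^]\<^bsub>R\<^esub> (n::nat)) = h z [^]\<^bsub>S\<^esub> n" if "z \<in> carrier R" for z n
    using that by (induction n) auto
  have apow: "h (add_pow R (n::nat) z) = add_pow S n (h z)" if "z \<in> carrier R" for z n
    using that by (induction n) auto
  show ?thesis
    unfolding cross_def using assms by (subst hom_finsum) (auto simp: pow apow o_def)
qed

text \<open>The common setting of A and A \<otimes> A; nilpotence is therefore a hypothesis of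
  single lemmas and not of the locale.\<close>

locale char_p_algebra = K: char_p_field p k + A: cring A + alg: algebra k A
  for p :: nat and k :: "('k, 'c) ring_scheme" and A :: "('k, 'a, 'd) module_scheme" (structure)
begin

lemma pc_eq: "x \<in> carrier A \<Longrightarrow> y \<in> carrier A \<Longrightarrow> pd_cross p k A x y = \<ominus> cross A p x y"
  by (rule pd_cross_eq) unfold_locales

lemma pc_closed [simp]: "x \<in> carrier A \<Longrightarrow> y \<in> carrier A \<Longrightarrow> pd_cross p k A x y \<in> carrier A"
  by (simp add: pc_eq)

lemma pc_comm: "x \<in> carrier A \<Longrightarrow> y \<in> carrier A \<Longrightarrow> pd_cross p k A x y = pd_cross p k A y x"
  by (simp add: pc_eq A.cross_comm[of x y])

lemma pc_cocycle:
  assumes "x \<in> carrier A" "y \<in> carrier A" "z \<in> carrier A"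
  shows "pd_cross p k A x y \<oplus> pd_cross p k A (x \<oplus> y) z =
    pd_cross p k A y z \<oplus> pd_cross p k A x (y \<oplus> z)"
  using A.cross_cocycle[OF K.prime_p assms] assms
  by (simp add: pc_eq A.minus_add[symmetric])

lemma pc_ideal:
  assumes "ideal J A" "x \<in> J" "y \<in> carrier A"
  shows "pd_cross p k A x y \<in> J"
  using A.cross_ideal[OF assms, of p] assms ideal.Icarr[OF assms(1)]
  by (simp add: pc_eq additive_subgroup.a_inv_closed ideal.axioms(1))

lemma smult_one_mult:
  assumes "l \<in> carrier k" "x \<in> carrier A"
  shows "(l \<odot> \<one>) \<otimes> x = l \<odot> x"
  using assms by (simp add: alg.smult_assoc2)

lemma smult_one_pow:
  "l \<in> carrier k \<Longrightarrow> (l \<odot> \<one>) [^] (n::nat) = (l [^]\<^bsub>k\<^esub> n) \<odot> \<one>"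
proof (induction n)
  case (Suc n)
  then have "(l \<odot> \<one>) [^] Suc n = (l [^]\<^bsub>k\<^esub> n) \<odot> (l \<odot> \<one>)"
    by (simp add: smult_one_mult)
  also have "\<dots> = (l [^]\<^bsub>k\<^esub> n \<otimes>\<^bsub>k\<^esub> l) \<odot> \<one>"
    using Suc.prems by (intro alg.smult_assoc1[symmetric]) auto
  finally show ?case by simp
qed simp

lemma pc_smult:
  assumes "l \<in> carrier k" "x \<in> carrier A" "y \<in> carrier A"
  shows "pd_cross p k A (l \<odot> x) (l \<odot> y) = (l [^]\<^bsub>k\<^esub> p) \<odot> pd_cross p k A x y"
  using A.cross_scale[of "l \<odot> \<one>" x y p] assms
  by (simp add: smult_one_mult smult_one_pow pc_eq alg.smult_r_minus)

lemma pc_nil: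
  assumes "a \<in> carrier A" "b \<in> carrier A" "x \<in> carrier A" "x [^] p = \<zero>"
  shows "pd_cross p k A (a \<otimes> x) (b \<otimes> x) = \<zero>"
  using assms A.cross_nil[OF assms] by (simp add: pc_eq)

lemma pc_smult_nil:
  assumes "l \<in> carrier k" "m \<in> carrier k" "x \<in> carrier A" "x [^] p = \<zero>"
  shows "pd_cross p k A (l \<odot> x) (m \<odot> x) = \<zero>"
  using pc_nil[of "l \<odot> \<one>" "m \<odot> \<one>" x] assms by (simp add: smult_one_mult)

text \<open>The cross term lies in every ideal containing its first argument, here the zero
  ideal.\<close>

lemma pc_zero: "x \<in> carrier A \<Longrightarrow> pd_cross p k A \<zero> x = \<zero>" "x \<in> carrier A \<Longrightarrow> pd_cross p k A x \<zero> = \<zero>"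
  using pc_ideal[OF A.zeroideal, of "\<zero>" x] pc_comm[of x "\<zero>"] by auto

text \<open>The sign of \<open>pd_cross\<close> turns the surviving term x^(p-1) y into its
  negative: the origin of the minus sign in the axiom for Beck derivations.\<close>

lemma pc_mod_square:
  assumes J: "ideal J A" and x: "x \<in> carrier A" and y: "y \<in> carrier A" and "y \<otimes> y \<in> J"
  shows "pd_cross p k A x y \<oplus> x [^] (p - 1) \<otimes> y \<in> J"
proof -
  have "p \<ge> 2" using K.prime_p prime_ge_2_nat by blast
  then have "\<ominus> (cross A p x y \<ominus> x [^] (p - 1) \<otimes> y) \<in> J"
    using A.cross_mod_square[OF _ J x y assms(4)] ideal.axioms(1)[OF J]
    by (intro additive_subgroup.a_inv_closed)
  then show ?thesis using x y by (simp add: pc_eq a_minus_def A.minus_add)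
qed

lemma frobenius:
  assumes "x \<in> carrier A" "y \<in> carrier A"
  shows "(x \<oplus> y) [^] p = x [^] p \<oplus> y [^] p"
proof (rule A.frobenius_add[OF K.prime_p _ assms])
  show "add_pow A p \<one> = \<zero>"
    using alg.add_pow_smult[of "\<one>\<^bsub>k\<^esub>" "\<one>" p] K.char_p by simp
qed

end

text \<open>A \<open>p\<close>-map on a nil ideal \<open>J\<close> is the second component of a linear section of the first
  projection of the following extension of \<open>J\<close> by its Frobenius twist.\<close>

definition twisted_module ::
  "nat \<Rightarrow> ('k, 'c) ring_scheme \<Rightarrow> ('k, 'a, 'd) module_scheme \<Rightarrow> 'a set \<Rightarrow> ('k, 'a \<times> 'a) module"
  where "twisted_module p k A J = \<lparr>
    carrier = J \<times> J, monoid.mult = undefined, one = undefined,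
    ring.zero = (\<zero>\<^bsub>A\<^esub>, \<zero>\<^bsub>A\<^esub>),
    ring.add = (\<lambda>v w. (fst v \<oplus>\<^bsub>A\<^esub> fst w, snd v \<oplus>\<^bsub>A\<^esub> snd w \<oplus>\<^bsub>A\<^esub> pd_cross p k A (fst v) (fst w))),
    smult = (\<lambda>l v. (l \<odot>\<^bsub>A\<^esub> fst v, (l [^]\<^bsub>k\<^esub> p) \<odot>\<^bsub>A\<^esub> snd v))\<rparr>"

lemma twisted_module_simps [simp]:
  "carrier (twisted_module p k A J) = J \<times> J"
  "\<zero>\<^bsub>twisted_module p k A J\<^esub> = (\<zero>\<^bsub>A\<^esub>, \<zero>\<^bsub>A\<^esub>)"
  "v \<oplus>\<^bsub>twisted_module p k A J\<^esub> w =
    (fst v \<oplus>\<^bsub>A\<^esub> fst w, snd v \<oplus>\<^bsub>A\<^esub> snd w \<oplus>\<^bsub>A\<^esub> pd_cross p k A (fst v) (fst w))"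
  "l \<odot>\<^bsub>twisted_module p k A J\<^esub> v = (l \<odot>\<^bsub>A\<^esub> fst v, (l [^]\<^bsub>k\<^esub> p) \<odot>\<^bsub>A\<^esub> snd v)"
  by (simp_all add: twisted_module_def)

text \<open>Associativity of the addition is the cocycle identity, and commutativity is the symmetry
  of the cross terms. For scalars, l^p on the second coordinate matches the degree p of the cross
  terms, and (l + m)^p = l^p + m^p in k.\<close>

lemma (in char_p_algebra) twisted_module_left_module:
  assumes J: "ideal J A" and nil: "\<And>x. x \<in> J \<Longrightarrow> x [^] p = \<zero>"
  shows "left_module k (twisted_module p k A J)"
proof -
  interpret J: ideal J A by fact
  have JA: "x \<in> J \<Longrightarrow> x \<in> carrier A" for x by (rule J.Icarr)
  have smult_J: "l \<odot> x \<in> J" if "l \<in> carrier k" "x \<in> J" for l x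
    using that J.I_l_closed[of x "l \<odot> \<one>"] by (simp add: smult_one_mult JA)
  have pc_J: "pd_cross p k A x y \<in> J" if "x \<in> J" "y \<in> J" for x y
    using that by (intro pc_ideal[OF J]) (auto simp: JA)
  let ?E = "twisted_module p k A J"
  have grp: "abelian_group ?E"
  proof (rule abelian_groupI)
    fix u v w assume *: "u \<in> carrier ?E" "v \<in> carrier ?E" "w \<in> carrier ?E"
    then have c: "fst u \<in> carrier A" "snd u \<in> carrier A" "fst v \<in> carrier A" "snd v \<in> carrier A"
      "fst w \<in> carrier A" "snd w \<in> carrier A" by (auto simp: JA)
    have "snd u \<oplus> snd v \<oplus> pd_cross p k A (fst u) (fst v) \<oplus> snd w \<oplus>
        pd_cross p k A (fst u \<oplus> fst v) (fst w) =
      (snd u \<oplus> snd v \<oplus> snd w) \<oplus>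
        (pd_cross p k A (fst u) (fst v) \<oplus> pd_cross p k A (fst u \<oplus> fst v) (fst w))"
      using c by (simp add: A.a_ac)
    also have "\<dots> = snd u \<oplus> (snd v \<oplus> snd w \<oplus> pd_cross p k A (fst v) (fst w)) \<oplus>
        pd_cross p k A (fst u) (fst v \<oplus> fst w)"
      using c by (subst pc_cocycle) (simp_all add: A.a_ac)
    finally show "u \<oplus>\<^bsub>?E\<^esub> v \<oplus>\<^bsub>?E\<^esub> w = u \<oplus>\<^bsub>?E\<^esub> (v \<oplus>\<^bsub>?E\<^esub> w)"
      using c by (simp add: A.a_assoc)
    show "u \<oplus>\<^bsub>?E\<^esub> v = v \<oplus>\<^bsub>?E\<^esub> u"
      using c by (simp add: A.a_comm pc_comm[of "fst u" "fst v"])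
    show "u \<oplus>\<^bsub>?E\<^esub> v \<in> carrier ?E"
      using * by (auto intro!: J.a_closed pc_J)
    show "\<zero>\<^bsub>?E\<^esub> \<oplus>\<^bsub>?E\<^esub> u = u"
      using c by (simp add: pc_zero)
    \<comment> \<open>Both arguments are scalar multiples of one x with x^p = 0, so negatives may be
      taken coordinatewise.\<close>
    have "pd_cross p k A (\<ominus> fst u) (fst u) = \<zero>"
      using pc_smult_nil[of "\<ominus>\<^bsub>k\<^esub> \<one>\<^bsub>k\<^esub>" "\<one>\<^bsub>k\<^esub>" "fst u"] c nil[of "fst u"] *(1)
      by (auto simp: alg.smult_l_minus)
    then have "(\<ominus> fst u, \<ominus> snd u) \<oplus>\<^bsub>?E\<^esub> u = \<zero>\<^bsub>?E\<^esub>"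
      using c by (simp add: A.l_neg)
    moreover have "(\<ominus> fst u, \<ominus> snd u) \<in> carrier ?E" using * by auto
    ultimately show "\<exists>v\<in>carrier ?E. v \<oplus>\<^bsub>?E\<^esub> u = \<zero>\<^bsub>?E\<^esub>" by blast
  qed simp
  show ?thesis
  proof (rule left_moduleI[OF K.ring_axioms grp])
    fix l m v assume l: "l \<in> carrier k" and m: "m \<in> carrier k" and v: "v \<in> carrier ?E"
    have c: "fst v \<in> carrier A" "snd v \<in> carrier A" using v by (auto simp: JA)
    have "(l \<oplus>\<^bsub>k\<^esub> m) [^]\<^bsub>k\<^esub> p = l [^]\<^bsub>k\<^esub> p \<oplus>\<^bsub>k\<^esub> m [^]\<^bsub>k\<^esub> p"
      by (rule K.frobenius_add[OF K.prime_p K.char_p l m])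
    \<comment> \<open>The twisted sum of lv and mv carries this cross term; it vanishes because the
      first coordinate of v has p-th power zero.\<close>
    moreover have "pd_cross p k A (l \<odot> fst v) (m \<odot> fst v) = \<zero>"
      using v l m c by (intro pc_smult_nil nil) auto
    ultimately show "(l \<oplus>\<^bsub>k\<^esub> m) \<odot>\<^bsub>?E\<^esub> v = (l \<odot>\<^bsub>?E\<^esub> v) \<oplus>\<^bsub>?E\<^esub> (m \<odot>\<^bsub>?E\<^esub> v)"
      using l m c by (simp add: alg.smult_l_distr)
    show "(l \<otimes>\<^bsub>k\<^esub> m) \<odot>\<^bsub>?E\<^esub> v = l \<odot>\<^bsub>?E\<^esub> (m \<odot>\<^bsub>?E\<^esub> v)"
      using l m c by (simp add: alg.smult_assoc1 K.nat_pow_distrib)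
  next
    fix l v assume l: "l \<in> carrier k" and v: "v \<in> carrier ?E"
    show "l \<odot>\<^bsub>?E\<^esub> v \<in> carrier ?E" using l v smult_J by auto
    fix w assume w: "w \<in> carrier ?E"
    have c: "fst v \<in> carrier A" "snd v \<in> carrier A" "fst w \<in> carrier A" "snd w \<in> carrier A"
      using v w by (auto simp: JA)
    show "l \<odot>\<^bsub>?E\<^esub> (v \<oplus>\<^bsub>?E\<^esub> w) = (l \<odot>\<^bsub>?E\<^esub> v) \<oplus>\<^bsub>?E\<^esub> (l \<odot>\<^bsub>?E\<^esub> w)"
      using l c by (simp add: alg.smult_r_distr pc_smult)
  next
    fix v assume "v \<in> carrier ?E"
    then show "\<one>\<^bsub>k\<^esub> \<odot>\<^bsub>?E\<^esub> v = v" by (auto simp: JA)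
  qed
qed

section \<open>The divided powers algebra \<open>A \<otimes> A\<close>\<close>

lemma linear_map_add_maps:
  assumes "left_module R N" "linear_map R M N f" "linear_map R M N g"
  shows "linear_map R M N (\<lambda>x. f x \<oplus>\<^bsub>N\<^esub> g x)"
proof -
  interpret N: left_module R N by fact
  show ?thesis
    using assms(2,3)
    by (intro linear_mapI)
       (auto simp: linear_map_closed linear_map_add linear_map_smult N.smult_r_distr N.M.a_ac)
qed

text \<open>Multiplication by c is itself linear because the scalars commute.\<close>

lemma linear_map_smult_map:
  assumes "module R N" "c \<in> carrier R" "linear_map R M N f"
  shows "linear_map R M N (\<lambda>x. c \<odot>\<^bsub>N\<^esub> f x)"
proof -
  interpret N: module R N by fact
  have "c \<odot>\<^bsub>N\<^esub> (r \<odot>\<^bsub>N\<^esub> x) = r \<odot>\<^bsub>N\<^esub> (c \<odot>\<^bsub>N\<^esub> x)" if "r \<in> carrier R" "x \<in> carrier N" for r x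
    using that assms(2) N.smult_assoc1[of c r x] N.smult_assoc1[of r c x] by (simp add: N.R.m_comm)
  then show ?thesis
    using assms(2,3)
    by (intro linear_mapI)
       (auto simp: linear_map_closed linear_map_add linear_map_smult N.smult_r_distr)
qed

lemma linear_map_smult_const:
  assumes "module R N" "v \<in> carrier N"
    and "\<And>x. x \<in> carrier M \<Longrightarrow> h x \<in> carrier R"
    and "\<And>x y. x \<in> carrier M \<Longrightarrow> y \<in> carrier M \<Longrightarrow> h (x \<oplus>\<^bsub>M\<^esub> y) = h x \<oplus>\<^bsub>R\<^esub> h y"
    and "\<And>r x. r \<in> carrier R \<Longrightarrow> x \<in> carrier M \<Longrightarrow> h (r \<odot>\<^bsub>M\<^esub> x) = r \<otimes>\<^bsub>R\<^esub> h x"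
  shows "linear_map R M N (\<lambda>x. h x \<odot>\<^bsub>N\<^esub> v)"
proof -
  interpret N: module R N by fact
  show ?thesis
    using assms(2-)
    by (intro linear_mapI) (auto simp: N.smult_l_distr N.smult_assoc1)
qed

locale pd_square = K: char_p_field p k + A: cring A + pd: pd_algebra p k A eps \<pi>
  for p :: nat and k :: "('k, 'c) ring_scheme" and A :: "('k, 'a, 'd) module_scheme" (structure)
    and eps :: "'a \<Rightarrow> 'k" and \<pi> :: "'a \<Rightarrow> 'a"
begin

abbreviation "T \<equiv> tensor_square k A"
abbreviation "tn \<equiv> tens k A"
abbreviation "\<mu> \<equiv> mult_map k A"
abbreviation "teps \<equiv> tensor_eps k A eps"
abbreviation "Aplus \<equiv> aug_ideal k A eps"
abbreviation "Tplus \<equiv> aug_ideal k T teps"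

lemma k_A_algebra: "algebra k A" ..

lemma algebra_square: "algebra_square k A"
  by (simp add: algebra_square_def k_A_algebra)

sublocale T: cring T
  by (rule algebra_square.T_cring[OF algebra_square])

sublocale Ap: char_p_algebra p k A ..

sublocale Tp: char_p_algebra p k T
proof -
  interpret a: algebra_square k A by (rule algebra_square)
  show "char_p_algebra p k T" ..
qed

sublocale sq: algebra_square k A
  by (rule algebra_square)

section \<open>Splitting off the constants in A and in the tensor square\<close>

lemma Aplus_iff: "a \<in> Aplus \<longleftrightarrow> a \<in> carrier A \<and> eps a = \<zero>\<^bsub>k\<^esub>"
  by (auto simp: a_kernel_def')

lemma Tplus_iff: "x \<in> Tplus \<longleftrightarrow> x \<in> carrier T \<and> teps x = \<zero>\<^bsub>k\<^esub>"
  by (auto simp: a_kernel_def')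

lemma eps_closed [simp]: "a \<in> carrier A \<Longrightarrow> eps a \<in> carrier k"
  by (rule ring_hom_closed[OF pd.eps_hom])

lemma eps_add: "a \<in> carrier A \<Longrightarrow> b \<in> carrier A \<Longrightarrow> eps (a \<oplus> b) = eps a \<oplus>\<^bsub>k\<^esub> eps b"
  by (rule ring_hom_add[OF pd.eps_hom])

lemma eps_mult: "a \<in> carrier A \<Longrightarrow> b \<in> carrier A \<Longrightarrow> eps (a \<otimes> b) = eps a \<otimes>\<^bsub>k\<^esub> eps b"
  by (rule ring_hom_mult[OF pd.eps_hom])

lemma eps_one: "eps \<one> = \<one>\<^bsub>k\<^esub>"
  by (rule ring_hom_one[OF pd.eps_hom])

text \<open>The projection of A = k + A_+ onto A_+ along the constants. \<pi> is meaningful on A_+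
  only, whereas a bilinear map needs values at all of A; composing with \<open>pr\<close> bridges
  this.\<close>

definition pr :: "'a \<Rightarrow> 'a" where "pr a = a \<oplus> (\<ominus>\<^bsub>k\<^esub> eps a) \<odot> \<one>"

lemma pr_linear_map: "linear_map k A A pr"
  by (rule linear_mapI)
     (auto simp: pr_def eps_add pd.eps_smult K.minus_add pd.smult_l_distr pd.smult_r_distr
       A.a_ac K.r_minus[symmetric] pd.smult_assoc1)

lemma pr_closed [simp]: "a \<in> carrier A \<Longrightarrow> pr a \<in> carrier A"
  by (simp add: pr_def)

lemma pr_Aplus: "a \<in> carrier A \<Longrightarrow> pr a \<in> Aplus"
  by (simp add: Aplus_iff pr_def eps_add pd.eps_smult eps_one K.r_neg)

lemma pr_eq: "a \<in> Aplus \<Longrightarrow> pr a = a"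
  by (simp add: Aplus_iff pr_def)

lemma pr_one: "pr \<one> = \<zero>"
  by (simp add: pr_def eps_one pd.smult_l_minus A.r_neg)

lemma pr_decomp: "a \<in> carrier A \<Longrightarrow> a = pr a \<oplus> eps a \<odot> \<one>"
  by (simp add: pr_def A.a_assoc pd.smult_l_minus A.l_neg)

lemma teps_tens: "a \<in> carrier A \<Longrightarrow> b \<in> carrier A \<Longrightarrow> teps (tn a b) = eps a \<otimes>\<^bsub>k\<^esub> eps b"
  by (simp add: tensor_eps_def sq.mult_map_tens eps_mult)

lemma mu_closed [simp]: "x \<in> carrier T \<Longrightarrow> \<mu> x \<in> carrier A"
  by (rule linear_map_closed[OF sq.mult_map_linear_map])

lemma mu_add: "x \<in> carrier T \<Longrightarrow> y \<in> carrier T \<Longrightarrow> \<mu> (x \<oplus>\<^bsub>T\<^esub> y) = \<mu> x \<oplus> \<mu> y"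
  by (rule ring_hom_add[OF sq.mult_map_ring_hom])

lemma mu_smult: "l \<in> carrier k \<Longrightarrow> x \<in> carrier T \<Longrightarrow> \<mu> (l \<odot>\<^bsub>T\<^esub> x) = l \<odot> \<mu> x"
  by (rule linear_map_smult[OF sq.mult_map_linear_map])

lemma teps_ring_hom: "teps \<in> ring_hom T k"
  using ring_hom_trans[OF sq.mult_map_ring_hom pd.eps_hom]
  by (simp add: tensor_eps_def[abs_def] o_def)

lemma teps_closed [simp]: "x \<in> carrier T \<Longrightarrow> teps x \<in> carrier k"
  by (rule ring_hom_closed[OF teps_ring_hom])

lemma teps_add: "x \<in> carrier T \<Longrightarrow> y \<in> carrier T \<Longrightarrow> teps (x \<oplus>\<^bsub>T\<^esub> y) = teps x \<oplus>\<^bsub>k\<^esub> teps y"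
  by (rule ring_hom_add[OF teps_ring_hom])

lemma teps_smult: "l \<in> carrier k \<Longrightarrow> x \<in> carrier T \<Longrightarrow> teps (l \<odot>\<^bsub>T\<^esub> x) = l \<otimes>\<^bsub>k\<^esub> teps x"
  by (simp add: tensor_eps_def mu_smult pd.eps_smult)

lemma teps_one: "teps \<one>\<^bsub>T\<^esub> = \<one>\<^bsub>k\<^esub>"
  by (rule ring_hom_one[OF teps_ring_hom])

lemma Tplus_ideal: "ideal Tplus T"
proof -
  interpret ring_hom_ring T k teps
    by (rule ring_hom_ringI2[OF T.ring_axioms K.ring_axioms teps_ring_hom])
  show ?thesis by (rule kernel_is_ideal)
qed

sublocale Tplus: ideal Tplus T by (rule Tplus_ideal)

declare Tplus.a_Hcarr [simp del]

lemma Aplus_ideal: "ideal Aplus A"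
proof -
  interpret ring_hom_ring A k eps
    by (rule ring_hom_ringI2[OF A.ring_axioms K.ring_axioms pd.eps_hom])
  show ?thesis by (rule kernel_is_ideal)
qed

sublocale Aplus: ideal Aplus A by (rule Aplus_ideal)

declare Aplus.a_Hcarr [simp del]

lemma Aplus_smult: "l \<in> carrier k \<Longrightarrow> a \<in> Aplus \<Longrightarrow> l \<odot> a \<in> Aplus"
  by (simp add: Aplus_iff pd.eps_smult)

lemma Tplus_smult: "l \<in> carrier k \<Longrightarrow> x \<in> Tplus \<Longrightarrow> l \<odot>\<^bsub>T\<^esub> x \<in> Tplus"
  by (simp add: Tplus_iff teps_smult)

lemma tens_Tplus:
  "a \<in> Aplus \<Longrightarrow> b \<in> carrier A \<Longrightarrow> tn a b \<in> Tplus"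
  "a \<in> carrier A \<Longrightarrow> b \<in> Aplus \<Longrightarrow> tn a b \<in> Tplus"
  by (simp_all add: Tplus_iff Aplus_iff teps_tens)

lemma tens_zero: "b \<in> carrier A \<Longrightarrow> tn \<zero> b = \<zero>\<^bsub>T\<^esub>" "a \<in> carrier A \<Longrightarrow> tn a \<zero> = \<zero>\<^bsub>T\<^esub>"
  using sq.tens_smult_left[of "\<zero>\<^bsub>k\<^esub>" "\<zero>" b] sq.tens_smult_right[of "\<zero>\<^bsub>k\<^esub>" a "\<zero>"] by auto

text \<open>Expands (pr a + \<epsilon>(a)) \<otimes> (pr b + \<epsilon>(b)): the first three
  summands lie in the three pieces of T_+, and the last one is the constant part.\<close>

lemma tens_decomp:
  assumes a: "a \<in> carrier A" and b: "b \<in> carrier A"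
  shows "tn a b = (eps b \<odot>\<^bsub>T\<^esub> tn (pr a) \<one> \<oplus>\<^bsub>T\<^esub> eps a \<odot>\<^bsub>T\<^esub> tn \<one> (pr b) \<oplus>\<^bsub>T\<^esub> tn (pr a) (pr b))
    \<oplus>\<^bsub>T\<^esub> teps (tn a b) \<odot>\<^bsub>T\<^esub> \<one>\<^bsub>T\<^esub>"
proof -
  have "tn a b = tn (pr a \<oplus> eps a \<odot> \<one>) (pr b \<oplus> eps b \<odot> \<one>)"
    using pr_decomp a b by simp
  also have "\<dots> = tn (pr a) (pr b) \<oplus>\<^bsub>T\<^esub> eps b \<odot>\<^bsub>T\<^esub> tn (pr a) \<one> \<oplus>\<^bsub>T\<^esub>
    (eps a \<odot>\<^bsub>T\<^esub> tn \<one> (pr b) \<oplus>\<^bsub>T\<^esub> eps a \<odot>\<^bsub>T\<^esub> (eps b \<odot>\<^bsub>T\<^esub> tn \<one> \<one>))"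
    using a b
    by (simp add: sq.tens_add_left sq.tens_add_right sq.tens_smult_left sq.tens_smult_right
        Tp.alg.smult_r_distr Tp.alg.smult_assoc1[symmetric] K.m_comm T.a_ac)
  also have "eps a \<odot>\<^bsub>T\<^esub> (eps b \<odot>\<^bsub>T\<^esub> tn \<one> \<one>) = teps (tn a b) \<odot>\<^bsub>T\<^esub> \<one>\<^bsub>T\<^esub>"
    using a b by (simp add: teps_tens sq.tens_one Tp.alg.smult_assoc1)
  finally show ?thesis using a b by (simp add: T.a_ac)
qed

definition prT :: "('a \<times> 'a \<Rightarrow> 'k) set \<Rightarrow> ('a \<times> 'a \<Rightarrow> 'k) set"
  where "prT x = x \<oplus>\<^bsub>T\<^esub> (\<ominus>\<^bsub>k\<^esub> teps x) \<odot>\<^bsub>T\<^esub> \<one>\<^bsub>T\<^esub>"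

lemma prT_closed [simp]: "x \<in> carrier T \<Longrightarrow> prT x \<in> carrier T"
  by (simp add: prT_def)

lemma prT_add: "x \<in> carrier T \<Longrightarrow> y \<in> carrier T \<Longrightarrow> prT (x \<oplus>\<^bsub>T\<^esub> y) = prT x \<oplus>\<^bsub>T\<^esub> prT y"
  by (simp add: prT_def teps_add K.minus_add Tp.alg.smult_l_distr T.a_ac)

lemma prT_Tplus: "x \<in> carrier T \<Longrightarrow> prT x \<in> Tplus"
  by (simp add: Tplus_iff prT_def teps_add teps_smult teps_one K.r_neg)

lemma prT_eq: "x \<in> Tplus \<Longrightarrow> prT x = x"
  by (simp add: Tplus_iff prT_def)

lemma prT_decomp: "x \<in> carrier T \<Longrightarrow> x = prT x \<oplus>\<^bsub>T\<^esub> teps x \<odot>\<^bsub>T\<^esub> \<one>\<^bsub>T\<^esub>"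
  by (simp add: prT_def T.a_assoc Tp.alg.smult_l_minus T.l_neg)

lemma prT_tens:
  assumes a: "a \<in> carrier A" and b: "b \<in> carrier A"
  shows "prT (tn a b) =
    eps b \<odot>\<^bsub>T\<^esub> tn (pr a) \<one> \<oplus>\<^bsub>T\<^esub> eps a \<odot>\<^bsub>T\<^esub> tn \<one> (pr b) \<oplus>\<^bsub>T\<^esub> tn (pr a) (pr b)"
proof -
  define u where "u = eps b \<odot>\<^bsub>T\<^esub> tn (pr a) \<one> \<oplus>\<^bsub>T\<^esub> eps a \<odot>\<^bsub>T\<^esub> tn \<one> (pr b) \<oplus>\<^bsub>T\<^esub> tn (pr a) (pr b)"
  have u: "u \<in> carrier T" using a b by (simp add: u_def)
  have e: "teps (tn a b) \<in> carrier k" using a b by simp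
  have "tn a b = u \<oplus>\<^bsub>T\<^esub> teps (tn a b) \<odot>\<^bsub>T\<^esub> \<one>\<^bsub>T\<^esub>"
    using tens_decomp[OF a b] unfolding u_def .
  then have "prT (tn a b) = (u \<oplus>\<^bsub>T\<^esub> teps (tn a b) \<odot>\<^bsub>T\<^esub> \<one>\<^bsub>T\<^esub>) \<oplus>\<^bsub>T\<^esub> (\<ominus>\<^bsub>k\<^esub> teps (tn a b)) \<odot>\<^bsub>T\<^esub> \<one>\<^bsub>T\<^esub>"
    unfolding prT_def by simp
  also have "\<dots> = u"
    using u e by (simp add: T.a_assoc Tp.alg.smult_l_minus T.r_neg)
  finally show ?thesis unfolding u_def .
qed

text \<open>\<open>prT\<close> is additive and the identity on T_+, so induction over pure tensors
  can be applied to \<open>prT t\<close>, whose value at a pure tensor splits into the three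
  kinds.\<close>

lemma Tplus_induct [consumes 1, case_names left right both add]:
  assumes x: "x \<in> Tplus"
    and left: "\<And>a. a \<in> Aplus \<Longrightarrow> Q (tn a \<one>)"
    and right: "\<And>b. b \<in> Aplus \<Longrightarrow> Q (tn \<one> b)"
    and both: "\<And>a b. a \<in> Aplus \<Longrightarrow> b \<in> Aplus \<Longrightarrow> Q (tn a b)"
    and add: "\<And>x y. x \<in> Tplus \<Longrightarrow> y \<in> Tplus \<Longrightarrow> Q x \<Longrightarrow> Q y \<Longrightarrow> Q (x \<oplus>\<^bsub>T\<^esub> y)"
  shows "Q x"
proof -
  have "Q (prT t)" if "t \<in> carrier T" for t
    using that
  proof (induction t rule: sq.T_induct)
    case (tens a b)
    have "prT (tn a b) =
      tn (eps b \<odot> pr a) \<one> \<oplus>\<^bsub>T\<^esub> tn \<one> (eps a \<odot> pr b) \<oplus>\<^bsub>T\<^esub> tn (pr a) (pr b)"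
      using tens by (simp add: prT_tens sq.tens_smult_left sq.tens_smult_right)
    moreover have "Q (tn (eps b \<odot> pr a) \<one> \<oplus>\<^bsub>T\<^esub> tn \<one> (eps a \<odot> pr b) \<oplus>\<^bsub>T\<^esub> tn (pr a) (pr b))"
      using tens
      by (intro add left right both Tplus.a_closed Aplus_smult pr_Aplus eps_closed
          tens_Tplus(1)[of _ "\<one>"] tens_Tplus(2)[of "\<one>"] tens_Tplus(1)[of "pr a" "pr b"]) auto
    ultimately show ?case by simp
  next
    case (add x y)
    then show ?case using assms(5)[of "prT x" "prT y"] by (simp add: prT_add prT_Tplus)
  qed
  from this[of x] show ?thesis using x by (simp add: prT_eq Tplus.Icarr)
qed

lemma A_pow_p:
  assumes "a \<in> carrier A"
  shows "a [^] p = (eps a [^]\<^bsub>k\<^esub> p) \<odot> \<one>"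
proof -
  have "a [^] p = (pr a \<oplus> eps a \<odot> \<one>) [^] p"
    using pr_decomp assms by simp
  also have "\<dots> = pr a [^] p \<oplus> (eps a \<odot> \<one>) [^] p"
    using assms by (intro Ap.frobenius) auto
  finally show ?thesis
    using assms pd.pow_p[OF pr_Aplus] by (simp add: Ap.smult_one_pow)
qed

lemma tens_pow:
  "a \<in> carrier A \<Longrightarrow> b \<in> carrier A \<Longrightarrow> tn a b [^]\<^bsub>T\<^esub> (n::nat) = tn (a [^] n) (b [^] n)"
  by (induction n) (simp_all add: sq.tens_one sq.tens_mult)

text \<open>Frobenius is additive, so pure tensors decide; there the value a^p \<otimes> b^p depends
  on the augmentations alone. On T_+ this gives x^p = 0.\<close>

lemma T_pow_p:
  assumes "x \<in> carrier T"
  shows "x [^]\<^bsub>T\<^esub> p = (teps x [^]\<^bsub>k\<^esub> p) \<odot>\<^bsub>T\<^esub> \<one>\<^bsub>T\<^esub>"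
  using assms
proof (induction x rule: sq.T_induct)
  case (tens a b)
  then show ?case
    by (simp add: tens_pow A_pow_p sq.tens_smult_left sq.tens_smult_right teps_tens sq.tens_one
        Tp.alg.smult_assoc1[symmetric] K.nat_pow_distrib K.m_comm)
next
  case (add x y)
  then show ?case
    using K.frobenius_add[OF K.prime_p K.char_p, of "teps x" "teps y"]
    by (simp add: Tp.frobenius teps_add Tp.alg.smult_l_distr)
qed

lemma Tplus_pow_p: "x \<in> Tplus \<Longrightarrow> x [^]\<^bsub>T\<^esub> p = \<zero>\<^bsub>T\<^esub>"
  using T_pow_p[of x] K.prime_p prime_gt_0_nat[of p]
  by (simp add: Tplus_iff K.nat_pow_zero)

section \<open>The linear section over the tensor square\<close>

abbreviation "E \<equiv> twisted_module p k T Tplus"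

lemma E_left_module: "left_module k E"
  by (rule Tp.twisted_module_left_module[OF Tplus_ideal Tplus_pow_p])

lemma E_module: "module k E"
  by (rule left_module_imp_module[OF K.is_cring E_left_module])

text \<open>The map from a to a \<otimes> 1 is a ring homomorphism, and cross terms have integer
  coefficients, so they are carried along.\<close>

lemma tens_pd_cross_left:
  assumes "a \<in> carrier A" "b \<in> carrier A"
  shows "pd_cross p k T (tn a \<one>) (tn b \<one>) = tn (pd_cross p k A a b) \<one>"
proof -
  interpret h: ring_hom_cring A T "\<lambda>a. tn a \<one>"
    by (intro ring_hom_cringI ring_hom_ringI2 A.ring_axioms T.ring_axioms A.is_cring T.is_cring
        ring_hom_memI) (simp_all add: sq.tens_mult sq.tens_add_left sq.tens_one)
  show ?thesis
    using assms cross_hom[OF h.ring_hom_cring_axioms assms, of p]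
    by (simp add: Tp.pc_eq Ap.pc_eq)
qed

lemma tens_pd_cross_right:
  assumes "a \<in> carrier A" "b \<in> carrier A"
  shows "pd_cross p k T (tn \<one> a) (tn \<one> b) = tn \<one> (pd_cross p k A a b)"
proof -
  interpret h: ring_hom_cring A T "\<lambda>a. tn \<one> a"
    by (intro ring_hom_cringI ring_hom_ringI2 A.ring_axioms T.ring_axioms A.is_cring T.is_cring
        ring_hom_memI) (simp_all add: sq.tens_mult sq.tens_add_right sq.tens_one)
  show ?thesis
    using assms cross_hom[OF h.ring_hom_cring_axioms assms, of p]
    by (simp add: Tp.pc_eq Ap.pc_eq)
qed

lemma pi_closed: "a \<in> Aplus \<Longrightarrow> \<pi> a \<in> carrier A"
  using pd.pi_closed by (simp add: Aplus_iff)

text \<open>The prescribed pair of an element and its p-map value, for pr a \<otimes> 1 and, in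
  \<open>sec2\<close>, for 1 \<otimes> pr a. The laws of the p-map of A say that as elements of
  \<open>E\<close> these depend linearly on a.\<close>

definition "sec1 a = (tn (pr a) \<one>, tn (\<pi> (pr a)) \<one>)"
definition "sec2 a = (tn \<one> (pr a), tn \<one> (\<pi> (pr a)))"
text \<open>The three summands follow the decomposition of \<open>prT (tn a b)\<close>. The last has
  second coordinate 0, since a p-map kills the product of pr a \<otimes> 1 and 1 \<otimes> pr
  b.\<close>

definition "sec w = (eps (snd w) \<odot>\<^bsub>E\<^esub> sec1 (fst w)) \<oplus>\<^bsub>E\<^esub> (eps (fst w) \<odot>\<^bsub>E\<^esub> sec2 (snd w)) \<oplus>\<^bsub>E\<^esub>
    (tn (pr (fst w)) (pr (snd w)), \<zero>\<^bsub>T\<^esub>)"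

lemma pr_add: "a \<in> carrier A \<Longrightarrow> b \<in> carrier A \<Longrightarrow> pr (a \<oplus> b) = pr a \<oplus> pr b"
  by (rule linear_map_add[OF pr_linear_map])

lemma pr_smult: "l \<in> carrier k \<Longrightarrow> a \<in> carrier A \<Longrightarrow> pr (l \<odot> a) = l \<odot> pr a"
  by (rule linear_map_smult[OF pr_linear_map])

lemma sec1_linear_map: "linear_map k A E sec1"
proof (rule linear_mapI)
  fix a assume a: "a \<in> carrier A"
  show "sec1 a \<in> carrier E"
    using a by (simp add: sec1_def tens_Tplus pr_Aplus pd.pi_closed)
  show "sec1 (l \<odot> a) = l \<odot>\<^bsub>E\<^esub> sec1 a" if "l \<in> carrier k" for l
    using a that
    by (simp add: sec1_def pr_smult pd.pi_smult pr_Aplus sq.tens_smult_left pi_closed)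
  fix b assume b: "b \<in> carrier A"
  show "sec1 (a \<oplus> b) = sec1 a \<oplus>\<^bsub>E\<^esub> sec1 b"
    using a b
    by (simp add: sec1_def pr_add pd.pi_add pr_Aplus sq.tens_add_left pi_closed tens_pd_cross_left)
qed

lemma sec2_linear_map: "linear_map k A E sec2"
proof (rule linear_mapI)
  fix a assume a: "a \<in> carrier A"
  show "sec2 a \<in> carrier E"
    using a by (simp add: sec2_def tens_Tplus pr_Aplus pd.pi_closed)
  show "sec2 (l \<odot> a) = l \<odot>\<^bsub>E\<^esub> sec2 a" if "l \<in> carrier k" for l
    using a that
    by (simp add: sec2_def pr_smult pd.pi_smult pr_Aplus sq.tens_smult_right pi_closed)
  fix b assume b: "b \<in> carrier A"
  show "sec2 (a \<oplus> b) = sec2 a \<oplus>\<^bsub>E\<^esub> sec2 b"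
    using a b
    by (simp add: sec2_def pr_add pd.pi_add pr_Aplus sq.tens_add_right pi_closed tens_pd_cross_right)
qed

text \<open>Both tensors are multiples of 1 \<otimes> b, whose p-th power is zero. For want of a
  cross term, (pr a \<otimes> pr b, 0) is additive in a as an element of \<open>E\<close>.\<close>

lemma pc_tens_left:
  assumes "a \<in> carrier A" "a' \<in> carrier A" "b \<in> Aplus"
  shows "pd_cross p k T (tn a b) (tn a' b) = \<zero>\<^bsub>T\<^esub>"
  using Tp.pc_nil[of "tn a \<one>" "tn a' \<one>" "tn \<one> b"] assms
    Tplus_pow_p[OF tens_Tplus(2)[of "\<one>" b]]
  by (simp add: sq.tens_mult Aplus.Icarr)

lemma pc_tens_right:
  assumes "a \<in> Aplus" "b \<in> carrier A" "b' \<in> carrier A"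
  shows "pd_cross p k T (tn a b) (tn a b') = \<zero>\<^bsub>T\<^esub>"
  using Tp.pc_nil[of "tn \<one> b" "tn \<one> b'" "tn a \<one>"] assms
    Tplus_pow_p[OF tens_Tplus(1)[of a "\<one>"]]
  by (simp add: sq.tens_mult Aplus.Icarr)

text \<open>For fixed b the three summands are a linear map scaled by \<epsilon>(b), a fixed vector
  scaled by \<epsilon>(a), and a map whose additivity in \<open>E\<close> is
  \<open>pc_tens_left\<close>.\<close>

lemma sec_linear_left:
  assumes b: "b \<in> carrier A"
  shows "linear_map k A E (\<lambda>a. sec (a, b))"
proof -
  have "linear_map k A E (\<lambda>a. (tn (pr a) (pr b), \<zero>\<^bsub>T\<^esub>))"
    using b pr_Aplus[OF b]
    by (intro linear_mapI)
       (simp_all add: tens_Tplus pr_Aplus pr_add pr_smult sq.tens_add_left sq.tens_smult_left pc_tens_left)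
  moreover have "linear_map k A E (\<lambda>a. eps b \<odot>\<^bsub>E\<^esub> sec1 a)"
    using b by (intro linear_map_smult_map E_module sec1_linear_map) auto
  moreover have "linear_map k A E (\<lambda>a. eps a \<odot>\<^bsub>E\<^esub> sec2 b)"
    using b linear_map_closed[OF sec2_linear_map b]
    by (intro linear_map_smult_const E_module) (auto simp: eps_add pd.eps_smult)
  ultimately show ?thesis
    unfolding sec_def fst_conv snd_conv by (intro linear_map_add_maps E_left_module)
qed

lemma sec_linear_right:
  assumes a: "a \<in> carrier A"
  shows "linear_map k A E (\<lambda>b. sec (a, b))"
proof -
  have "linear_map k A E (\<lambda>b. (tn (pr a) (pr b), \<zero>\<^bsub>T\<^esub>))"
    using a pr_Aplus[OF a]
    by (intro linear_mapI)
       (simp_all add: tens_Tplus pr_Aplus pr_add pr_smult sq.tens_add_right sq.tens_smult_right pc_tens_right)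
  moreover have "linear_map k A E (\<lambda>b. eps a \<odot>\<^bsub>E\<^esub> sec2 b)"
    using a by (intro linear_map_smult_map E_module sec2_linear_map) auto
  moreover have "linear_map k A E (\<lambda>b. eps b \<odot>\<^bsub>E\<^esub> sec1 a)"
    using a linear_map_closed[OF sec1_linear_map a]
    by (intro linear_map_smult_const E_module) (auto simp: eps_add pd.eps_smult)
  ultimately show ?thesis
    unfolding sec_def fst_conv snd_conv by (intro linear_map_add_maps E_left_module)
qed

definition "psi = sq.tensor_lift E sec"

lemma psi_linear_map: "linear_map k T E psi"
  unfolding psi_def
  by (rule sq.tensor_lift_linear_map[OF E_left_module sec_linear_left sec_linear_right])

lemma psi_tens: "a \<in> carrier A \<Longrightarrow> b \<in> carrier A \<Longrightarrow> psi (tn a b) = sec (a, b)"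
  unfolding psi_def
  by (rule sq.tensor_lift_tens[OF E_left_module sec_linear_left sec_linear_right])

text \<open>\<open>psi\<close> lies over the projection to T_+, so on T_+ it is a section of the
  extension, and its second coordinate obeys the addition law of a p-map.\<close>

lemma fst_psi: "x \<in> carrier T \<Longrightarrow> fst (psi x) = prT x"
proof (induction x rule: sq.T_induct)
  case (tens a b)
  then show ?case by (simp add: psi_tens prT_tens sec_def sec1_def sec2_def)
next
  case (add x y)
  then show ?case by (simp add: linear_map_add[OF psi_linear_map] prT_add)
qed

lemma psi_closed: "x \<in> carrier T \<Longrightarrow> fst (psi x) \<in> Tplus \<and> snd (psi x) \<in> Tplus"
  using linear_map_closed[OF psi_linear_map, of x] by (auto simp: mem_Times_iff)

text \<open>Extensional on T_+, since \<open>tensor_pi\<close> singles out one function among the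
  extensional ones.\<close>

definition "qmap = (\<lambda>x\<in>Tplus. snd (psi x))"

lemma fst_psi_Tplus: "x \<in> Tplus \<Longrightarrow> fst (psi x) = x"
  by (simp add: fst_psi prT_eq Tplus.Icarr)

lemma qmap_closed: "x \<in> Tplus \<Longrightarrow> qmap x \<in> Tplus"
  by (simp add: qmap_def psi_closed Tplus.Icarr)

lemma qmap_add: "x \<in> Tplus \<Longrightarrow> y \<in> Tplus \<Longrightarrow>
    qmap (x \<oplus>\<^bsub>T\<^esub> y) = qmap x \<oplus>\<^bsub>T\<^esub> qmap y \<oplus>\<^bsub>T\<^esub> pd_cross p k T x y"
  using linear_map_add[OF psi_linear_map, of x y]
  by (simp add: qmap_def Tplus.Icarr fst_psi_Tplus)

lemma qmap_smult: "l \<in> carrier k \<Longrightarrow> x \<in> Tplus \<Longrightarrow> qmap (l \<odot>\<^bsub>T\<^esub> x) = (l [^]\<^bsub>k\<^esub> p) \<odot>\<^bsub>T\<^esub> qmap x"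
  using linear_map_smult[OF psi_linear_map, of x l]
  by (simp add: qmap_def Tplus.Icarr Tplus_smult)

lemma pi_zero: "\<pi> \<zero> = \<zero>"
  using pd.pi_mult[of "\<zero>" "\<zero>"] by simp

lemma eps_Aplus: "a \<in> Aplus \<Longrightarrow> eps a = \<zero>\<^bsub>k\<^esub>"
  by (simp add: Aplus_iff)

lemma p_pos: "p > 0"
  using K.prime_p prime_gt_0_nat by auto

lemma qmap_left: "a \<in> Aplus \<Longrightarrow> qmap (tn a \<one>) = tn (\<pi> a) \<one>"
  using p_pos
  by (simp add: qmap_def tens_Tplus psi_tens Aplus.Icarr sec_def sec1_def sec2_def pr_eq pr_one
      pi_zero eps_one eps_Aplus tens_zero pi_closed Tp.pc_zero K.nat_pow_zero)

lemma qmap_right: "a \<in> Aplus \<Longrightarrow> qmap (tn \<one> a) = tn \<one> (\<pi> a)"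
  using p_pos
  by (simp add: qmap_def tens_Tplus psi_tens Aplus.Icarr sec_def sec1_def sec2_def pr_eq pr_one
      pi_zero eps_one eps_Aplus tens_zero pi_closed Tp.pc_zero K.nat_pow_zero)

lemma qmap_both: "a \<in> Aplus \<Longrightarrow> b \<in> Aplus \<Longrightarrow> qmap (tn a b) = \<zero>\<^bsub>T\<^esub>"
  using p_pos
  by (simp add: qmap_def tens_Tplus psi_tens Aplus.Icarr sec_def sec1_def sec2_def pr_eq pr_one
      pi_zero eps_one eps_Aplus tens_zero pi_closed Tp.pc_zero K.nat_pow_zero)

text \<open>The cross term of xy and x'y vanishes because of the common factor y with y^p = 0. So
  only products of generators matter; they are a product taken in one copy of A, killed by \<pi>, or
  a mixed tensor, on which \<open>qmap\<close> is 0.\<close>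

lemma qmap_mult:
  assumes x: "x \<in> Tplus" and y: "y \<in> Tplus"
  shows "qmap (x \<otimes>\<^bsub>T\<^esub> y) = \<zero>\<^bsub>T\<^esub>"
proof -
  have add_left: "qmap ((x \<oplus>\<^bsub>T\<^esub> x') \<otimes>\<^bsub>T\<^esub> y) = \<zero>\<^bsub>T\<^esub>"
    if "x \<in> Tplus" "x' \<in> Tplus" "y \<in> Tplus" "qmap (x \<otimes>\<^bsub>T\<^esub> y) = \<zero>\<^bsub>T\<^esub>" "qmap (x' \<otimes>\<^bsub>T\<^esub> y) = \<zero>\<^bsub>T\<^esub>"
    for x x' y
    using that Tp.pc_nil[of x x' y]
    by (simp add: T.l_distr Tplus.Icarr qmap_add Tplus.I_l_closed Tplus_pow_p)
  \<comment> \<open>The condition on a and b covers the three kinds of generators of T_+ at once,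
    with 1 allowed in one slot.\<close>
  have gen: "qmap (tn a b \<otimes>\<^bsub>T\<^esub> y) = \<zero>\<^bsub>T\<^esub>"
    if y: "y \<in> Tplus" and ab: "(a \<in> Aplus \<and> (b \<in> Aplus \<or> b = \<one>)) \<or> (a = \<one> \<and> b \<in> Aplus)"
    for a b y
    using y
  proof (induction y rule: Tplus_induct)
    case (left a')
    with ab show ?case
      by (auto simp: sq.tens_mult Aplus.Icarr qmap_both qmap_left pd.pi_mult tens_zero Aplus.I_r_closed)
  next
    case (right b')
    with ab show ?case
      by (auto simp: sq.tens_mult Aplus.Icarr qmap_both qmap_right pd.pi_mult tens_zero Aplus.I_r_closed)
  next
    case (both a' b')
    with ab show ?case
      by (auto simp: sq.tens_mult Aplus.Icarr qmap_both Aplus.I_r_closed)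
  next
    case (add y y')
    have "tn a b \<in> Tplus" using ab by (auto simp: tens_Tplus Aplus.Icarr)
    with add show ?case
      using add_left[of y y' "tn a b"] by (simp add: T.m_comm Tplus.Icarr)
  qed
  show ?thesis
    using x
  proof (induction x rule: Tplus_induct)
    case (add x x')
    then show ?case using add_left y by blast
  qed (auto intro!: gen y)
qed

lemma augmented_T: "augmented_algebra k T teps"
  by (intro augmented_algebra.intro augmented_algebra_axioms.intro teps_ring_hom)
     (auto simp: teps_smult intro: Tp.alg.algebra_axioms)

lemma qmap_pd_algebra: "pd_algebra p k T teps qmap"
  by (intro pd_algebra.intro pd_algebra_axioms.intro augmented_T qmap_closed Tplus_pow_p qmap_add
      qmap_mult qmap_smult)

abbreviation "q \<equiv> tensor_pi p k A eps \<pi>"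

text \<open>Uniqueness: a p-map on T_+ is determined by its values on a \<otimes> 1 and 1 \<otimes>
  b, because it kills a \<otimes> b = (a \<otimes> 1)(1 \<otimes> b) and its addition law fixes the
  values on sums.\<close>

lemma tensor_pi_eq: "q = qmap"
  unfolding tensor_pi_def
proof (rule the_equality, intro conjI ballI)
  show "qmap \<in> extensional Tplus" by (simp add: qmap_def)
  fix r
  assume r: "r \<in> extensional Tplus \<and> pd_algebra p k T teps r \<and>
    (\<forall>a\<in>Aplus. r (tn a \<one>) = tn (\<pi> a) \<one> \<and> r (tn \<one> a) = tn \<one> (\<pi> a))"
  interpret r: pd_algebra p k T teps r using r by blast
  have "r x = qmap x" if "x \<in> Tplus" for x
    using that
  proof (induction x rule: Tplus_induct)
    case (both a b)
    then have "r (tn a \<one> \<otimes>\<^bsub>T\<^esub> tn \<one> b) = \<zero>\<^bsub>T\<^esub>"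
      by (intro r.pi_mult) (auto simp: tens_Tplus)
    with both show ?case by (simp add: sq.tens_mult Aplus.Icarr qmap_both)
  next
    case (add x y)
    then show ?case by (simp add: r.pi_add qmap_add)
  qed (use r in \<open>auto simp: qmap_left qmap_right\<close>)
  then show "r = qmap"
    using r by (intro extensionalityI[of r Tplus]) (auto simp: qmap_def)
qed (auto simp: qmap_pd_algebra qmap_left qmap_right)

section \<open>The p-map under multiplication and under \<mu>\<close>

lemmas q_closed = qmap_closed[folded tensor_pi_eq]
  and q_add = qmap_add[folded tensor_pi_eq]
  and q_smult = qmap_smult[folded tensor_pi_eq]
  and q_mult = qmap_mult[folded tensor_pi_eq]
  and q_left = qmap_left[folded tensor_pi_eq]
  and q_right = qmap_right[folded tensor_pi_eq]
  and q_both = qmap_both[folded tensor_pi_eq]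

text \<open>Of y = prT y + \<epsilon>(y), the first part contributes a product of two elements of
  T_+, which is killed. For y = a \<otimes> 1 this is the semilinearity required of a Beck
  module.\<close>

lemma q_mult_eps:
  assumes y: "y \<in> carrier T" and x: "x \<in> Tplus"
  shows "q (y \<otimes>\<^bsub>T\<^esub> x) = (teps y [^]\<^bsub>k\<^esub> p) \<odot>\<^bsub>T\<^esub> q x"
proof -
  have xT: "x \<in> carrier T" using x by (rule Tplus.Icarr)
  have "y \<otimes>\<^bsub>T\<^esub> x = (prT y \<oplus>\<^bsub>T\<^esub> teps y \<odot>\<^bsub>T\<^esub> \<one>\<^bsub>T\<^esub>) \<otimes>\<^bsub>T\<^esub> x"
    using prT_decomp y by simp
  also have "\<dots> = prT y \<otimes>\<^bsub>T\<^esub> x \<oplus>\<^bsub>T\<^esub> teps y \<odot>\<^bsub>T\<^esub> x"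
    using y xT by (simp add: T.l_distr Tp.smult_one_mult)
  also have "q \<dots> = q (prT y \<otimes>\<^bsub>T\<^esub> x) \<oplus>\<^bsub>T\<^esub> q (teps y \<odot>\<^bsub>T\<^esub> x) \<oplus>\<^bsub>T\<^esub>
      pd_cross p k T (prT y \<otimes>\<^bsub>T\<^esub> x) (teps y \<odot>\<^bsub>T\<^esub> x)"
    using x y by (intro q_add) (auto simp: Tplus_smult Tplus.I_l_closed)
  also have "pd_cross p k T (prT y \<otimes>\<^bsub>T\<^esub> x) (teps y \<odot>\<^bsub>T\<^esub> x) = \<zero>\<^bsub>T\<^esub>"
    using Tp.pc_nil[of "prT y" "teps y \<odot>\<^bsub>T\<^esub> \<one>\<^bsub>T\<^esub>" x] x xT y by (simp add: Tp.smult_one_mult Tplus_pow_p)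
  also have "q (prT y \<otimes>\<^bsub>T\<^esub> x) = \<zero>\<^bsub>T\<^esub>" using x y by (intro q_mult prT_Tplus)
  finally show ?thesis using x y by (simp add: q_smult q_closed Tplus.Icarr)
qed

lemma mu_Tplus: "x \<in> Tplus \<Longrightarrow> \<mu> x \<in> Aplus"
  by (simp add: Tplus_iff Aplus_iff tensor_eps_def)

text \<open>Both sides obey the same addition law, so the generators of T_+ decide. It follows that
  the p-map preserves the kernel of \<mu>.\<close>

lemma mu_q:
  assumes "x \<in> Tplus"
  shows "\<mu> (q x) = \<pi> (\<mu> x)"
  using assms
proof (induction x rule: Tplus_induct)
  case (left a)
  then show ?case by (simp add: q_left sq.mult_map_tens Aplus.Icarr pi_closed)
next
  case (right a)
  then show ?case by (simp add: q_right sq.mult_map_tens Aplus.Icarr pi_closed)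
next
  case (both a b)
  then show ?case
    using linear_map_smult[OF sq.mult_map_linear_map, of "\<zero>\<^bsub>T\<^esub>" "\<zero>\<^bsub>k\<^esub>"]
    by (simp add: q_both sq.mult_map_tens Aplus.Icarr pd.pi_mult)
next
  case (add x y)
  interpret h: ring_hom_cring T A \<mu>
    by (intro ring_hom_cringI ring_hom_ringI2 A.ring_axioms T.ring_axioms A.is_cring T.is_cring
        sq.mult_map_ring_hom)
  have c: "x \<in> carrier T" "y \<in> carrier T" "q x \<in> carrier T" "q y \<in> carrier T"
    using add by (auto simp: Tplus.Icarr q_closed)
  have "\<mu> (pd_cross p k T x y) = pd_cross p k A (\<mu> x) (\<mu> y)"
    using c cross_hom[OF h.ring_hom_cring_axioms, of x y p] by (simp add: Tp.pc_eq Ap.pc_eq)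
  then show ?case
    using add c by (simp add: q_add mu_add pd.pi_add mu_Tplus)
qed

end

section \<open>Modules over \<open>V(A)\<close>\<close>

lemma finsum_hom:
  assumes "abelian_group M" "abelian_group N" "finite B" "g \<in> B \<rightarrow> carrier M"
    and "f \<in> carrier M \<rightarrow> carrier N"
    and "\<And>x y. x \<in> carrier M \<Longrightarrow> y \<in> carrier M \<Longrightarrow> f (x \<oplus>\<^bsub>M\<^esub> y) = f x \<oplus>\<^bsub>N\<^esub> f y"
  shows "f (finsum M g B) = finsum N (\<lambda>i. f (g i)) B"
proof -
  interpret M: abelian_group M by fact
  interpret N: abelian_group N by fact
  have zero: "f \<zero>\<^bsub>M\<^esub> = \<zero>\<^bsub>N\<^esub>"
    using assms(6)[of "\<zero>\<^bsub>M\<^esub>" "\<zero>\<^bsub>M\<^esub>"] assms(5) N.add.r_cancel_one'[of "f \<zero>\<^bsub>M\<^esub>" "f \<zero>\<^bsub>M\<^esub>"]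
    by (auto simp: Pi_iff)
  show ?thesis
    using assms(3,4,5)
    by (induction B rule: finite_induct) (auto simp: zero assms(6) Pi_iff)
qed

text \<open>That V(A) is a ring is an assumption of this locale; in the theorem it is contained in
  the hypothesis on M.\<close>

locale pd_square_V = pd_square p k A eps \<pi> + V: ring "V_ring p k A eps"
  for p :: nat and k :: "('k, 'c) ring_scheme" and A :: "('k, 'a, 'd) module_scheme" (structure)
    and eps :: "'a \<Rightarrow> 'k" and \<pi> :: "'a \<Rightarrow> 'a"
begin

abbreviation "V \<equiv> V_ring p k A eps"

lemma V_carrier: "carrier V = up A"
  by (simp add: V_ring_def)

lemma V_zero: "\<zero>\<^bsub>V\<^esub> = (\<lambda>i. \<zero>)"
  by (simp add: V_ring_def UP_def)

lemma V_one: "\<one>\<^bsub>V\<^esub> = (\<lambda>i. if i = 0 then \<one> else \<zero>)"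
  by (simp add: V_ring_def UP_def)

lemma V_add: "f \<in> carrier V \<Longrightarrow> g \<in> carrier V \<Longrightarrow> f \<oplus>\<^bsub>V\<^esub> g = (\<lambda>i. f i \<oplus> g i)"
  by (simp add: V_ring_def UP_def)

lemma V_mult: "(f \<otimes>\<^bsub>V\<^esub> g) n = (\<Oplus>i\<in>{..n}. f i \<otimes> V_twist p k A eps i (g (n - i)))"
  by (simp add: V_ring_def)

lemma V_of_eq: "a \<in> carrier A \<Longrightarrow> V_of A a = (\<lambda>i. if i = 0 then a else \<zero>)"
  by (simp add: V_of_def UP_def)

lemma V_P_eq: "V_P A = (\<lambda>i. if i = 1 then \<one> else \<zero>)"
  by (simp add: V_P_def UP_def)

lemma V_of_coeff: "a \<in> carrier A \<Longrightarrow> V_of A a i = (if i = 0 then a else \<zero>)"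
  by (simp add: V_of_eq)

lemma V_P_coeff: "V_P A i = (if i = 1 then \<one> else \<zero>)"
  by (simp add: V_P_eq)

lemma V_add_coeff: "f \<in> carrier V \<Longrightarrow> g \<in> carrier V \<Longrightarrow> (f \<oplus>\<^bsub>V\<^esub> g) i = f i \<oplus> g i"
  by (simp add: V_add)

lemma V_of_closed [simp]: "a \<in> carrier A \<Longrightarrow> V_of A a \<in> carrier V"
  unfolding V_carrier by (rule mem_upI) (auto simp: V_of_coeff)

lemma V_P_closed [simp]: "V_P A \<in> carrier V"
  unfolding V_carrier by (rule mem_upI) (auto simp: V_P_coeff)

lemma V_coeff [simp]: "v \<in> carrier V \<Longrightarrow> v i \<in> carrier A"
  unfolding V_carrier by (rule mem_upD)

lemma V_of_add: "a \<in> carrier A \<Longrightarrow> b \<in> carrier A \<Longrightarrow> V_of A (a \<oplus> b) = V_of A a \<oplus>\<^bsub>V\<^esub> V_of A b"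
  by (simp add: V_add) (auto simp: V_of_eq)

lemma V_of_one: "V_of A \<one> = \<one>\<^bsub>V\<^esub>"
  by (simp add: V_of_eq V_one)

lemma V_twist_closed [simp]: "b \<in> carrier A \<Longrightarrow> V_twist p k A eps i b \<in> carrier A"
  by (simp add: V_twist_def)

lemma V_twist_zero [simp]: "V_twist p k A eps i \<zero> = \<zero>"
proof -
  have "eps \<zero> = \<zero>\<^bsub>k\<^esub>" by (rule eps_Aplus) simp
  then show ?thesis using p_pos by (simp add: V_twist_def K.nat_pow_zero)
qed

lemma V_twist_one [simp]: "V_twist p k A eps i \<one> = \<one>"
  by (simp add: V_twist_def eps_one)

text \<open>One summand of the convolution survives when a factor is concentrated in one degree;
  products with a \<otimes> 1 and 1 \<otimes> P are computed in this way.\<close>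

lemma V_mult_single:
  assumes f: "f \<in> carrier V" and g: "g \<in> carrier V" and j: "j \<le> n"
    and z: "\<And>i. i \<le> n \<Longrightarrow> i \<noteq> j \<Longrightarrow> f i = \<zero> \<or> g (n - i) = \<zero>"
  shows "(f \<otimes>\<^bsub>V\<^esub> g) n = f j \<otimes> V_twist p k A eps j (g (n - j))"
proof -
  have "(f \<otimes>\<^bsub>V\<^esub> g) n = (\<Oplus>i\<in>{j}. f i \<otimes> V_twist p k A eps i (g (n - i)))"
    unfolding V_mult
  proof (rule A.add.finprod_mono_neutral_cong_right)
    show "f i \<otimes> V_twist p k A eps i (g (n - i)) = \<zero>" if "i \<in> {..n} - {j}" for i
      using that z[of i] f g by auto
  qed (use j f g in auto)
  then show ?thesis using f g by simp
qed

lemma V_of_mult_coeff: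
  assumes "a \<in> carrier A" "w \<in> carrier V"
  shows "(V_of A a \<otimes>\<^bsub>V\<^esub> w) n = a \<otimes> w n"
  using assms V_mult_single[of "V_of A a" w 0 n] by (simp add: V_of_coeff V_twist_def)

lemma V_of_mult:
  assumes "a \<in> carrier A" "b \<in> carrier A"
  shows "V_of A (a \<otimes> b) = V_of A a \<otimes>\<^bsub>V\<^esub> V_of A b"
proof
  fix n
  show "V_of A (a \<otimes> b) n = (V_of A a \<otimes>\<^bsub>V\<^esub> V_of A b) n"
    using assms by (simp add: V_of_mult_coeff) (simp add: V_of_coeff)
qed

lemma V_of_ring_hom: "V_of A \<in> ring_hom A V"
  by (rule ring_hom_memI) (auto simp: V_of_mult V_of_add V_of_one)

lemma V_mult_P_coeff:
  assumes "v \<in> carrier V"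
  shows "(v \<otimes>\<^bsub>V\<^esub> V_P A) n = (case n of 0 \<Rightarrow> \<zero> | Suc i \<Rightarrow> v i)"
proof (cases n)
  case 0
  then show ?thesis
    using assms V_mult_single[of v "V_P A" 0 0] by (simp add: V_P_coeff)
next
  case (Suc i)
  then have "(v \<otimes>\<^bsub>V\<^esub> V_P A) n = v i \<otimes> V_twist p k A eps i (V_P A (n - i))"
    using assms by (intro V_mult_single) (auto simp: V_P_coeff)
  with Suc show ?thesis
    using assms by (simp add: V_P_coeff)
qed

lemma V_P_mult_coeff:
  assumes "w \<in> carrier V"
  shows "(V_P A \<otimes>\<^bsub>V\<^esub> w) n = (case n of 0 \<Rightarrow> \<zero> | Suc i \<Rightarrow> (eps (w i) [^]\<^bsub>k\<^esub> p) \<odot> \<one>)"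
proof (cases n)
  case 0
  then show ?thesis
    using assms V_mult_single[of "V_P A" w 0 0] by (simp add: V_P_coeff)
next
  case (Suc i)
  have "(V_P A \<otimes>\<^bsub>V\<^esub> w) n = V_P A 1 \<otimes> V_twist p k A eps 1 (w (n - 1))"
    using assms Suc by (intro V_mult_single) (auto simp: V_P_coeff)
  then show ?thesis
    using assms Suc by (simp add: V_P_coeff V_twist_def)
qed

text \<open>Combines the rules P a = 0 for a in A_+ and P l = l^p P into P a = \<epsilon>(a)^p P,
  valid for every a.\<close>

lemma V_P_V_of:
  assumes "a \<in> carrier A"
  shows "V_P A \<otimes>\<^bsub>V\<^esub> V_of A a = V_of A ((eps a [^]\<^bsub>k\<^esub> p) \<odot> \<one>) \<otimes>\<^bsub>V\<^esub> V_P A"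
proof
  fix n
  have z: "(eps \<zero> [^]\<^bsub>k\<^esub> p) = \<zero>\<^bsub>k\<^esub>"
    using p_pos eps_Aplus[of "\<zero>"] by (simp add: K.nat_pow_zero)
  show "(V_P A \<otimes>\<^bsub>V\<^esub> V_of A a) n = (V_of A ((eps a [^]\<^bsub>k\<^esub> p) \<odot> \<one>) \<otimes>\<^bsub>V\<^esub> V_P A) n"
    using assms z by (simp add: V_P_mult_coeff V_mult_P_coeff split: nat.split)
      (auto simp: V_of_coeff)
qed

text \<open>The quotient on division by P from the right: v is its constant coefficient plus
  \<open>shift v\<close> times P.\<close>

definition shift :: "(nat \<Rightarrow> 'a) \<Rightarrow> nat \<Rightarrow> 'a" where "shift v = (\<lambda>i. v (Suc i))"

lemma shift_coeff: "shift v i = v (Suc i)"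
  by (simp add: shift_def)

lemma shift_closed [simp]:
  assumes "v \<in> carrier V"
  shows "shift v \<in> carrier V"
  unfolding V_carrier
proof (rule mem_upI)
  show "shift v i \<in> carrier A" for i using assms by (simp add: shift_def)
  obtain n where "bound \<zero> n v" using assms unfolding V_carrier by (auto simp: up_def)
  then have "bound \<zero> n (shift v)" by (auto simp: shift_def bound_def)
  then show "\<exists>n. bound \<zero> n (shift v)" ..
qed

lemma V_decomp:
  assumes "v \<in> carrier V"
  shows "v = V_of A (v 0) \<oplus>\<^bsub>V\<^esub> shift v \<otimes>\<^bsub>V\<^esub> V_P A"
  using assms
  by (intro ext) (simp add: V_add_coeff V_mult_P_coeff V_of_coeff shift_coeff split: nat.split)

text \<open>Induction on the degree: \<open>shift\<close> lowers a degree bound by one, so zero is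
  reached after finitely many steps.\<close>

lemma V_induct [consumes 1, case_names zero shift]:
  assumes v: "v \<in> carrier V"
    and zero: "Q \<zero>\<^bsub>V\<^esub>"
    and shift: "\<And>v. v \<in> carrier V \<Longrightarrow> Q (shift v) \<Longrightarrow> Q v"
  shows "Q v"
proof -
  obtain n where n: "bound \<zero> n v" using v unfolding V_carrier by (auto simp: up_def)
  have "\<forall>v\<in>carrier V. (\<forall>i\<ge>n. v i = \<zero>) \<longrightarrow> Q v" for n
  proof (induction n)
    case 0
    have "v = \<zero>\<^bsub>V\<^esub>" if "\<forall>i\<ge>0. v i = \<zero>" for v using that by (auto simp: V_zero)
    then show ?case using zero by metis
  next
    case (Suc n)
    show ?case
    proof (intro ballI impI)
      fix v assume v: "v \<in> carrier V" "\<forall>i\<ge>Suc n. v i = \<zero>"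
      have "\<forall>i\<ge>n. shift v i = \<zero>" using v(2) by (simp add: shift_def)
      then have "Q (shift v)" using Suc v(1) by simp
      then show "Q v" by (rule shift[OF v(1)])
    qed
  qed
  \<comment> \<open>\<open>bound\<close> speaks of indices strictly above n, hence the use at n +
    1.\<close>
  moreover have "\<forall>i\<ge>Suc n. v i = \<zero>" using n by (auto simp: bound_def)
  ultimately show ?thesis using v by blast
qed

lemma V_smult_decomp:
  assumes "left_module V M" "v \<in> carrier V" "x \<in> carrier M"
  shows "v \<odot>\<^bsub>M\<^esub> x = (V_of A (v 0) \<odot>\<^bsub>M\<^esub> x) \<oplus>\<^bsub>M\<^esub> (shift v \<odot>\<^bsub>M\<^esub> (V_P A \<odot>\<^bsub>M\<^esub> x))"
proof -
  interpret M: left_module V M by fact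
  have "v \<odot>\<^bsub>M\<^esub> x = (V_of A (v 0) \<oplus>\<^bsub>V\<^esub> shift v \<otimes>\<^bsub>V\<^esub> V_P A) \<odot>\<^bsub>M\<^esub> x"
    using V_decomp[OF assms(2)] by simp
  then show ?thesis
    using assms by (simp add: M.smult_l_distr M.smult_assoc1)
qed

text \<open>A and P generate V(A): v x is the constant coefficient times x plus
  \<open>shift v\<close> applied to P x, and the last term is covered by induction.\<close>

lemma V_linear_mapI:
  assumes M: "left_module V M" and N: "left_module V N"
    and closed: "\<And>x. x \<in> carrier M \<Longrightarrow> f x \<in> carrier N"
    and add: "\<And>x y. x \<in> carrier M \<Longrightarrow> y \<in> carrier M \<Longrightarrow> f (x \<oplus>\<^bsub>M\<^esub> y) = f x \<oplus>\<^bsub>N\<^esub> f y"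
    and scal: "\<And>a x. a \<in> carrier A \<Longrightarrow> x \<in> carrier M \<Longrightarrow> f (V_of A a \<odot>\<^bsub>M\<^esub> x) = V_of A a \<odot>\<^bsub>N\<^esub> f x"
    and P: "\<And>x. x \<in> carrier M \<Longrightarrow> f (V_P A \<odot>\<^bsub>M\<^esub> x) = V_P A \<odot>\<^bsub>N\<^esub> f x"
  shows "linear_map V M N f"
proof (rule linear_mapI[OF closed add])
  interpret M: left_module V M by fact
  interpret N: left_module V N by fact
  fix v x assume v: "v \<in> carrier V" and x: "x \<in> carrier M"
  have zero: "f \<zero>\<^bsub>M\<^esub> = \<zero>\<^bsub>N\<^esub>"
    using add[of "\<zero>\<^bsub>M\<^esub>" "\<zero>\<^bsub>M\<^esub>"] closed[of "\<zero>\<^bsub>M\<^esub>"]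
      N.M.add.r_cancel_one'[of "f \<zero>\<^bsub>M\<^esub>" "f \<zero>\<^bsub>M\<^esub>"] by auto
  \<comment> \<open>Stated for all x at once, because the induction hypothesis is applied at P
    x.\<close>
  have "\<forall>x\<in>carrier M. f (v \<odot>\<^bsub>M\<^esub> x) = v \<odot>\<^bsub>N\<^esub> f x"
    using v
  proof (induction v rule: V_induct)
    case zero
    then show ?case using \<open>f \<zero>\<^bsub>M\<^esub> = \<zero>\<^bsub>N\<^esub>\<close> closed by (simp add: M.lm_smult_l_null N.lm_smult_l_null)
  next
    case (shift v)
    show ?case
    proof
      fix x assume x: "x \<in> carrier M"
      have Px: "V_P A \<odot>\<^bsub>M\<^esub> x \<in> carrier M" using x by (simp add: M.smult_closed)
      have "f (v \<odot>\<^bsub>M\<^esub> x) = f (V_of A (v 0) \<odot>\<^bsub>M\<^esub> x) \<oplus>\<^bsub>N\<^esub> f (shift v \<odot>\<^bsub>M\<^esub> (V_P A \<odot>\<^bsub>M\<^esub> x))"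
        unfolding V_smult_decomp[OF M shift(1) x]
        using shift(1) x Px by (intro add M.smult_closed) auto
      also have "\<dots> = v \<odot>\<^bsub>N\<^esub> f x"
        using shift x Px by (simp add: scal P V_smult_decomp[OF N shift(1) closed[OF x]])
      finally show "f (v \<odot>\<^bsub>M\<^esub> x) = v \<odot>\<^bsub>N\<^esub> f x" .
    qed
  qed
  with x show "f (v \<odot>\<^bsub>M\<^esub> x) = v \<odot>\<^bsub>N\<^esub> f x" by blast
qed

end

text \<open>\<open>P_smult\<close> merges the two axioms of a Beck module: for a constant a it is
  semilinearity, and for a in A_+ it says P(a x) = 0, because \<epsilon>(a) = 0.\<close>

locale beck_module = pd_square_V p k A eps \<pi> + N: left_module A N
  for p :: nat and k :: "('k, 'c) ring_scheme" and A :: "('k, 'a, 'd) module_scheme" (structure)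
    and eps :: "'a \<Rightarrow> 'k" and \<pi> :: "'a \<Rightarrow> 'a" and N :: "('a, 'n, 'f) module_scheme" +
  fixes P :: "'n \<Rightarrow> 'n"
  assumes P_closed: "x \<in> carrier N \<Longrightarrow> P x \<in> carrier N"
    and P_add: "\<lbrakk>x \<in> carrier N; y \<in> carrier N\<rbrakk> \<Longrightarrow> P (x \<oplus>\<^bsub>N\<^esub> y) = P x \<oplus>\<^bsub>N\<^esub> P y"
    and P_smult: "\<lbrakk>a \<in> carrier A; x \<in> carrier N\<rbrakk> \<Longrightarrow>
      P (a \<odot>\<^bsub>N\<^esub> x) = ((eps a [^]\<^bsub>k\<^esub> p) \<odot> \<one>) \<odot>\<^bsub>N\<^esub> P x"
begin

abbreviation "BN \<equiv> beck_V_module A N P"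

lemma BN_simps:
  "carrier BN = carrier N" "\<zero>\<^bsub>BN\<^esub> = \<zero>\<^bsub>N\<^esub>" "add BN = add N"
  by (simp_all add: beck_V_module_def)

lemma P_funpow_closed [simp]: "x \<in> carrier N \<Longrightarrow> (P ^^ i) x \<in> carrier N"
  by (induction i) (auto simp: P_closed)

text \<open>Supports vary with v; a common degree bound makes the sums for different v
  comparable.\<close>

lemma act_bound:
  assumes v: "v \<in> carrier V" and x: "x \<in> carrier N" and n: "\<And>i. i > n \<Longrightarrow> v i = \<zero>"
  shows "v \<odot>\<^bsub>BN\<^esub> x = (\<Oplus>\<^bsub>N\<^esub>i\<in>{..n}. v i \<odot>\<^bsub>N\<^esub> ((P ^^ i) x))"
proof -
  have "v \<odot>\<^bsub>BN\<^esub> x = (\<Oplus>\<^bsub>N\<^esub>i\<in>{i. v i \<noteq> \<zero>}. v i \<odot>\<^bsub>N\<^esub> ((P ^^ i) x))"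
    by (simp add: beck_V_module_def)
  also have "\<dots> = (\<Oplus>\<^bsub>N\<^esub>i\<in>{..n}. v i \<odot>\<^bsub>N\<^esub> ((P ^^ i) x))"
  proof (rule N.M.add.finprod_mono_neutral_cong_left)
    show "{i. v i \<noteq> \<zero>} \<subseteq> {..n}" using n by (auto simp: not_less[symmetric])
    show "v i \<odot>\<^bsub>N\<^esub> ((P ^^ i) x) = \<zero>\<^bsub>N\<^esub>" if "i \<in> {..n} - {i. v i \<noteq> \<zero>}" for i
      using that x by (simp add: N.lm_smult_l_null)
  qed (use v x in \<open>auto simp: N.smult_closed\<close>)
  finally show ?thesis .
qed

lemma V_bound:
  assumes "v \<in> carrier V"
  obtains n where "\<And>i. i > n \<Longrightarrow> v i = \<zero>"
  using assms unfolding V_carrier by (auto simp: up_def bound_def)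

lemma act_closed:
  assumes "v \<in> carrier V" "x \<in> carrier N"
  shows "v \<odot>\<^bsub>BN\<^esub> x \<in> carrier N"
proof -
  obtain n where n: "\<And>i. i > n \<Longrightarrow> v i = \<zero>" by (rule V_bound[OF assms(1)]) blast
  have "v \<odot>\<^bsub>BN\<^esub> x = (\<Oplus>\<^bsub>N\<^esub>i\<in>{..n}. v i \<odot>\<^bsub>N\<^esub> ((P ^^ i) x))"
    using assms n by (intro act_bound)
  then show ?thesis
    using assms by (simp add: N.M.finsum_closed N.smult_closed)
qed

lemma act_V_of:
  assumes "a \<in> carrier A" "x \<in> carrier N"
  shows "V_of A a \<odot>\<^bsub>BN\<^esub> x = a \<odot>\<^bsub>N\<^esub> x"
  using act_bound[of "V_of A a" x 0] assms by (simp add: V_of_coeff N.smult_closed)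

lemma act_V_P:
  assumes "x \<in> carrier N"
  shows "V_P A \<odot>\<^bsub>BN\<^esub> x = P x"
proof -
  have "V_P A \<odot>\<^bsub>BN\<^esub> x = (\<Oplus>\<^bsub>N\<^esub>i\<in>{..Suc 0}. V_P A i \<odot>\<^bsub>N\<^esub> ((P ^^ i) x))"
    using assms by (intro act_bound) (auto simp: V_P_coeff)
  then show ?thesis
    using assms
    by (simp add: V_P_coeff N.lm_smult_l_null N.smult_one P_closed N.smult_closed)
qed

lemma act_add_left:
  assumes v: "v \<in> carrier V" and w: "w \<in> carrier V" and x: "x \<in> carrier N"
  shows "(v \<oplus>\<^bsub>V\<^esub> w) \<odot>\<^bsub>BN\<^esub> x = (v \<odot>\<^bsub>BN\<^esub> x) \<oplus>\<^bsub>N\<^esub> (w \<odot>\<^bsub>BN\<^esub> x)"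
proof -
  obtain m where m: "\<And>i. i > m \<Longrightarrow> v i = \<zero>" by (rule V_bound[OF v]) blast
  obtain n where n: "\<And>i. i > n \<Longrightarrow> w i = \<zero>" by (rule V_bound[OF w]) blast
  have "(v \<oplus>\<^bsub>V\<^esub> w) \<odot>\<^bsub>BN\<^esub> x = (\<Oplus>\<^bsub>N\<^esub>i\<in>{..max m n}. (v \<oplus>\<^bsub>V\<^esub> w) i \<odot>\<^bsub>N\<^esub> ((P ^^ i) x))"
    using v w x m n by (intro act_bound) (auto simp: V_add_coeff)
  also have "\<dots> = (\<Oplus>\<^bsub>N\<^esub>i\<in>{..max m n}. (v i \<odot>\<^bsub>N\<^esub> ((P ^^ i) x)) \<oplus>\<^bsub>N\<^esub> (w i \<odot>\<^bsub>N\<^esub> ((P ^^ i) x)))"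
    using v w x by (intro N.M.finsum_cong') (auto simp: V_add_coeff N.smult_l_distr N.smult_closed)
  also have "\<dots> = (\<Oplus>\<^bsub>N\<^esub>i\<in>{..max m n}. v i \<odot>\<^bsub>N\<^esub> ((P ^^ i) x)) \<oplus>\<^bsub>N\<^esub>
      (\<Oplus>\<^bsub>N\<^esub>i\<in>{..max m n}. w i \<odot>\<^bsub>N\<^esub> ((P ^^ i) x))"
    using v w x by (intro N.M.finsum_addf) (auto simp: N.smult_closed)
  also have "(\<Oplus>\<^bsub>N\<^esub>i\<in>{..max m n}. v i \<odot>\<^bsub>N\<^esub> ((P ^^ i) x)) = v \<odot>\<^bsub>BN\<^esub> x"
    using v x m by (intro act_bound[symmetric]) auto
  also have "(\<Oplus>\<^bsub>N\<^esub>i\<in>{..max m n}. w i \<odot>\<^bsub>N\<^esub> ((P ^^ i) x)) = w \<odot>\<^bsub>BN\<^esub> x"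
    using w x n by (intro act_bound[symmetric]) auto
  finally show ?thesis .
qed

lemma P_funpow_add: "x \<in> carrier N \<Longrightarrow> y \<in> carrier N \<Longrightarrow>
    (P ^^ i) (x \<oplus>\<^bsub>N\<^esub> y) = (P ^^ i) x \<oplus>\<^bsub>N\<^esub> (P ^^ i) y"
  by (induction i) (auto simp: P_add)

lemma act_add_right:
  assumes v: "v \<in> carrier V" and x: "x \<in> carrier N" and y: "y \<in> carrier N"
  shows "v \<odot>\<^bsub>BN\<^esub> (x \<oplus>\<^bsub>N\<^esub> y) = (v \<odot>\<^bsub>BN\<^esub> x) \<oplus>\<^bsub>N\<^esub> (v \<odot>\<^bsub>BN\<^esub> y)"
proof -
  obtain n where n: "\<And>i. i > n \<Longrightarrow> v i = \<zero>" by (rule V_bound[OF v]) blast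
  have xy: "x \<oplus>\<^bsub>N\<^esub> y \<in> carrier N" using x y by simp
  have eq: "v \<odot>\<^bsub>BN\<^esub> z = (\<Oplus>\<^bsub>N\<^esub>i\<in>{..n}. v i \<odot>\<^bsub>N\<^esub> ((P ^^ i) z))" if "z \<in> carrier N" for z
    using v that n by (intro act_bound)
  have "v \<odot>\<^bsub>BN\<^esub> (x \<oplus>\<^bsub>N\<^esub> y) =
    (\<Oplus>\<^bsub>N\<^esub>i\<in>{..n}. (v i \<odot>\<^bsub>N\<^esub> ((P ^^ i) x)) \<oplus>\<^bsub>N\<^esub> (v i \<odot>\<^bsub>N\<^esub> ((P ^^ i) y)))"
    unfolding eq[OF xy] using v x y
    by (intro N.M.finsum_cong') (auto simp: P_funpow_add N.smult_r_distr N.smult_closed)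
  also have "\<dots> = (v \<odot>\<^bsub>BN\<^esub> x) \<oplus>\<^bsub>N\<^esub> (v \<odot>\<^bsub>BN\<^esub> y)"
    unfolding eq[OF x] eq[OF y] using v x y
    by (intro N.M.finsum_addf) (auto simp: N.smult_closed)
  finally show ?thesis .
qed

text \<open>The action obeys the one-step recursion of \<open>V_decomp\<close>, with P moved from
  the ring to the module.\<close>

lemma act_shift:
  assumes v: "v \<in> carrier V" and x: "x \<in> carrier N"
  shows "v \<odot>\<^bsub>BN\<^esub> x = (v 0 \<odot>\<^bsub>N\<^esub> x) \<oplus>\<^bsub>N\<^esub> (shift v \<odot>\<^bsub>BN\<^esub> P x)"
proof -
  obtain n where n: "\<And>i. i > n \<Longrightarrow> v i = \<zero>" by (rule V_bound[OF v]) blast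
  have "v \<odot>\<^bsub>BN\<^esub> x = (\<Oplus>\<^bsub>N\<^esub>i\<in>{..Suc n}. v i \<odot>\<^bsub>N\<^esub> ((P ^^ i) x))"
    using n by (intro act_bound v x) auto
  also have "\<dots> = (\<Oplus>\<^bsub>N\<^esub>i\<in>{..n}. v (Suc i) \<odot>\<^bsub>N\<^esub> ((P ^^ Suc i) x)) \<oplus>\<^bsub>N\<^esub> (v 0 \<odot>\<^bsub>N\<^esub> ((P ^^ 0) x))"
    using v x P_funpow_closed[OF x] by (intro N.M.finsum_Suc2) (auto intro!: N.smult_closed P_closed)
  also have "(\<Oplus>\<^bsub>N\<^esub>i\<in>{..n}. v (Suc i) \<odot>\<^bsub>N\<^esub> ((P ^^ Suc i) x)) = shift v \<odot>\<^bsub>BN\<^esub> P x"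
    using v x n P_closed[OF x]
    by (subst act_bound[where n = n])
       (auto simp: shift_coeff funpow_Suc_right simp del: funpow.simps)
  finally show ?thesis
    using v x by (simp add: N.M.a_comm N.smult_closed act_closed P_closed)
qed

lemma act_V_of_mult:
  assumes a: "a \<in> carrier A" and w: "w \<in> carrier V" and x: "x \<in> carrier N"
  shows "(V_of A a \<otimes>\<^bsub>V\<^esub> w) \<odot>\<^bsub>BN\<^esub> x = a \<odot>\<^bsub>N\<^esub> (w \<odot>\<^bsub>BN\<^esub> x)"
proof -
  obtain n where n: "\<And>i. i > n \<Longrightarrow> w i = \<zero>" by (rule V_bound[OF w]) blast
  have eq: "w \<odot>\<^bsub>BN\<^esub> x = (\<Oplus>\<^bsub>N\<^esub>i\<in>{..n}. w i \<odot>\<^bsub>N\<^esub> ((P ^^ i) x))"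
    using w x n by (intro act_bound)
  have "(V_of A a \<otimes>\<^bsub>V\<^esub> w) \<odot>\<^bsub>BN\<^esub> x = (\<Oplus>\<^bsub>N\<^esub>i\<in>{..n}. (V_of A a \<otimes>\<^bsub>V\<^esub> w) i \<odot>\<^bsub>N\<^esub> ((P ^^ i) x))"
    using a w x n by (intro act_bound) (auto simp: V_of_mult_coeff)
  also have "\<dots> = (\<Oplus>\<^bsub>N\<^esub>i\<in>{..n}. a \<odot>\<^bsub>N\<^esub> (w i \<odot>\<^bsub>N\<^esub> ((P ^^ i) x)))"
    using a w x
    by (intro N.M.finsum_cong') (auto simp: V_of_mult_coeff N.smult_assoc1 N.smult_closed)
  also have "\<dots> = a \<odot>\<^bsub>N\<^esub> (w \<odot>\<^bsub>BN\<^esub> x)"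
    unfolding eq using a w x
    by (intro N.lm_finsum_smult[symmetric]) (auto simp: N.smult_closed)
  finally show ?thesis .
qed

text \<open>With w_i the coefficients of w, that of P w in degree i + 1 is \<epsilon>(w_i)^p, and
  semilinearity turns \<epsilon>(w_i)^p P(P^i x) into P(w_i P^i x).\<close>

lemma act_V_P_mult:
  assumes w: "w \<in> carrier V" and x: "x \<in> carrier N"
  shows "(V_P A \<otimes>\<^bsub>V\<^esub> w) \<odot>\<^bsub>BN\<^esub> x = P (w \<odot>\<^bsub>BN\<^esub> x)"
proof -
  obtain n where n: "\<And>i. i > n \<Longrightarrow> w i = \<zero>" by (rule V_bound[OF w]) blast
  have eq: "w \<odot>\<^bsub>BN\<^esub> x = (\<Oplus>\<^bsub>N\<^esub>i\<in>{..n}. w i \<odot>\<^bsub>N\<^esub> ((P ^^ i) x))"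
    using w x n by (intro act_bound)
  have Pw: "V_P A \<otimes>\<^bsub>V\<^esub> w \<in> carrier V" using w by simp
  have z: "(eps \<zero> [^]\<^bsub>k\<^esub> p) = \<zero>\<^bsub>k\<^esub>"
    using p_pos eps_Aplus[of "\<zero>"] by (simp add: K.nat_pow_zero)
  have "(V_P A \<otimes>\<^bsub>V\<^esub> w) \<odot>\<^bsub>BN\<^esub> x = (\<Oplus>\<^bsub>N\<^esub>i\<in>{..Suc n}. (V_P A \<otimes>\<^bsub>V\<^esub> w) i \<odot>\<^bsub>N\<^esub> ((P ^^ i) x))"
    using w x n z by (intro act_bound Pw) (auto simp: V_P_mult_coeff split: nat.split)
  also have "\<dots> = (\<Oplus>\<^bsub>N\<^esub>i\<in>{..n}. (V_P A \<otimes>\<^bsub>V\<^esub> w) (Suc i) \<odot>\<^bsub>N\<^esub> ((P ^^ Suc i) x)) \<oplus>\<^bsub>N\<^esub>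
      ((V_P A \<otimes>\<^bsub>V\<^esub> w) 0 \<odot>\<^bsub>N\<^esub> ((P ^^ 0) x))"
    using V_coeff[OF Pw] x P_funpow_closed[OF x]
    by (intro N.M.finsum_Suc2) (auto intro!: N.smult_closed P_closed)
  also have "\<dots> = (\<Oplus>\<^bsub>N\<^esub>i\<in>{..n}. P (w i \<odot>\<^bsub>N\<^esub> ((P ^^ i) x)))"
    using w x
    by (simp add: V_P_mult_coeff N.lm_smult_l_null P_smult N.M.finsum_closed N.smult_closed P_closed)
  also have "\<dots> = P (w \<odot>\<^bsub>BN\<^esub> x)"
    unfolding eq using w x
    by (intro finsum_hom[symmetric] N.M.abelian_group_axioms)
       (auto simp: P_closed P_add N.smult_closed)
  finally show ?thesis .
qed

text \<open>Left multiplication by a \<otimes> 1 and by P is known from coefficients. After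
  splitting v, associativity in V(A) moves the right factor P over to w, and the induction
  hypothesis for \<open>shift v\<close> is applied to P w; hence the quantification over w.\<close>

lemma act_assoc:
  assumes "v \<in> carrier V" "w \<in> carrier V" "x \<in> carrier N"
  shows "(v \<otimes>\<^bsub>V\<^esub> w) \<odot>\<^bsub>BN\<^esub> x = v \<odot>\<^bsub>BN\<^esub> (w \<odot>\<^bsub>BN\<^esub> x)"
proof -
  have zero: "\<zero>\<^bsub>V\<^esub> \<odot>\<^bsub>BN\<^esub> y = \<zero>\<^bsub>N\<^esub>" if "y \<in> carrier N" for y
    by (simp add: beck_V_module_def V_zero)
  have "\<forall>w\<in>carrier V. (v \<otimes>\<^bsub>V\<^esub> w) \<odot>\<^bsub>BN\<^esub> x = v \<odot>\<^bsub>BN\<^esub> (w \<odot>\<^bsub>BN\<^esub> x)"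
    using assms(1)
  proof (induction v rule: V_induct)
    case zero
    then show ?case using \<open>\<And>y. y \<in> carrier N \<Longrightarrow> \<zero>\<^bsub>V\<^esub> \<odot>\<^bsub>BN\<^esub> y = \<zero>\<^bsub>N\<^esub>\<close> assms(3)
      by (simp add: act_closed)
  next
    case (shift v)
    show ?case
    proof
      fix w assume w: "w \<in> carrier V"
      note c = shift(1) w assms(3)
      have "v \<otimes>\<^bsub>V\<^esub> w = (V_of A (v 0) \<oplus>\<^bsub>V\<^esub> shift v \<otimes>\<^bsub>V\<^esub> V_P A) \<otimes>\<^bsub>V\<^esub> w"
        using V_decomp[OF shift(1)] by simp
      also have "\<dots> = V_of A (v 0) \<otimes>\<^bsub>V\<^esub> w \<oplus>\<^bsub>V\<^esub> shift v \<otimes>\<^bsub>V\<^esub> (V_P A \<otimes>\<^bsub>V\<^esub> w)"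
        using c by (simp add: V.l_distr V.m_assoc)
      finally have "(v \<otimes>\<^bsub>V\<^esub> w) \<odot>\<^bsub>BN\<^esub> x =
        ((V_of A (v 0) \<otimes>\<^bsub>V\<^esub> w) \<odot>\<^bsub>BN\<^esub> x) \<oplus>\<^bsub>N\<^esub> ((shift v \<otimes>\<^bsub>V\<^esub> (V_P A \<otimes>\<^bsub>V\<^esub> w)) \<odot>\<^bsub>BN\<^esub> x)"
        using c by (simp add: act_add_left)
      also have "\<dots> = (v 0 \<odot>\<^bsub>N\<^esub> (w \<odot>\<^bsub>BN\<^esub> x)) \<oplus>\<^bsub>N\<^esub> (shift v \<odot>\<^bsub>BN\<^esub> P (w \<odot>\<^bsub>BN\<^esub> x))"
        using c shift(2) by (simp add: act_V_of_mult act_V_P_mult)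
      also have "\<dots> = v \<odot>\<^bsub>BN\<^esub> (w \<odot>\<^bsub>BN\<^esub> x)"
        using c by (intro act_shift[symmetric] act_closed)
      finally show "(v \<otimes>\<^bsub>V\<^esub> w) \<odot>\<^bsub>BN\<^esub> x = v \<odot>\<^bsub>BN\<^esub> (w \<odot>\<^bsub>BN\<^esub> x)" .
    qed
  qed
  with assms(2) show ?thesis by blast
qed

lemma BN_left_module: "left_module V BN"
proof (rule left_moduleI[OF V.ring_axioms])
  show "abelian_group BN"
    by (rule abelian_group_cong[OF N.M.abelian_group_axioms]) (simp_all add: BN_simps)
  show "\<one>\<^bsub>V\<^esub> \<odot>\<^bsub>BN\<^esub> x = x" if "x \<in> carrier BN" for x
    using act_V_of[of "\<one>" x] that by (simp add: V_of_one BN_simps N.smult_one)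
qed (simp_all add: BN_simps act_closed act_add_left act_add_right act_assoc)

end

section \<open>The module \<open>I/I\<^sup>2\<close>\<close>

context pd_square
begin

section \<open>The p-map on the ideal I and on its square\<close>

abbreviation "I \<equiv> diag_ideal k A"
abbreviation "I2 \<equiv> diag_ideal_sq k A"
abbreviation "cls x \<equiv> I2 +>\<^bsub>T\<^esub> x"

lemma I_iff: "x \<in> I \<longleftrightarrow> x \<in> carrier T \<and> \<mu> x = \<zero>"
  by (auto simp: diag_ideal_def a_kernel_def')

lemma I_ideal: "ideal I T"
proof -
  interpret ring_hom_ring T A \<mu>
    by (rule ring_hom_ringI2[OF T.ring_axioms A.ring_axioms sq.mult_map_ring_hom])
  show ?thesis unfolding diag_ideal_def by (rule kernel_is_ideal)
qed

sublocale I: ideal I T by (rule I_ideal)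

declare I.a_Hcarr [simp del]

lemma I2_ideal: "ideal I2 T"
  unfolding diag_ideal_sq_def by (rule T.ideal_prod_is_ideal[OF I_ideal I_ideal])

sublocale I2: ideal I2 T by (rule I2_ideal)

declare I2.a_Hcarr [simp del]

lemma I2_subset: "x \<in> I2 \<Longrightarrow> x \<in> I"
  unfolding diag_ideal_sq_def using T.ideal_prod_inter[OF I_ideal I_ideal] by blast

lemma I2_mult: "x \<in> I \<Longrightarrow> y \<in> I \<Longrightarrow> x \<otimes>\<^bsub>T\<^esub> y \<in> I2"
  unfolding diag_ideal_sq_def by (rule ideal_prod.prod)

lemma I2_induct [consumes 1, case_names prod sum]:
  assumes "x \<in> I2"
    and "\<And>x y. x \<in> I \<Longrightarrow> y \<in> I \<Longrightarrow> Q (x \<otimes>\<^bsub>T\<^esub> y)"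
    and "\<And>x y. x \<in> I2 \<Longrightarrow> Q x \<Longrightarrow> y \<in> I2 \<Longrightarrow> Q y \<Longrightarrow> Q (x \<oplus>\<^bsub>T\<^esub> y)"
  shows "Q x"
  using assms unfolding diag_ideal_sq_def by (rule ideal_prod.induct)

lemma I_Tplus: "x \<in> I \<Longrightarrow> x \<in> Tplus"
  by (simp add: I_iff Tplus_iff tensor_eps_def eps_Aplus)

lemma q_I: "x \<in> I \<Longrightarrow> q x \<in> I"
proof -
  assume x: "x \<in> I"
  have "\<mu> (q x) = \<zero>" using mu_q[OF I_Tplus[OF x]] x by (simp add: I_iff pi_zero)
  then show "q x \<in> I" using Tplus.Icarr[OF q_closed[OF I_Tplus[OF x]]] by (simp add: I_iff)
qed

text \<open>Modulo I^2 the cross term is -x^(p-1) y, which lies in I^2 as p - 1 > 0. So the p-map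
  becomes additive on I/I^2.\<close>

lemma pc_I_I2:
  assumes x: "x \<in> I" and y: "y \<in> I"
  shows "pd_cross p k T x y \<in> I2"
proof -
  have c: "x \<in> carrier T" "y \<in> carrier T" using x y by (auto simp: I_iff)
  have "p \<ge> 2" using K.prime_p prime_ge_2_nat by blast
  then obtain n where "p - 1 = Suc n" by (cases "p - 1") auto
  then have "x [^]\<^bsub>T\<^esub> (p - 1) \<in> I" using x c by (simp add: I.I_l_closed)
  then have z: "x [^]\<^bsub>T\<^esub> (p - 1) \<otimes>\<^bsub>T\<^esub> y \<in> I2" using y by (rule I2_mult)
  have "pd_cross p k T x y \<oplus>\<^bsub>T\<^esub> x [^]\<^bsub>T\<^esub> (p - 1) \<otimes>\<^bsub>T\<^esub> y \<in> I2"
    using c y by (intro Tp.pc_mod_square[OF I2_ideal] I2_mult)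
  from I2.a_closed[OF this I2.a_inv_closed[OF z]]
  have "(pd_cross p k T x y \<oplus>\<^bsub>T\<^esub> x [^]\<^bsub>T\<^esub> (p - 1) \<otimes>\<^bsub>T\<^esub> y) \<oplus>\<^bsub>T\<^esub>
      \<ominus>\<^bsub>T\<^esub> (x [^]\<^bsub>T\<^esub> (p - 1) \<otimes>\<^bsub>T\<^esub> y) \<in> I2" .
  then show ?thesis using c by (simp add: T.a_assoc T.r_neg)
qed

text \<open>The p-map kills products of elements of T_+, in particular those spanning I^2; sums only
  add cross terms, again in I^2.\<close>

lemma q_I2: "x \<in> I2 \<Longrightarrow> q x \<in> I2"
proof (induction x rule: I2_induct)
  case (prod x y)
  then show ?case by (simp add: q_mult I_Tplus)
next
  case (sum x y)
  then show ?case by (simp add: q_add I_Tplus I2_subset pc_I_I2)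
qed

text \<open>The representative in I of the universal derivation.\<close>

definition "dif b = tn \<one> b \<ominus>\<^bsub>T\<^esub> tn b \<one>"

lemma dif_T [simp]: "b \<in> carrier A \<Longrightarrow> dif b \<in> carrier T"
  by (simp add: dif_def)

lemma mu_minus: "x \<in> carrier T \<Longrightarrow> y \<in> carrier T \<Longrightarrow> \<mu> (x \<ominus>\<^bsub>T\<^esub> y) = \<mu> x \<ominus> \<mu> y"
proof -
  interpret h: ring_hom_ring T A \<mu>
    by (rule ring_hom_ringI2[OF T.ring_axioms A.ring_axioms sq.mult_map_ring_hom])
  show "x \<in> carrier T \<Longrightarrow> y \<in> carrier T \<Longrightarrow> \<mu> (x \<ominus>\<^bsub>T\<^esub> y) = \<mu> x \<ominus> \<mu> y"
    by (simp add: a_minus_def)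
qed

lemma dif_I: "b \<in> carrier A \<Longrightarrow> dif b \<in> I"
  by (simp add: I_iff dif_def mu_minus sq.mult_map_tens a_minus_def[of A] A.r_neg)

lemma cotangent_d_eq: "cotangent_d k A b = cls (dif b)"
  by (simp add: cotangent_d_def dif_def)

text \<open>An element \<open>\<Sum> a \<otimes> b\<close> of \<open>I\<close> equals \<open>\<Sum> (a \<otimes> 1) (1 \<otimes> b - b \<otimes> 1)\<close>.\<close>

lemma I_induct [consumes 1, case_names dif add]:
  assumes x: "x \<in> I"
    and dif: "\<And>a b. a \<in> carrier A \<Longrightarrow> b \<in> carrier A \<Longrightarrow> Q (tn a \<one> \<otimes>\<^bsub>T\<^esub> dif b)"
    and add: "\<And>x y. x \<in> I \<Longrightarrow> y \<in> I \<Longrightarrow> Q x \<Longrightarrow> Q y \<Longrightarrow> Q (x \<oplus>\<^bsub>T\<^esub> y)"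
  shows "Q x"
proof -
  have mem: "t \<ominus>\<^bsub>T\<^esub> tn (\<mu> t) \<one> \<in> I" if "t \<in> carrier T" for t
    using that by (simp add: I_iff mu_minus sq.mult_map_tens a_minus_def[of A] A.r_neg)
  \<comment> \<open>The correction t - \<mu>(t) \<otimes> 1 lies in I, is additive in t, and is t
    itself for t in I; so induction over pure tensors of T becomes induction over I.\<close>
  have "Q (t \<ominus>\<^bsub>T\<^esub> tn (\<mu> t) \<one>)" if "t \<in> carrier T" for t
    using that
  proof (induction t rule: sq.T_induct)
    case (tens a b)
    have "tn a b \<ominus>\<^bsub>T\<^esub> tn (\<mu> (tn a b)) \<one> = tn a \<one> \<otimes>\<^bsub>T\<^esub> dif b"
      using tens
      by (simp add: dif_def a_minus_def T.r_distr T.r_minus sq.tens_mult sq.mult_map_tens)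
    with tens show ?case using dif by simp
  next
    case (add x y)
    have "(x \<oplus>\<^bsub>T\<^esub> y) \<ominus>\<^bsub>T\<^esub> tn (\<mu> (x \<oplus>\<^bsub>T\<^esub> y)) \<one> =
      (x \<ominus>\<^bsub>T\<^esub> tn (\<mu> x) \<one>) \<oplus>\<^bsub>T\<^esub> (y \<ominus>\<^bsub>T\<^esub> tn (\<mu> y) \<one>)"
      using add by (simp add: mu_add sq.tens_add_left a_minus_def T.minus_add T.a_ac)
    with add show ?case using assms(3) mem by simp
  qed
  from this[of x] show ?thesis
    using x by (simp add: I_iff tens_zero a_minus_def)
qed

section \<open>The A-module I/I^2 and its p-map\<close>

abbreviation "D \<equiv> diag_module k A"

lemma D_simps:
  "carrier D = I" "\<zero>\<^bsub>D\<^esub> = \<zero>\<^bsub>T\<^esub>" "add D = add T"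
  "a \<odot>\<^bsub>D\<^esub> x = tn a \<one> \<otimes>\<^bsub>T\<^esub> x"
  by (simp_all add: diag_module_def)

lemma D_left_module: "left_module A D"
proof (rule left_moduleI[OF A.ring_axioms])
  show "abelian_group D"
  proof (rule abelian_groupI)
    fix x assume "x \<in> carrier D"
    then have "\<ominus>\<^bsub>T\<^esub> x \<in> carrier D" "\<ominus>\<^bsub>T\<^esub> x \<oplus>\<^bsub>D\<^esub> x = \<zero>\<^bsub>D\<^esub>"
      by (auto simp: D_simps T.l_neg I.Icarr)
    then show "\<exists>y\<in>carrier D. y \<oplus>\<^bsub>D\<^esub> x = \<zero>\<^bsub>D\<^esub>" by blast
  qed (auto simp: D_simps I.Icarr T.a_assoc, auto simp: I.Icarr T.a_comm)
qed (auto simp: D_simps I.Icarr I.I_l_closed T.l_distr T.r_distr sq.tens_add_left sq.tens_mult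
    T.m_assoc[symmetric] sq.tens_one[symmetric])

lemma I2_submodule: "submodule I2 A D"
  by (rule left_module.lm_submoduleI[OF D_left_module])
     (auto simp: D_simps I2_subset I2.I_l_closed)

sublocale C: quot_left_module A D I2
  by (simp add: quot_left_module_def quot_left_module_axioms_def D_left_module I2_submodule)

abbreviation "CN \<equiv> quot_module D I2"
abbreviation "cpi \<equiv> cotangent_pi p k A eps \<pi>"

text \<open>Cosets depend only on the addition, which \<open>D\<close> shares with T.\<close>

lemma cls_D: "I2 +>\<^bsub>D\<^esub> x = cls x"
  by (rule a_r_coset_cong) (simp add: D_simps)

lemma CN_carrier: "carrier CN = cls ` I"
  using C.quot_carrier by (simp add: cls_D D_simps)

lemma CN_add: "x \<in> I \<Longrightarrow> y \<in> I \<Longrightarrow> cls x \<oplus>\<^bsub>CN\<^esub> cls y = cls (x \<oplus>\<^bsub>T\<^esub> y)"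
  using C.quot_add[of x y] by (simp add: cls_D D_simps)

lemma CN_smult: "a \<in> carrier A \<Longrightarrow> x \<in> I \<Longrightarrow> a \<odot>\<^bsub>CN\<^esub> cls x = cls (tn a \<one> \<otimes>\<^bsub>T\<^esub> x)"
  using C.quot_smult[of a x] by (simp add: cls_D D_simps)

lemma T_coset_eq: "x \<in> carrier T \<Longrightarrow> y \<in> carrier T \<Longrightarrow> cls x = cls y \<longleftrightarrow> x \<ominus>\<^bsub>T\<^esub> y \<in> I2"
  using T.quotient_eq_iff_same_a_r_cos[OF I2_ideal] by blast

lemma cls_add_I2:
  assumes "x \<in> carrier T" "z \<in> I2"
  shows "cls (x \<oplus>\<^bsub>T\<^esub> z) = cls x"
proof -
  have z: "z \<in> carrier T" by (rule I2.Icarr[OF assms(2)])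
  have "(x \<oplus>\<^bsub>T\<^esub> z) \<ominus>\<^bsub>T\<^esub> x = z"
    using assms(1) z by (simp add: a_minus_def T.a_comm[of x z] T.a_assoc T.r_neg)
  then show ?thesis using assms z by (subst T_coset_eq) auto
qed

lemma cls_q_add:
  assumes x: "x \<in> I" and y: "y \<in> I"
  shows "cls (q (x \<oplus>\<^bsub>T\<^esub> y)) = cls (q x \<oplus>\<^bsub>T\<^esub> q y)"
  using x y q_I[OF x] q_I[OF y]
  by (simp add: q_add I_Tplus cls_add_I2 pc_I_I2 I.Icarr)

text \<open>The union in \<open>cotangent_pi\<close> collapses because modulo I^2 the p-map is
  additive on I, and it maps I^2 into itself.\<close>

lemma cpi_cls:
  assumes x: "x \<in> I"
  shows "cpi (cls x) = cls (q x)"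
proof -
  have xT: "x \<in> carrier T" by (rule I.Icarr[OF x])
  have "cls (q y) = cls (q x)" if y: "y \<in> cls x" for y
  proof -
    obtain z where z: "z \<in> I2" "y = z \<oplus>\<^bsub>T\<^esub> x" using y by (auto simp: a_r_coset_def')
    have zI: "z \<in> I" by (rule I2_subset[OF z(1)])
    have "cls (q y) = cls (q x \<oplus>\<^bsub>T\<^esub> q z)"
      using cls_q_add[OF x zI] z xT by (simp add: T.a_comm I2.Icarr)
    also have "\<dots> = cls (q x)"
      using x z by (intro cls_add_I2 q_I2 I.Icarr[OF q_I])
    finally show ?thesis .
  qed
  moreover have "x \<in> cls x"
  proof -
    have "x = \<zero>\<^bsub>T\<^esub> \<oplus>\<^bsub>T\<^esub> x" using xT by simp
    then show ?thesis unfolding a_r_coset_def' using I2.zero_closed by blast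
  qed
  ultimately show ?thesis unfolding cotangent_pi_def by blast
qed

lemma dif_add: "a \<in> carrier A \<Longrightarrow> b \<in> carrier A \<Longrightarrow> dif (a \<oplus> b) = dif a \<oplus>\<^bsub>T\<^esub> dif b"
  by (simp add: dif_def sq.tens_add_left sq.tens_add_right a_minus_def T.minus_add T.a_ac)

lemma dif_smult: "l \<in> carrier k \<Longrightarrow> a \<in> carrier A \<Longrightarrow> dif (l \<odot> a) = l \<odot>\<^bsub>T\<^esub> dif a"
  by (simp add: dif_def sq.tens_smult_left sq.tens_smult_right a_minus_def Tp.alg.smult_r_distr
      Tp.alg.smult_r_minus)

lemma dif_const: "l \<in> carrier k \<Longrightarrow> dif (l \<odot> \<one>) = \<zero>\<^bsub>T\<^esub>"
  by (simp add: dif_smult) (simp add: dif_def a_minus_def T.r_neg)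

text \<open>Constants have zero difference, so an element of A may be replaced by its part in A_+,
  to which \<pi> applies.\<close>

lemma dif_pr: "a \<in> carrier A \<Longrightarrow> dif (pr a) = dif a"
  using pr_decomp[of a] dif_add[of "pr a" "eps a \<odot> \<one>"] by (simp add: dif_const)

text \<open>The Leibniz rule up to the product of the two differences, an element of I^2.\<close>

lemma dif_mult:
  assumes a: "a \<in> carrier A" and b: "b \<in> carrier A"
  shows "dif (a \<otimes> b) = (tn a \<one> \<otimes>\<^bsub>T\<^esub> dif b \<oplus>\<^bsub>T\<^esub> tn b \<one> \<otimes>\<^bsub>T\<^esub> dif a) \<oplus>\<^bsub>T\<^esub> dif a \<otimes>\<^bsub>T\<^esub> dif b"
proof -
  define u v u' v' where "u = tn \<one> a" "v = tn a \<one>" "u' = tn \<one> b" "v' = tn b \<one>"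
  note uv = this
  have c: "u \<in> carrier T" "v \<in> carrier T" "u' \<in> carrier T" "v' \<in> carrier T"
    using a b by (simp_all add: uv)
  have "u \<otimes>\<^bsub>T\<^esub> u' \<ominus>\<^bsub>T\<^esub> v \<otimes>\<^bsub>T\<^esub> v' =
    (v \<otimes>\<^bsub>T\<^esub> (u' \<ominus>\<^bsub>T\<^esub> v') \<oplus>\<^bsub>T\<^esub> v' \<otimes>\<^bsub>T\<^esub> (u \<ominus>\<^bsub>T\<^esub> v)) \<oplus>\<^bsub>T\<^esub> (u \<ominus>\<^bsub>T\<^esub> v) \<otimes>\<^bsub>T\<^esub> (u' \<ominus>\<^bsub>T\<^esub> v')"
    using c by algebra
  then show ?thesis using a b by (simp add: uv dif_def sq.tens_mult)
qed

text \<open>Since \<open>1 \<otimes> c = c \<otimes> 1 + \<delta>\<close> with \<open>\<delta> = 1 \<otimes> c - c \<otimes> 1\<close>, expanding \<open>\<pi> (1 \<otimes> c)\<close>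
  yields \<open>\<pi> \<delta> = 1 \<otimes> \<pi> c - \<pi> c \<otimes> 1\<close> up to the cross terms of \<open>c \<otimes> 1\<close> and \<open>\<delta>\<close>, of which only
  \<open>- (c \<otimes> 1)^(p-1) \<delta>\<close> survives modulo \<open>I\<^sup>2\<close>.\<close>

lemma cls_q_dif:
  assumes c: "c \<in> Aplus"
  shows "cls (q (dif c)) = cls (dif (\<pi> c) \<oplus>\<^bsub>T\<^esub> tn (c [^] (p - 1)) \<one> \<otimes>\<^bsub>T\<^esub> dif c)"
proof -
  have cA: "c \<in> carrier A" by (rule Aplus.Icarr[OF c])
  have pc: "\<pi> c \<in> carrier A" by (rule pi_closed[OF c])
  define x where "x = tn c \<one>"
  have x: "x \<in> Tplus" using c by (simp add: x_def tens_Tplus)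
  have xT: "x \<in> carrier T" by (rule Tplus.Icarr[OF x])
  have dI: "dif c \<in> I" by (rule dif_I[OF cA])
  note dT = dif_T[OF cA]
  define X where "X = pd_cross p k T x (dif c)"
  define Y where "Y = x [^]\<^bsub>T\<^esub> (p - 1) \<otimes>\<^bsub>T\<^esub> dif c"
  have XY: "X \<in> carrier T" "Y \<in> carrier T" using xT dT by (simp_all add: X_def Y_def)
  have qd: "q (dif c) \<in> carrier T" using q_I[OF dI] by (rule I.Icarr)
  have "tn \<one> c = x \<oplus>\<^bsub>T\<^esub> dif c"
    using cA xT by (simp add: dif_def x_def a_minus_def T.a_lcomm[of "tn c \<one>"] T.r_neg)
  then have "q (x \<oplus>\<^bsub>T\<^esub> dif c) = tn \<one> (\<pi> c)"
    using q_right[OF c] by simp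
  moreover have "q (x \<oplus>\<^bsub>T\<^esub> dif c) = tn (\<pi> c) \<one> \<oplus>\<^bsub>T\<^esub> q (dif c) \<oplus>\<^bsub>T\<^esub> X"
    using q_add[OF x I_Tplus[OF dI]] q_left[OF c] by (simp add: x_def X_def)
  ultimately have "tn \<one> (\<pi> c) = tn (\<pi> c) \<one> \<oplus>\<^bsub>T\<^esub> q (dif c) \<oplus>\<^bsub>T\<^esub> X" by simp
  then have "dif (\<pi> c) = (tn (\<pi> c) \<one> \<oplus>\<^bsub>T\<^esub> q (dif c) \<oplus>\<^bsub>T\<^esub> X) \<ominus>\<^bsub>T\<^esub> tn (\<pi> c) \<one>"
    by (simp add: dif_def)
  moreover have "(u \<oplus>\<^bsub>T\<^esub> q (dif c) \<oplus>\<^bsub>T\<^esub> X) \<ominus>\<^bsub>T\<^esub> u \<oplus>\<^bsub>T\<^esub> Y = q (dif c) \<oplus>\<^bsub>T\<^esub> (X \<oplus>\<^bsub>T\<^esub> Y)"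
    if "u \<in> carrier T" for u
    using that XY qd by algebra
  ultimately have "dif (\<pi> c) \<oplus>\<^bsub>T\<^esub> Y = q (dif c) \<oplus>\<^bsub>T\<^esub> (X \<oplus>\<^bsub>T\<^esub> Y)"
    using pc by simp
  moreover have "X \<oplus>\<^bsub>T\<^esub> Y \<in> I2"
    unfolding X_def Y_def using xT dT dI by (intro Tp.pc_mod_square[OF I2_ideal] I2_mult)
  ultimately have "cls (dif (\<pi> c) \<oplus>\<^bsub>T\<^esub> Y) = cls (q (dif c))"
    using qd by (simp add: cls_add_I2)
  moreover have "Y = tn (c [^] (p - 1)) \<one> \<otimes>\<^bsub>T\<^esub> dif c"
    using cA by (simp add: Y_def x_def tens_pow)
  ultimately show ?thesis by simp
qed

lemma q_smult_left:
  assumes a: "a \<in> carrier A" and x: "x \<in> I"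
  shows "q (tn a \<one> \<otimes>\<^bsub>T\<^esub> x) = tn ((eps a [^]\<^bsub>k\<^esub> p) \<odot> \<one>) \<one> \<otimes>\<^bsub>T\<^esub> q x"
  using assms q_mult_eps[of "tn a \<one>" x] I.Icarr[OF q_I[OF x]]
  by (simp add: teps_tens eps_one I_Tplus sq.tens_smult_left sq.tens_one[symmetric]
      Tp.smult_one_mult)

end

section \<open>I/I^2 as a module over V(A)\<close>

context pd_square_V
begin

sublocale B: beck_module p k A eps \<pi> CN cpi
proof (intro beck_module.intro pd_square_V_axioms C.quot_left_module beck_module_axioms.intro)
  fix X assume "X \<in> carrier CN"
  then obtain x where x: "x \<in> I" "X = cls x" by (auto simp: CN_carrier)
  then show "cpi X \<in> carrier CN" by (auto simp: cpi_cls CN_carrier q_I)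
  show "cpi (a \<odot>\<^bsub>CN\<^esub> X) = (eps a [^]\<^bsub>k\<^esub> p) \<odot> \<one> \<odot>\<^bsub>CN\<^esub> cpi X" if "a \<in> carrier A" for a
    using that x by (simp add: CN_smult cpi_cls q_I I.I_l_closed q_smult_left)
  fix Y assume "Y \<in> carrier CN"
  then obtain y where y: "y \<in> I" "Y = cls y" by (auto simp: CN_carrier)
  show "cpi (X \<oplus>\<^bsub>CN\<^esub> Y) = cpi X \<oplus>\<^bsub>CN\<^esub> cpi Y"
    using x y by (simp add: CN_add cpi_cls q_I cls_q_add)
qed

abbreviation "cot \<equiv> cotangent p k A eps \<pi>"

lemma cot_eq: "cot = beck_V_module A CN cpi"
  by (simp add: cotangent_def)

lemma cot_left_module: "left_module V cot"
  unfolding cot_eq by (rule B.BN_left_module)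

sublocale cot: left_module V cot by (rule cot_left_module)

lemma cot_carrier: "carrier cot = cls ` I"
  by (simp add: cot_eq B.BN_simps CN_carrier)

lemma cot_add: "x \<in> I \<Longrightarrow> y \<in> I \<Longrightarrow> cls x \<oplus>\<^bsub>cot\<^esub> cls y = cls (x \<oplus>\<^bsub>T\<^esub> y)"
  by (simp add: cot_eq B.BN_simps CN_add)

lemma cot_V_of: "a \<in> carrier A \<Longrightarrow> x \<in> I \<Longrightarrow> V_of A a \<odot>\<^bsub>cot\<^esub> cls x = cls (tn a \<one> \<otimes>\<^bsub>T\<^esub> x)"
  by (simp add: cot_eq B.act_V_of CN_carrier CN_smult)

lemma cot_V_P: "x \<in> I \<Longrightarrow> V_P A \<odot>\<^bsub>cot\<^esub> cls x = cls (q x)"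
  by (simp add: cot_eq B.act_V_P CN_carrier cpi_cls)

lemma Der_pD:
  assumes "\<delta> \<in> Der_p p k A eps \<pi> M"
  shows "a \<in> carrier A \<Longrightarrow> \<delta> a \<in> carrier M"
    and "\<delta> \<in> extensional (carrier A)"
    and "a \<in> carrier A \<Longrightarrow> b \<in> carrier A \<Longrightarrow> \<delta> (a \<oplus> b) = \<delta> a \<oplus>\<^bsub>M\<^esub> \<delta> b"
    and "l \<in> carrier k \<Longrightarrow> a \<in> carrier A \<Longrightarrow> \<delta> (l \<odot> a) = V_of A (l \<odot> \<one>) \<odot>\<^bsub>M\<^esub> \<delta> a"
    and "a \<in> carrier A \<Longrightarrow> b \<in> carrier A \<Longrightarrow>
      \<delta> (a \<otimes> b) = (V_of A a \<odot>\<^bsub>M\<^esub> \<delta> b) \<oplus>\<^bsub>M\<^esub> (V_of A b \<odot>\<^bsub>M\<^esub> \<delta> a)"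
    and "a \<in> Aplus \<Longrightarrow>
      \<delta> (\<pi> a) = (V_P A \<odot>\<^bsub>M\<^esub> \<delta> a) \<ominus>\<^bsub>M\<^esub> (V_of A (a [^] (p - 1)) \<odot>\<^bsub>M\<^esub> \<delta> a)"
  using assms by (auto simp: Der_p_def Der_k_def PiE_def)

lemma Der_pI:
  assumes "\<And>a. a \<in> carrier A \<Longrightarrow> \<delta> a \<in> carrier M"
    and "\<delta> \<in> extensional (carrier A)"
    and "\<And>a b. a \<in> carrier A \<Longrightarrow> b \<in> carrier A \<Longrightarrow> \<delta> (a \<oplus> b) = \<delta> a \<oplus>\<^bsub>M\<^esub> \<delta> b"
    and "\<And>l a. l \<in> carrier k \<Longrightarrow> a \<in> carrier A \<Longrightarrow> \<delta> (l \<odot> a) = V_of A (l \<odot> \<one>) \<odot>\<^bsub>M\<^esub> \<delta> a"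
    and "\<And>a b. a \<in> carrier A \<Longrightarrow> b \<in> carrier A \<Longrightarrow>
      \<delta> (a \<otimes> b) = (V_of A a \<odot>\<^bsub>M\<^esub> \<delta> b) \<oplus>\<^bsub>M\<^esub> (V_of A b \<odot>\<^bsub>M\<^esub> \<delta> a)"
    and "\<And>a. a \<in> Aplus \<Longrightarrow>
      \<delta> (\<pi> a) = (V_P A \<odot>\<^bsub>M\<^esub> \<delta> a) \<ominus>\<^bsub>M\<^esub> (V_of A (a [^] (p - 1)) \<odot>\<^bsub>M\<^esub> \<delta> a)"
  shows "\<delta> \<in> Der_p p k A eps \<pi> M"
  using assms by (auto simp: Der_p_def Der_k_def PiE_def)

abbreviation "cd \<equiv> cotangent_d k A"

lemma cd_closed: "a \<in> carrier A \<Longrightarrow> cd a \<in> carrier cot"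
  by (auto simp: cotangent_d_eq cot_carrier dif_I)

text \<open>The error term in the Leibniz rule lies in I^2, and the condition on \<pi> is
  \<open>cls_q_dif\<close> with the term containing c^(p-1) moved to the other side.\<close>

lemma cd_Der: "(\<lambda>a\<in>carrier A. cd a) \<in> Der_p p k A eps \<pi> cot"
proof (rule Der_pI)
  fix a assume a: "a \<in> carrier A"
  show "(\<lambda>a\<in>carrier A. cd a) a \<in> carrier cot" using a by (simp add: cd_closed)
  show "(\<lambda>a\<in>carrier A. cd a) (l \<odot> a) = V_of A (l \<odot> \<one>) \<odot>\<^bsub>cot\<^esub> (\<lambda>a\<in>carrier A. cd a) a"
    if "l \<in> carrier k" for l
    using that a
    by (simp add: cotangent_d_eq cot_V_of dif_I dif_smult sq.tens_smult_left sq.tens_one[symmetric]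
        Tp.smult_one_mult)
  fix b assume b: "b \<in> carrier A"
  show "(\<lambda>a\<in>carrier A. cd a) (a \<oplus> b) = (\<lambda>a\<in>carrier A. cd a) a \<oplus>\<^bsub>cot\<^esub> (\<lambda>a\<in>carrier A. cd a) b"
    using a b by (simp add: cotangent_d_eq cot_add dif_I dif_add)
  have "cls (dif (a \<otimes> b)) = cls (tn a \<one> \<otimes>\<^bsub>T\<^esub> dif b \<oplus>\<^bsub>T\<^esub> tn b \<one> \<otimes>\<^bsub>T\<^esub> dif a)"
    unfolding dif_mult[OF a b] using a b by (intro cls_add_I2 I2_mult dif_I) auto
  then show "(\<lambda>a\<in>carrier A. cd a) (a \<otimes> b) =
    (V_of A a \<odot>\<^bsub>cot\<^esub> (\<lambda>a\<in>carrier A. cd a) b) \<oplus>\<^bsub>cot\<^esub> (V_of A b \<odot>\<^bsub>cot\<^esub> (\<lambda>a\<in>carrier A. cd a) a)"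
    using a b by (simp add: cotangent_d_eq cot_V_of dif_I cot_add I.I_l_closed)
next
  fix c assume c: "c \<in> Aplus"
  have cA: "c \<in> carrier A" by (rule Aplus.Icarr[OF c])
  note dI = dif_I[OF cA] dif_I[OF pi_closed[OF c]]
  let ?y = "tn (c [^] (p - 1)) \<one> \<otimes>\<^bsub>T\<^esub> dif c"
  have y: "?y \<in> I" using cA dI by (simp add: I.I_l_closed)
  have "V_P A \<odot>\<^bsub>cot\<^esub> cd c = cd (\<pi> c) \<oplus>\<^bsub>cot\<^esub> cls ?y"
    using c cA dI y by (simp add: cotangent_d_eq cot_V_P cls_q_dif cot_add)
  moreover have "V_of A (c [^] (p - 1)) \<odot>\<^bsub>cot\<^esub> cd c = cls ?y"
    using cA dI by (simp add: cotangent_d_eq cot_V_of)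
  moreover have "cls ?y \<in> carrier cot" using y by (simp add: cot_carrier)
  moreover have "cd (\<pi> c) \<in> carrier cot" using c by (intro cd_closed pi_closed)
  ultimately show "(\<lambda>a\<in>carrier A. cd a) (\<pi> c) = (V_P A \<odot>\<^bsub>cot\<^esub> (\<lambda>a\<in>carrier A. cd a) c) \<ominus>\<^bsub>cot\<^esub>
      (V_of A (c [^] (p - 1)) \<odot>\<^bsub>cot\<^esub> (\<lambda>a\<in>carrier A. cd a) c)"
    using cA pi_closed[OF c] by (simp add: a_minus_def cot.M.a_assoc cot.M.r_neg)
qed simp

text \<open>The classes \<open>cd a\<close> generate I/I^2, already over A.\<close>

lemma cot_linear_map_eq:
  assumes f: "linear_map V cot N f" and g: "linear_map V cot N g"
    and eq: "\<And>a. a \<in> carrier A \<Longrightarrow> f (cd a) = g (cd a)" and X: "X \<in> carrier cot"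
  shows "f X = g X"
proof -
  obtain x where x: "x \<in> I" "X = cls x" using X by (auto simp: cot_carrier)
  have "f (cls x) = g (cls x)"
    using x(1)
  proof (induction x rule: I_induct)
    case (dif a b)
    then have "cls (tn a \<one> \<otimes>\<^bsub>T\<^esub> dif b) = V_of A a \<odot>\<^bsub>cot\<^esub> cd b"
      by (simp add: cotangent_d_eq cot_V_of dif_I)
    then show ?case
      using dif eq by (simp add: linear_map_smult[OF f] linear_map_smult[OF g] cd_closed)
  next
    case (add x y)
    then have "cls (x \<oplus>\<^bsub>T\<^esub> y) = cls x \<oplus>\<^bsub>cot\<^esub> cls y" "cls x \<in> carrier cot" "cls y \<in> carrier cot"
      by (simp_all add: cot_add cot_carrier)
    then show ?case
      using add by (simp add: linear_map_add[OF f] linear_map_add[OF g])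
  qed
  with x show ?thesis by simp
qed

end

section \<open>Derivations\<close>

text \<open>M is a module over V(A), but the universal property of A \<otimes> A is over k and that
  of the quotient I/I^2 over A; restriction along k and A into V(A) supplies these
  structures.\<close>

definition restrict_scalars :: "('r \<Rightarrow> 's) \<Rightarrow> ('s, 'm, 'd) module_scheme \<Rightarrow> ('r, 'm) module"
  where "restrict_scalars h M = \<lparr>
    carrier = carrier M, monoid.mult = monoid.mult M, one = one M,
    ring.zero = zero M, ring.add = add M, smult = (\<lambda>r x. h r \<odot>\<^bsub>M\<^esub> x)\<rparr>"

lemma restrict_scalars_simps [simp]:
  "carrier (restrict_scalars h M) = carrier M"
  "zero (restrict_scalars h M) = zero M"
  "add (restrict_scalars h M) = add M"
  "r \<odot>\<^bsub>restrict_scalars h M\<^esub> x = h r \<odot>\<^bsub>M\<^esub> x"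
  by (simp_all add: restrict_scalars_def)

lemma restrict_scalars_left_module:
  assumes "ring R" "h \<in> ring_hom R S" "left_module S M"
  shows "left_module R (restrict_scalars h M)"
proof -
  interpret M: left_module S M by fact
  show ?thesis
  proof (rule left_moduleI[OF assms(1)])
    show "abelian_group (restrict_scalars h M)"
      by (rule abelian_group_cong[OF M.M.abelian_group_axioms]) simp_all
  qed (use assms(2) in \<open>simp_all add: M.smult_closed M.smult_l_distr M.smult_r_distr M.smult_assoc1
      M.smult_one ring_hom_closed ring_hom_add ring_hom_mult ring_hom_one\<close>)
qed

context pd_square_V
begin

lemma k_V_ring_hom: "(\<lambda>l. V_of A (l \<odot> \<one>)) \<in> ring_hom k V"
proof (rule ring_hom_memI)
  fix l m assume l: "l \<in> carrier k" and m: "m \<in> carrier k"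
  have "(l \<odot> \<one>) \<otimes> (m \<odot> \<one>) = (l \<otimes>\<^bsub>k\<^esub> m) \<odot> \<one>"
    using l m by (simp add: Ap.smult_one_mult pd.smult_assoc1)
  then show "V_of A ((l \<otimes>\<^bsub>k\<^esub> m) \<odot> \<one>) = V_of A (l \<odot> \<one>) \<otimes>\<^bsub>V\<^esub> V_of A (m \<odot> \<one>)"
    using l m by (simp add: V_of_mult[symmetric])
  show "V_of A ((l \<oplus>\<^bsub>k\<^esub> m) \<odot> \<one>) = V_of A (l \<odot> \<one>) \<oplus>\<^bsub>V\<^esub> V_of A (m \<odot> \<one>)"
    using l m by (simp add: pd.smult_l_distr V_of_add)
qed (simp_all add: V_of_one)

lemma Der_p_comp:
  assumes f: "linear_map V N M f" and N: "left_module V N" and M: "left_module V M"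
    and \<delta>: "\<delta> \<in> Der_p p k A eps \<pi> N"
  shows "(\<lambda>a\<in>carrier A. f (\<delta> a)) \<in> Der_p p k A eps \<pi> M"
proof -
  interpret N: left_module V N by fact
  interpret M: left_module V M by fact
  interpret h: abelian_group_hom N M f
    by (rule abelian_group_hom_linear_map[OF N.M.abelian_group_axioms M.M.abelian_group_axioms f])
  note d = Der_pD[OF \<delta>]
  show ?thesis
  proof (rule Der_pI)
    fix a assume a: "a \<in> Aplus"
    have aA: "a \<in> carrier A" by (rule Aplus.Icarr[OF a])
    then show "(\<lambda>a\<in>carrier A. f (\<delta> a)) (\<pi> a) = (V_P A \<odot>\<^bsub>M\<^esub> (\<lambda>a\<in>carrier A. f (\<delta> a)) a) \<ominus>\<^bsub>M\<^esub>
      (V_of A (a [^] (p - 1)) \<odot>\<^bsub>M\<^esub> (\<lambda>a\<in>carrier A. f (\<delta> a)) a)"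
      using a pi_closed[OF a] d(1)[OF aA]
      by (simp add: d(6) a_minus_def N.smult_closed linear_map_smult[OF f])
  qed (simp_all add: d(1,3-5) linear_map_smult[OF f] N.smult_closed)
qed

text \<open>Used to see that the map from a \<otimes> b to a \<delta>(b) vanishes on b \<otimes> 1,
  and that constants have zero differential.\<close>

lemma Der_p_one:
  assumes M: "left_module V M" and \<delta>: "\<delta> \<in> Der_p p k A eps \<pi> M"
  shows "\<delta> \<one> = \<zero>\<^bsub>M\<^esub>"
proof -
  interpret M: left_module V M by fact
  note d = Der_pD[OF \<delta>]
  have c: "\<delta> \<one> \<in> carrier M" by (simp add: d(1))
  have "\<delta> \<one> = \<delta> \<one> \<oplus>\<^bsub>M\<^esub> \<delta> \<one>"
    using d(5)[of "\<one>" "\<one>"] c by (simp add: V_of_one M.smult_one)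
  then show ?thesis using c M.M.add.r_cancel_one'[of "\<delta> \<one>" "\<delta> \<one>"] by simp
qed

text \<open>The linear map \<open>a \<otimes> b \<mapsto> a \<delta>(b)\<close> restricts to \<open>I\<close> and kills \<open>I\<^sup>2\<close>.\<close>

lemma Der_p_lift:
  assumes M: "left_module V M" and \<delta>: "\<delta> \<in> Der_p p k A eps \<pi> M"
  obtains f where "linear_map V cot M f" "\<And>a. a \<in> carrier A \<Longrightarrow> f (cd a) = \<delta> a"
proof -
  interpret M: left_module V M by fact
  note d = Der_pD[OF \<delta>]
  define Mk where "Mk = restrict_scalars (\<lambda>l. V_of A (l \<odot> \<one>)) M"
  define MA where "MA = restrict_scalars (V_of A) M"
  have Mk: "left_module k Mk"
    unfolding Mk_def by (rule restrict_scalars_left_module[OF K.ring_axioms k_V_ring_hom M])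
  have MA: "left_module A MA"
    unfolding MA_def by (rule restrict_scalars_left_module[OF A.ring_axioms V_of_ring_hom M])
  have ac: "V_of A a \<odot>\<^bsub>M\<^esub> (V_of A b \<odot>\<^bsub>M\<^esub> x) = V_of A (a \<otimes> b) \<odot>\<^bsub>M\<^esub> x"
    if "a \<in> carrier A" "b \<in> carrier A" "x \<in> carrier M" for a b x
    using that by (simp add: V_of_mult M.smult_assoc1)
  have sm: "(l \<odot> \<one>) \<otimes> a = l \<odot> a" "a \<otimes> (l \<odot> \<one>) = l \<odot> a"
    if "l \<in> carrier k" "a \<in> carrier A" for l a
    using that by (simp_all add: Ap.smult_one_mult A.m_comm[of a])
  have Vc: "V_of A a \<odot>\<^bsub>M\<^esub> x \<in> carrier M" if "a \<in> carrier A" "x \<in> carrier M" for a x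
    using that by (simp add: M.smult_closed)
  let ?h = "\<lambda>z. V_of A (fst z) \<odot>\<^bsub>M\<^esub> \<delta> (snd z)"
  define \<phi> where "\<phi> = sq.tensor_lift Mk ?h"
  have l1: "linear_map k A Mk (\<lambda>a. ?h (a, b))" if "b \<in> carrier A" for b
    using that d(1)[of b]
    by (intro linear_mapI) (simp_all add: Mk_def Vc V_of_add M.smult_l_distr ac sm)
  have l2: "linear_map k A Mk (\<lambda>b. ?h (a, b))" if "a \<in> carrier A" for a
    using that
    by (intro linear_mapI) (simp_all add: Mk_def Vc d(1,3,4) M.smult_r_distr ac sm)
  have lin: "linear_map k T Mk \<phi>"
    unfolding \<phi>_def by (rule sq.tensor_lift_linear_map[OF Mk l1 l2])
  have \<phi>_tens: "\<phi> (tn a b) = V_of A a \<odot>\<^bsub>M\<^esub> \<delta> b" if "a \<in> carrier A" "b \<in> carrier A" for a b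
    unfolding \<phi>_def using that by (subst sq.tensor_lift_tens[OF Mk l1 l2]) auto
  have \<phi>_closed: "\<phi> x \<in> carrier M" if "x \<in> carrier T" for x
    using linear_map_closed[OF lin that] by (simp add: Mk_def)
  have \<phi>_add: "\<phi> (x \<oplus>\<^bsub>T\<^esub> y) = \<phi> x \<oplus>\<^bsub>M\<^esub> \<phi> y" if "x \<in> carrier T" "y \<in> carrier T" for x y
    using linear_map_add[OF lin that] by (simp add: Mk_def)
  \<comment> \<open>\<open>\<phi>\<close> is a derivation of A \<otimes> A into M along \<mu>. On I,
    where \<mu> is zero, it is therefore linear along \<mu>, and it kills products of two elements
    of I.\<close>
  have \<phi>_mult: "\<phi> (x \<otimes>\<^bsub>T\<^esub> y) = (V_of A (\<mu> x) \<odot>\<^bsub>M\<^esub> \<phi> y) \<oplus>\<^bsub>M\<^esub> (V_of A (\<mu> y) \<odot>\<^bsub>M\<^esub> \<phi> x)"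
    if x: "x \<in> carrier T" and y: "y \<in> carrier T" for x y
    using x
  proof (induction x rule: sq.T_induct)
    case (tens a b)
    show ?case
      using y
    proof (induction y rule: sq.T_induct)
      case (tens a' b')
      have "V_of A (a \<otimes> a') \<odot>\<^bsub>M\<^esub> \<delta> (b \<otimes> b') =
        (V_of A (a \<otimes> a' \<otimes> b) \<odot>\<^bsub>M\<^esub> \<delta> b') \<oplus>\<^bsub>M\<^esub> (V_of A (a \<otimes> a' \<otimes> b') \<odot>\<^bsub>M\<^esub> \<delta> b)"
        using \<open>a \<in> carrier A\<close> \<open>b \<in> carrier A\<close> tens by (simp add: d(1,5) M.smult_r_distr Vc ac)
      then show ?case
        using \<open>a \<in> carrier A\<close> \<open>b \<in> carrier A\<close> tens
        by (simp add: sq.tens_mult \<phi>_tens sq.mult_map_tens ac d(1) A.m_ac)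
    next
      case (add y y')
      have t: "tn a b \<in> carrier T" using tens by simp
      show ?case
        using add t
        by (simp add: T.r_distr \<phi>_add mu_add V_of_add M.smult_l_distr M.smult_r_distr \<phi>_closed Vc M.M.a_ac
            del: sq.tens_closed)
    qed
  next
    case (add x x')
    then show ?case
      using y
      by (simp add: T.l_distr \<phi>_add mu_add V_of_add M.smult_l_distr M.smult_r_distr \<phi>_closed Vc M.M.a_ac)
  qed
  have V0: "V_of A \<zero> \<odot>\<^bsub>M\<^esub> x = \<zero>\<^bsub>M\<^esub>" if "x \<in> carrier M" for x
    using that left_module.lm_smult_l_null[OF MA, of x] by (simp add: MA_def)
  have \<phi>_I: "\<phi> (t \<otimes>\<^bsub>T\<^esub> x) = V_of A (\<mu> t) \<odot>\<^bsub>M\<^esub> \<phi> x" if "t \<in> carrier T" "x \<in> I" for t x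
    using that by (simp add: \<phi>_mult I_iff V0 \<phi>_closed Vc)
  have \<phi>_I2: "\<phi> x = \<zero>\<^bsub>M\<^esub>" if "x \<in> I2" for x
    using that
  proof (induction x rule: I2_induct)
    case (prod x y)
    then show ?case by (simp add: \<phi>_mult I_iff V0 \<phi>_closed)
  next
    case (sum x y)
    then show ?case by (simp add: \<phi>_add I2.Icarr)
  qed
  \<comment> \<open>The p-map on I is controlled only modulo I^2; through this, identities between
    classes can be fed into \<open>\<phi>\<close>.\<close>
  have \<phi>_cls: "\<phi> x = \<phi> y" if "x \<in> I" "y \<in> I" "cls x = cls y" for x y
  proof -
    have xy: "x \<in> carrier T" "y \<in> carrier T" using that by (auto simp: I_iff)
    define z where "z = x \<ominus>\<^bsub>T\<^esub> y"
    have z: "z \<in> I2" using that xy by (simp add: z_def T_coset_eq)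
    have "x = y \<oplus>\<^bsub>T\<^esub> z" using xy unfolding z_def by algebra
    then show ?thesis using z xy by (simp add: \<phi>_add I2.Icarr \<phi>_I2 \<phi>_closed)
  qed
  have \<phi>_dif: "\<phi> (dif b) = \<delta> b" if b: "b \<in> carrier A" for b
  proof -
    have dT: "dif b \<in> carrier T" using b by simp
    have "tn \<one> b = dif b \<oplus>\<^bsub>T\<^esub> tn b \<one>"
      using b by (simp add: dif_def a_minus_def T.a_assoc T.l_neg)
    then have "\<phi> (tn \<one> b) = \<phi> (dif b) \<oplus>\<^bsub>M\<^esub> \<phi> (tn b \<one>)"
      using b dT by (simp add: \<phi>_add)
    then show ?thesis
      using b dT
      by (simp add: \<phi>_tens Der_p_one[OF M \<delta>] V_of_one M.smult_one d(1) M.lm_smult_r_null \<phi>_closed)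
  qed
  have linD: "linear_map A D MA \<phi>"
    by (rule linear_mapI)
       (simp_all add: D_simps MA_def \<phi>_closed \<phi>_add \<phi>_I I.Icarr sq.mult_map_tens)
  define f where "f = (\<lambda>Y. the_elem (\<phi> ` Y))"
  have f_cls: "f (cls x) = \<phi> x" if "x \<in> I" for x
    using C.quot_lift_eq[OF MA linD] \<phi>_I2 that by (simp add: f_def MA_def D_simps cls_D)
  \<comment> \<open>Modulo I^2 both sides are additive on I, so (a \<otimes> 1) times a difference
    of b is enough. Replacing b by \<open>pr b\<close>, where \<pi> is available, changes neither
    the difference nor \<delta>(b).\<close>
  have fP: "\<phi> (q x) = V_P A \<odot>\<^bsub>M\<^esub> \<phi> x" if "x \<in> I" for x
    using that
  proof (induction x rule: I_induct)
    case (dif a b)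
    note ab = this
    have c: "pr b \<in> Aplus" "pr b \<in> carrier A" "\<pi> (pr b) \<in> carrier A"
      using ab pr_Aplus[of b] by (auto simp: pi_closed)
    have db: "\<delta> b = \<delta> (pr b)" using \<phi>_dif[of b] \<phi>_dif[of "pr b"] dif_pr[of b] ab c by simp
    have dc: "\<delta> (pr b) \<in> carrier M" using c by (simp add: d(1))
    define y where "y = tn (pr b [^] (p - 1)) \<one> \<otimes>\<^bsub>T\<^esub> local.dif (pr b)"
    have y: "y \<in> I" unfolding y_def using c by (intro I.I_l_closed dif_I) auto
    have dI: "local.dif (pr b) \<in> I" "local.dif (\<pi> (pr b)) \<in> I" using c by (simp_all add: dif_I)
    have "\<phi> (q (local.dif (pr b))) = \<phi> (local.dif (\<pi> (pr b)) \<oplus>\<^bsub>T\<^esub> y)"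
      using cls_q_dif[OF c(1)] y dI unfolding y_def[symmetric]
      by (intro \<phi>_cls q_I I.a_closed)
    also have "\<dots> = \<delta> (\<pi> (pr b)) \<oplus>\<^bsub>M\<^esub> (V_of A (pr b [^] (p - 1)) \<odot>\<^bsub>M\<^esub> \<delta> (pr b))"
      using y dI c unfolding y_def by (simp add: \<phi>_add I.Icarr \<phi>_dif \<phi>_I sq.mult_map_tens)
    \<comment> \<open>The Beck axiom for \<delta> at \<open>pr b\<close> cancels the term with the
      power p - 1.\<close>
    also have "\<dots> = V_P A \<odot>\<^bsub>M\<^esub> \<delta> (pr b)"
      using c dc by (simp add: d(6) a_minus_def M.M.a_assoc M.M.l_neg Vc M.smult_closed)
    finally have qd: "\<phi> (q (local.dif (pr b))) = V_P A \<odot>\<^bsub>M\<^esub> \<delta> (pr b)" .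
    let ?e = "(eps a [^]\<^bsub>k\<^esub> p) \<odot> \<one>"
    have "\<phi> (q (tn a \<one> \<otimes>\<^bsub>T\<^esub> local.dif b)) = \<phi> (tn ?e \<one> \<otimes>\<^bsub>T\<^esub> q (local.dif (pr b)))"
      using ab dI dif_pr[of b] by (simp add: q_smult_left)
    also have "\<dots> = V_of A ?e \<odot>\<^bsub>M\<^esub> (V_P A \<odot>\<^bsub>M\<^esub> \<delta> (pr b))"
      using ab dI by (subst \<phi>_I) (simp_all add: q_I sq.mult_map_tens qd)
    \<comment> \<open>The twist \<epsilon>(a)^p is exactly what moving a past P produces in
      V(A).\<close>
    also have "\<dots> = (V_P A \<otimes>\<^bsub>V\<^esub> V_of A a) \<odot>\<^bsub>M\<^esub> \<delta> (pr b)"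
      using ab dc by (simp add: V_P_V_of M.smult_assoc1)
    also have "\<dots> = V_P A \<odot>\<^bsub>M\<^esub> \<phi> (tn a \<one> \<otimes>\<^bsub>T\<^esub> local.dif b)"
      using ab dc db by (simp add: M.smult_assoc1 \<phi>_I dif_I sq.mult_map_tens \<phi>_dif)
    finally show ?case .
  next
    case (add x y)
    have c: "x \<in> carrier T" "y \<in> carrier T" "q x \<in> I" "q y \<in> I"
      using add by (auto simp: I.Icarr q_I)
    have "\<phi> (q (x \<oplus>\<^bsub>T\<^esub> y)) = \<phi> (q x \<oplus>\<^bsub>T\<^esub> q y)"
      using add c by (intro \<phi>_cls cls_q_add q_I I.a_closed)
    then show ?case
      using add c by (simp add: \<phi>_add I.Icarr M.smult_r_distr \<phi>_closed)
  qed
  have "linear_map V cot M f"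
  proof (rule V_linear_mapI[OF cot_left_module M])
    fix X assume "X \<in> carrier cot"
    then obtain x where x: "x \<in> I" "X = cls x" by (auto simp: cot_carrier)
    show "f X \<in> carrier M" using x by (simp add: f_cls \<phi>_closed I.Icarr)
    show "f (V_of A a \<odot>\<^bsub>cot\<^esub> X) = V_of A a \<odot>\<^bsub>M\<^esub> f X" if "a \<in> carrier A" for a
      using x that by (simp add: cot_V_of f_cls I.I_l_closed \<phi>_I sq.mult_map_tens)
    show "f (V_P A \<odot>\<^bsub>cot\<^esub> X) = V_P A \<odot>\<^bsub>M\<^esub> f X"
      using x by (simp add: cot_V_P f_cls q_I fP)
    fix Y assume "Y \<in> carrier cot"
    then obtain y where y: "y \<in> I" "Y = cls y" by (auto simp: cot_carrier)
    show "f (X \<oplus>\<^bsub>cot\<^esub> Y) = f X \<oplus>\<^bsub>M\<^esub> f Y"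
      using x y by (simp add: cot_add f_cls \<phi>_add I.Icarr)
  qed
  moreover have "f (cd a) = \<delta> a" if "a \<in> carrier A" for a
    using that by (simp add: cotangent_d_eq f_cls dif_I \<phi>_dif)
  ultimately show thesis by (rule that)
qed

text \<open>Injective because the classes \<open>cd a\<close> generate I/I^2, surjective by lifting
  derivations.\<close>

lemma Hom_Der_bij:
  assumes M: "left_module V M"
  shows "bij_betw (\<lambda>f. \<lambda>a\<in>carrier A. f (cd a)) (module_Hom V cot M) (Der_p p k A eps \<pi> M)"
proof (rule bij_betwI')
  fix f g assume f: "f \<in> module_Hom V cot M" and g: "g \<in> module_Hom V cot M"
  show "(\<lambda>a\<in>carrier A. f (cd a)) = (\<lambda>a\<in>carrier A. g (cd a)) \<longleftrightarrow> f = g"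
  proof
    assume eq: "(\<lambda>a\<in>carrier A. f (cd a)) = (\<lambda>a\<in>carrier A. g (cd a))"
    have eq': "f (cd a) = g (cd a)" if "a \<in> carrier A" for a
      using fun_cong[OF eq, of a] that by simp
    have lin: "linear_map V cot M f" "linear_map V cot M g"
      using f g by (simp_all add: module_Hom_iff)
    have "f X = g X" if "X \<in> carrier cot" for X
      by (rule cot_linear_map_eq[OF lin eq' that])
    then show "f = g"
      using f g unfolding module_Hom_iff by (intro extensionalityI[of f "carrier cot"]) auto
  qed simp
next
  fix f assume "f \<in> module_Hom V cot M"
  then have "linear_map V cot M f" by (simp add: module_Hom_iff)
  from Der_p_comp[OF this cot_left_module M cd_Der]
  show "(\<lambda>a\<in>carrier A. f (cd a)) \<in> Der_p p k A eps \<pi> M"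
    by (simp cong: restrict_cong)
next
  fix \<delta> assume \<delta>: "\<delta> \<in> Der_p p k A eps \<pi> M"
  obtain f where f: "linear_map V cot M f" "\<And>a. a \<in> carrier A \<Longrightarrow> f (cd a) = \<delta> a"
    by (rule Der_p_lift[OF M \<delta>]) blast
  \<comment> \<open>Cut down to the carrier, as elements of \<open>module_Hom\<close> are
    extensional.\<close>
  let ?f = "\<lambda>X\<in>carrier cot. f X"
  have "linear_map V cot M ?f"
    using f(1) cot.smult_closed by (auto simp: linear_map_def)
  then have "?f \<in> module_Hom V cot M" by (simp add: module_Hom_iff)
  moreover have "\<delta> = (\<lambda>a\<in>carrier A. ?f (cd a))"
    using f(2) Der_pD(2)[OF \<delta>]
    by (intro extensionalityI[of \<delta> "carrier A"]) (auto simp: cd_closed)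
  ultimately show "\<exists>f\<in>module_Hom V cot M. \<delta> = (\<lambda>a\<in>carrier A. f (cd a))" by blast
qed

section \<open>The presented module of differentials and its comparison with I/I^2\<close>

abbreviation "FV \<equiv> free_module V (carrier A)"
abbreviation "rels \<equiv> Omega_rels p k A eps \<pi>"
abbreviation "NR \<equiv> gen_submodule V FV rels"
abbreviation "Om \<equiv> Omega_p p k A eps \<pi>"

sublocale FV: left_module V FV
  by (rule free_module_left_module[OF V.ring_axioms])

lemma Om_eq: "Om = quot_module FV NR"
  by (simp add: Omega_p_def Let_def)

lemma gen_FV [simp]: "a \<in> carrier A \<Longrightarrow> free_gen V a \<in> carrier FV"
  by (rule free_gen_closed[OF V.ring_axioms])

lemma Omega_rels_cases [consumes 1, case_names const linear mult pi]:
  assumes "r \<in> rels"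
  obtains l where "l \<in> carrier k" "r = free_gen V (l \<odot> \<one>)"
    | l m a b where "l \<in> carrier k" "m \<in> carrier k" "a \<in> carrier A" "b \<in> carrier A"
      "r = free_gen V ((l \<odot> a) \<oplus> (m \<odot> b)) \<ominus>\<^bsub>FV\<^esub>
        ((V_of A (l \<odot> \<one>) \<odot>\<^bsub>FV\<^esub> free_gen V a) \<oplus>\<^bsub>FV\<^esub> (V_of A (m \<odot> \<one>) \<odot>\<^bsub>FV\<^esub> free_gen V b))"
    | a b where "a \<in> carrier A" "b \<in> carrier A"
      "r = free_gen V (a \<otimes> b) \<ominus>\<^bsub>FV\<^esub>
        ((V_of A a \<odot>\<^bsub>FV\<^esub> free_gen V b) \<oplus>\<^bsub>FV\<^esub> (V_of A b \<odot>\<^bsub>FV\<^esub> free_gen V a))"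
    | c where "c \<in> Aplus"
      "r = free_gen V (\<pi> c) \<ominus>\<^bsub>FV\<^esub>
        ((V_P A \<odot>\<^bsub>FV\<^esub> free_gen V c) \<ominus>\<^bsub>FV\<^esub> (V_of A (c [^] (p - 1)) \<odot>\<^bsub>FV\<^esub> free_gen V c))"
proof -
  note goals = that
  show thesis
    using assms unfolding Omega_rels_def Let_def
    by (elim UnE CollectE exE conjE) (rule goals; assumption)+
qed

lemma Omega_relsI:
  shows "l \<in> carrier k \<Longrightarrow> free_gen V (l \<odot> \<one>) \<in> rels"
    and "l \<in> carrier k \<Longrightarrow> m \<in> carrier k \<Longrightarrow> a \<in> carrier A \<Longrightarrow> b \<in> carrier A \<Longrightarrow>
      free_gen V ((l \<odot> a) \<oplus> (m \<odot> b)) \<ominus>\<^bsub>FV\<^esub>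
        ((V_of A (l \<odot> \<one>) \<odot>\<^bsub>FV\<^esub> free_gen V a) \<oplus>\<^bsub>FV\<^esub> (V_of A (m \<odot> \<one>) \<odot>\<^bsub>FV\<^esub> free_gen V b)) \<in> rels"
    and "a \<in> carrier A \<Longrightarrow> b \<in> carrier A \<Longrightarrow> free_gen V (a \<otimes> b) \<ominus>\<^bsub>FV\<^esub>
        ((V_of A a \<odot>\<^bsub>FV\<^esub> free_gen V b) \<oplus>\<^bsub>FV\<^esub> (V_of A b \<odot>\<^bsub>FV\<^esub> free_gen V a)) \<in> rels"
    and "c \<in> Aplus \<Longrightarrow> free_gen V (\<pi> c) \<ominus>\<^bsub>FV\<^esub>
        ((V_P A \<odot>\<^bsub>FV\<^esub> free_gen V c) \<ominus>\<^bsub>FV\<^esub> (V_of A (c [^] (p - 1)) \<odot>\<^bsub>FV\<^esub> free_gen V c)) \<in> rels"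
  unfolding Omega_rels_def Let_def by blast+

lemma Omega_rels_closed: "rels \<subseteq> carrier FV"
proof
  fix r assume "r \<in> rels"
  then show "r \<in> carrier FV"
    by (cases rule: Omega_rels_cases)
       (auto simp: pi_closed Aplus.Icarr intro!: FV.M.minus_closed FV.M.a_closed FV.smult_closed gen_FV)
qed

sublocale Om: quot_left_module V FV NR
  by (simp add: quot_left_module_def quot_left_module_axioms_def FV.left_module_axioms
      FV.gen_submodule_submodule[OF Omega_rels_closed])

lemma Om_left_module: "left_module V Om"
  unfolding Om_eq by (rule Om.quot_left_module)

definition "om a = NR +>\<^bsub>FV\<^esub> free_gen V a"

lemma om_closed: "a \<in> carrier A \<Longrightarrow> om a \<in> carrier Om"
  by (simp add: om_def Om_eq Om.quot_carrier)

lemma Om_rel: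
  assumes "x \<ominus>\<^bsub>FV\<^esub> y \<in> rels" "x \<in> carrier FV" "y \<in> carrier FV"
  shows "NR +>\<^bsub>FV\<^esub> x = NR +>\<^bsub>FV\<^esub> y"
  using assms FV.gen_submodule_incl[of rels] by (subst Om.quot_eq) auto

lemma om_linear:
  assumes "l \<in> carrier k" "m \<in> carrier k" "a \<in> carrier A" "b \<in> carrier A"
  shows "om ((l \<odot> a) \<oplus> (m \<odot> b)) =
    (V_of A (l \<odot> \<one>) \<odot>\<^bsub>Om\<^esub> om a) \<oplus>\<^bsub>Om\<^esub> (V_of A (m \<odot> \<one>) \<odot>\<^bsub>Om\<^esub> om b)"
  using assms Om_rel[OF Omega_relsI(2)[OF assms]]
  by (simp add: om_def Om_eq Om.quot_smult Om.quot_add FV.smult_closed)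

text \<open>The axioms of a Beck derivation are the defining relations, read in the
  quotient.\<close>

lemma om_Der: "(\<lambda>a\<in>carrier A. om a) \<in> Der_p p k A eps \<pi> Om"
proof (rule Der_pI)
  interpret Omm: left_module V Om by (rule Om_left_module)
  fix a assume a: "a \<in> carrier A"
  show "(\<lambda>a\<in>carrier A. om a) a \<in> carrier Om" using a by (simp add: om_closed)
  show "(\<lambda>a\<in>carrier A. om a) (l \<odot> a) = V_of A (l \<odot> \<one>) \<odot>\<^bsub>Om\<^esub> (\<lambda>a\<in>carrier A. om a) a"
    if "l \<in> carrier k" for l
  proof -
    \<comment> \<open>Homogeneity is the case m = 0 of the relation for l a + m b.\<close>
    have "V_of A \<zero> = \<zero>\<^bsub>V\<^esub>" by (simp add: V_of_eq V_zero fun_eq_iff)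
    then show ?thesis
      using that a om_linear[of l "\<zero>\<^bsub>k\<^esub>" a a]
      by (simp add: Omm.lm_smult_l_null om_closed Omm.smult_closed)
  qed
  fix b assume b: "b \<in> carrier A"
  show "(\<lambda>a\<in>carrier A. om a) (a \<oplus> b) = (\<lambda>a\<in>carrier A. om a) a \<oplus>\<^bsub>Om\<^esub> (\<lambda>a\<in>carrier A. om a) b"
    using a b om_linear[of "\<one>\<^bsub>k\<^esub>" "\<one>\<^bsub>k\<^esub>" a b] by (simp add: V_of_one Omm.smult_one om_closed)
  have "om (a \<otimes> b) = (V_of A a \<odot>\<^bsub>Om\<^esub> om b) \<oplus>\<^bsub>Om\<^esub> (V_of A b \<odot>\<^bsub>Om\<^esub> om a)"
    using a b Om_rel[OF Omega_relsI(3)[OF a b]]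
    by (simp add: om_def Om_eq Om.quot_smult Om.quot_add FV.smult_closed)
  then show "(\<lambda>a\<in>carrier A. om a) (a \<otimes> b) =
    (V_of A a \<odot>\<^bsub>Om\<^esub> (\<lambda>a\<in>carrier A. om a) b) \<oplus>\<^bsub>Om\<^esub> (V_of A b \<odot>\<^bsub>Om\<^esub> (\<lambda>a\<in>carrier A. om a) a)"
    using a b by simp
next
  interpret Omm: left_module V Om by (rule Om_left_module)
  interpret h: abelian_group_hom FV Om "\<lambda>x. NR +>\<^bsub>FV\<^esub> x"
    using Om.quot_linear_map unfolding Om_eq[symmetric]
    by (intro abelian_group_hom_linear_map FV.M.abelian_group_axioms Omm.M.abelian_group_axioms)
  have sm: "v \<odot>\<^bsub>Om\<^esub> (NR +>\<^bsub>FV\<^esub> x) = NR +>\<^bsub>FV\<^esub> (v \<odot>\<^bsub>FV\<^esub> x)" if "v \<in> carrier V" "x \<in> carrier FV" for v x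
    using that by (simp add: Om_eq Om.quot_smult)
  fix c assume c: "c \<in> Aplus"
  have cA: "c \<in> carrier A" by (rule Aplus.Icarr[OF c])
  have "om (\<pi> c) = (V_P A \<odot>\<^bsub>Om\<^esub> om c) \<ominus>\<^bsub>Om\<^esub> (V_of A (c [^] (p - 1)) \<odot>\<^bsub>Om\<^esub> om c)"
    using cA pi_closed[OF c] Om_rel[OF Omega_relsI(4)[OF c]]
    by (simp add: om_def sm FV.smult_closed a_minus_def)
  then show "(\<lambda>a\<in>carrier A. om a) (\<pi> c) = (V_P A \<odot>\<^bsub>Om\<^esub> (\<lambda>a\<in>carrier A. om a) c) \<ominus>\<^bsub>Om\<^esub>
      (V_of A (c [^] (p - 1)) \<odot>\<^bsub>Om\<^esub> (\<lambda>a\<in>carrier A. om a) c)"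
    using cA pi_closed[OF c] by simp
qed simp

text \<open>Because \<open>cd\<close> is a Beck derivation, the linear map on the free module that
  sends da to \<open>cd a\<close> kills the relations.\<close>

lemma Om_lift:
  obtains g where "linear_map V Om cot g" "\<And>a. a \<in> carrier A \<Longrightarrow> g (om a) = cd a"
proof -
  let ?E = "lin_ext V cot cd"
  have lin: "linear_map V FV cot ?E"
    using cd_closed by (intro cot.lin_ext_linear_map) auto
  have gen: "?E (free_gen V a) = cd a" if "a \<in> carrier A" for a
    using that cd_closed by (intro cot.lin_ext_gen)
  interpret h: abelian_group_hom FV cot ?E
    by (rule abelian_group_hom_linear_map[OF FV.M.abelian_group_axioms cot.M.abelian_group_axioms lin])
  note d = Der_pD[OF cd_Der]
  have cd_add: "cd (a \<oplus> b) = cd a \<oplus>\<^bsub>cot\<^esub> cd b" if "a \<in> carrier A" "b \<in> carrier A" for a b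
    using d(3)[OF that] that by simp
  have cd_smult: "cd (l \<odot> a) = V_of A (l \<odot> \<one>) \<odot>\<^bsub>cot\<^esub> cd a"
    if "l \<in> carrier k" "a \<in> carrier A" for l a
    using d(4)[OF that] that by simp
  have cd_mult: "cd (a \<otimes> b) = (V_of A a \<odot>\<^bsub>cot\<^esub> cd b) \<oplus>\<^bsub>cot\<^esub> (V_of A b \<odot>\<^bsub>cot\<^esub> cd a)"
    if "a \<in> carrier A" "b \<in> carrier A" for a b
    using d(5)[OF that] that by simp
  have cd_pi: "cd (\<pi> c) = (V_P A \<odot>\<^bsub>cot\<^esub> cd c) \<ominus>\<^bsub>cot\<^esub> (V_of A (c [^] (p - 1)) \<odot>\<^bsub>cot\<^esub> cd c)"
    if "c \<in> Aplus" for c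
    using d(6)[OF that] Aplus.Icarr[OF that] pi_closed[OF that] by simp
  have cd_one: "cd \<one> = \<zero>\<^bsub>cot\<^esub>"
    using Der_p_one[OF cot_left_module cd_Der] by simp
  note cl = cd_closed cot.smult_closed FV.smult_closed pi_closed Aplus.Icarr
  have rels: "?E r = \<zero>\<^bsub>cot\<^esub>" if "r \<in> rels" for r
    using that
  proof (cases rule: Omega_rels_cases)
    \<comment> \<open>Here d(l 1) = l d(1), and d(1) = 0 by the Leibniz rule.\<close>
    case (const l)
    then show ?thesis by (simp add: gen cd_smult cd_one cot.lm_smult_r_null)
  next
    case (linear l m a b)
    then show ?thesis
      by (simp add: gen cd_add cd_smult linear_map_smult[OF lin] cl a_minus_def cot.M.r_neg)
  next
    case (mult a b)
    then show ?thesis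
      by (simp add: gen cd_mult linear_map_smult[OF lin] cl a_minus_def cot.M.r_neg)
  next
    case (pi c)
    then have "c \<in> carrier A" "\<pi> c \<in> carrier A" by (simp_all add: cl)
    with pi show ?thesis
      by (simp add: gen cd_pi linear_map_smult[OF lin] cl a_minus_def cot.M.r_neg)
  qed
  have null: "?E x = \<zero>\<^bsub>cot\<^esub>" if "x \<in> NR" for x
  proof -
    have "NR \<subseteq> {x \<in> carrier FV. ?E x = \<zero>\<^bsub>cot\<^esub>}"
      using rels Omega_rels_closed
      by (intro FV.gen_submodule_subset FV.kernel_submodule[OF cot_left_module lin]) blast
    with that show ?thesis by blast
  qed
  show thesis
  proof (rule that)
    show "linear_map V Om cot (\<lambda>Y. the_elem (?E ` Y))"
      unfolding Om_eq by (rule Om.quot_lift_linear_map[OF cot_left_module lin null])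
    show "the_elem (?E ` om a) = cd a" if "a \<in> carrier A" for a
      using Om.quot_lift_eq[OF cot_left_module lin null, of "free_gen V a"] that
      by (simp add: om_def gen)
  qed
qed

text \<open>f lifts the derivation of \<open>Omega_p\<close> that sends a to da, and g sends da back
  to \<open>cd a\<close>; both composites are linear and fix the generators.\<close>

lemma cot_Om_isomorphic: "module_isomorphic V cot Om"
proof -
  obtain f where f: "linear_map V cot Om f" "\<And>a. a \<in> carrier A \<Longrightarrow> f (cd a) = om a"
    using Der_p_lift[OF Om_left_module om_Der] by auto
  obtain g where g: "linear_map V Om cot g" "\<And>a. a \<in> carrier A \<Longrightarrow> g (om a) = cd a"
    by (rule Om_lift) blast
  have id: "linear_map V cot cot (\<lambda>X. X)" by (auto simp: linear_map_def)
  have gf: "g (f X) = X" if "X \<in> carrier cot" for X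
    by (rule cot_linear_map_eq[OF linear_map_compose[OF f(1) g(1)] id _ that]) (simp add: f g)
  \<comment> \<open>Linear maps out of the quotient are compared after composition with the
    projection from the free module.\<close>
  have fg: "f (g Y) = Y" if "Y \<in> carrier Om" for Y
  proof -
    obtain x where x: "x \<in> carrier FV" "Y = NR +>\<^bsub>FV\<^esub> x"
      using \<open>Y \<in> carrier Om\<close> by (auto simp: Om_eq Om.quot_carrier)
    have c: "linear_map V FV Om (\<lambda>x. NR +>\<^bsub>FV\<^esub> x)"
      unfolding Om_eq by (rule Om.quot_linear_map)
    have "f (g (NR +>\<^bsub>FV\<^esub> x)) = NR +>\<^bsub>FV\<^esub> x"
      by (rule free_linear_map_eq[OF Om_left_module
            linear_map_compose[OF linear_map_compose[OF c g(1)] f(1)] c _ x(1)])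
         (simp add: f g om_def[symmetric])
    with x show ?thesis by simp
  qed
  let ?f = "\<lambda>X\<in>carrier cot. f X"
  have "linear_map V cot Om ?f"
    using f(1) cot.smult_closed by (auto simp: linear_map_def)
  then have "?f \<in> module_Hom V cot Om" by (simp add: module_Hom_iff)
  moreover have "bij_betw ?f (carrier cot) (carrier Om)"
    using gf fg linear_map_closed[OF f(1)] linear_map_closed[OF g(1)]
    by (intro bij_betw_byWitness[where f' = g]) auto
  ultimately show ?thesis unfolding module_isomorphic_def by blast
qed

end

theorem theorem2p9:
  fixes p :: nat
    and k :: "('k, 'c) ring_scheme"
    and A :: "('k, 'a, 'd) module_scheme"
    and eps :: "'a \<Rightarrow> 'k"
    and \<pi> :: "'a \<Rightarrow> 'a"
    and M :: "(nat \<Rightarrow> 'a, 'm, 'e) module_scheme"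
  assumes "char_p_field p k"
    and "pd_algebra p k A eps \<pi>"
    and "left_module (V_ring p k A eps) M"
  shows "bij_betw (\<lambda>f. \<lambda>a\<in>carrier A. f (cotangent_d k A a))
           (module_Hom (V_ring p k A eps) (cotangent p k A eps \<pi>) M)
           (Der_p p k A eps \<pi> M)
         \<and> module_isomorphic (V_ring p k A eps) (cotangent p k A eps \<pi>) (Omega_p p k A eps \<pi>)"
proof -
  have "cring A"
    using assms(2)
    by (simp add: pd_algebra_def augmented_algebra_def algebra_def)
  \<comment> \<open>The ring axioms of V(A) are part of the module structure of M.\<close>
  moreover have "ring (V_ring p k A eps)"
    using assms(3) by (simp add: left_module_def)
  ultimately interpret pd_square_V p k A eps \<pi>
    using assms(1,2) by (simp add: pd_square_V_def pd_square_def)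
  show ?thesis
    using Hom_Der_bij[OF assms(3)] cot_Om_isomorphic ..
qed

end
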